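(* Let $0<\beta<\tfrac12$ and let $a,\lambda,A,\gamma,\alpha$ be positive constants. Consider the following boundary value problem (fractional lumped formulation in the linear case) for $u=u(x,z,t)=u(x,z,t;\beta)$: $$D_*^{2\beta}u=a^2\frac{\partial^2u}{\partial z^2}-\lambda\frac{\partial u}{\partial z},\qquad 0<x,z,t<\infty,$$ subject to the boundary condition $$z=0:\quad D_*^{2\beta}u=\frac{\partial^2u}{\partial x^2}-2\gamma\frac{\partial u}{\partial x}+\alpha\frac{\partial u}{\partial z},\qquad 0<x,t<\infty,$$ and the additional conditions (a) $\frac{\partial u}{\partial x}-2\gamma u=-2\gamma A$ at $z=x=0$; (b) $u\to0$ as $x^2+z^2\to\infty$; (c) $u=0$ at $t=0$. Then the solution of this problem is given by $$u(x,z,t;\beta)=2\gamma A e^{\gamma x}\int_0^\infty\left(\frac{1}{\sqrt{\pi\tau}}e^{-\left(\frac{x^2}{4\tau}+\tau\gamma^2\right)}-\gamma e^{\gamma x}\,\mathrm{erfc}\!\left(\frac{x}{2\sqrt\tau}+\gamma\sqrt\tau\right)\right)e^{\frac{\lambda}{2a^2}(z+\alpha\tau)}\,g_2(t,\tau,z;\beta)\,d\tau,$$ where $g_2(t,\tau,z;\beta)$ is the Laplace convolution (in the variable $t$) of two functions, $$g_2(t,\tau,z;\beta)=L^{-1}\!\left(\frac{e^{-\tau p^{2\beta}}}{p}\right)*L^{-1}\!\left(e^{-\frac{z+\alpha\tau}{a}\sqrt{p^{2\beta}+\frac{\lambda^2}{4a^2}}}\right).$$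
   Context: The Caputo fractional derivative $D_*^{2\beta}$ acts in the variable $t$. For $m\in\mathbb N$, $D_*^{\delta}f(t)=\frac{1}{\Gamma(m-\delta)}\int_0^t\frac{f^{(m)}(s)}{(t-s)^{\delta+1-m}}\,ds$ if $m-1<\delta<m$, and $D_*^{m}f(t)=\frac{d^mf}{dt^m}(t)$; in particular, for $0<2\beta<1$, $D_*^{2\beta}f(t)=\frac{1}{\Gamma(1-2\beta)}\int_0^t (t-s)^{-2\beta}f'(s)\,ds$. The Laplace transform is $\bar f(p)=L[f(t)]=\int_0^\infty e^{-pt}f(t)\,dt$, $\operatorname{Re}(p)>0$, and $L^{-1}$ is its inverse, from functions of $p$ to functions of $t$ (here $\tau,z$ are parameters). Powers and square roots are principal branches. Convolution is $(f*g)(t)=\int_0^t f(t-s)g(s)\,ds$. $\mathrm{erfc}$ is the complementary error function, $\mathrm{erfc}(y)=\frac{2}{\sqrt\pi}\int_y^\infty e^{-s^2}\,ds$. *)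

theory Defs
  imports "HOL-Analysis.Analysis"
begin

definition erfc :: "real \<Rightarrow> real" where
  "erfc y = 2 / sqrt pi * (LBINT s:{y..}. exp (- s\<^sup>2))"

text \<open>
  Caputo derivative of order \<open>\<delta> > 0\<close>, based at \<open>0\<close>. With \<open>m = \<lceil>\<delta>\<rceil>\<close>, either \<open>\<delta> = m\<close> or
  \<open>m - 1 < \<delta> < m\<close>. The integral is only meaningful under \<open>caputo_differentiable\<close>, which asks for
  the pointwise derivatives up to order \<open>m\<close> on \<open>(0,t]\<close> and for an integrable integrand; neither
  depends on differentiability at the base point.
\<close>

definition caputo :: "real \<Rightarrow> (real \<Rightarrow> real) \<Rightarrow> real \<Rightarrow> real" where
  "caputo \<delta> f t =
    (let m = nat \<lceil>\<delta>\<rceil> in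
      if \<delta> = real m then (deriv ^^ m) f t
      else 1 / Gamma (real m - \<delta>) *
        (LBINT s:{0..t}. (deriv ^^ m) f s / (t - s) powr (\<delta> + 1 - real m)))"

definition caputo_differentiable :: "real \<Rightarrow> (real \<Rightarrow> real) \<Rightarrow> real \<Rightarrow> bool" where
  "caputo_differentiable \<delta> f t \<longleftrightarrow>
    (let m = nat \<lceil>\<delta>\<rceil> in
      (\<forall>k<m. \<forall>s\<in>{0<..t}. (deriv ^^ k) f differentiable (at s)) \<and>
      (\<delta> \<noteq> real m \<longrightarrow>
        set_integrable lborel {0..t}
          (\<lambda>s. (deriv ^^ m) f s / (t - s) powr (\<delta> + 1 - real m))))"

definition laplace :: "(real \<Rightarrow> real) \<Rightarrow> complex \<Rightarrow> complex" where
  "laplace f p = (LBINT t:{0..}. exp (- p * of_real t) * of_real (f t))"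

text \<open>
  By Lerch's theorem a transform determines \<open>f\<close> almost everywhere on \<open>(0,\<infinity>)\<close>. Continuity on
  \<open>(0,\<infinity>)\<close> makes the inverse unique there; its values on \<open>(-\<infinity>,0]\<close> are left unspecified and do
  not affect any convolution.
\<close>

definition is_inverse_laplace :: "(complex \<Rightarrow> complex) \<Rightarrow> (real \<Rightarrow> real) \<Rightarrow> bool" where
  "is_inverse_laplace F f \<longleftrightarrow>
    continuous_on {0<..} f \<and>
    (\<forall>p. Re p > 0 \<longrightarrow>
      set_integrable lborel {0..} (\<lambda>t. exp (- p * of_real t) * complex_of_real (f t)) \<and>
      laplace f p = F p)"

definition inverse_laplace :: "(complex \<Rightarrow> complex) \<Rightarrow> real \<Rightarrow> real" where
  "inverse_laplace F = (SOME f. is_inverse_laplace F f)"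

definition convolution :: "(real \<Rightarrow> real) \<Rightarrow> (real \<Rightarrow> real) \<Rightarrow> real \<Rightarrow> real" where
  "convolution f g t = (LBINT s:{0..t}. f (t - s) * g s)"

definition g2 :: "real \<Rightarrow> real \<Rightarrow> real \<Rightarrow> real \<Rightarrow> real \<Rightarrow> real \<Rightarrow> real \<Rightarrow> real" where
  "g2 a lam \<alpha> t \<tau> z \<beta> =
    convolution
      (inverse_laplace (\<lambda>p. exp (- of_real \<tau> * p powr of_real (2 * \<beta>)) / p))
      (inverse_laplace (\<lambda>p. exp (- of_real ((z + \<alpha> * \<tau>) / a) *
          csqrt (p powr of_real (2 * \<beta>) + of_real (lam\<^sup>2 / (4 * a\<^sup>2))))))
      t"

text \<open>
  Classical solutions on the closed octant \<open>x, z, t \<ge> 0\<close>. All derivatives occurring in an equation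
  are required to exist where that equation is imposed; the \<open>z\<close>-derivative at \<open>z = 0\<close> and the
  \<open>x\<close>-derivative at \<open>x = z = 0\<close> are one-sided. No equation is imposed on the face \<open>x = 0\<close>, \<open>z > 0\<close>,
  where \<open>u\<close> is determined by continuity. The decay as \<open>x\<^sup>2 + z\<^sup>2 \<rightarrow> \<infinity>\<close> is uniform for \<open>t\<close> in
  bounded intervals; it cannot be uniform for all \<open>t\<close>, because \<open>u \<rightarrow> A\<close> as \<open>t \<rightarrow> \<infinity>\<close>.
\<close>

definition lumped_solution ::
  "real \<Rightarrow> real \<Rightarrow> real \<Rightarrow> real \<Rightarrow> real \<Rightarrow> real \<Rightarrow> (real \<Rightarrow> real \<Rightarrow> real \<Rightarrow> real) \<Rightarrow> bool" where
  "lumped_solution \<beta> a lam A \<gamma> \<alpha> u \<longleftrightarrow>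
    continuous_on ({0..} \<times> {0..} \<times> {0..}) (\<lambda>(x, z, t). u x z t) \<and>
    (\<forall>x>0. \<forall>z>0. \<forall>t>0.
      caputo_differentiable (2 * \<beta>) (\<lambda>s. u x z s) t \<and>
      (\<lambda>\<zeta>. u x \<zeta> t) differentiable (at z) \<and>
      deriv (\<lambda>\<zeta>. u x \<zeta> t) differentiable (at z) \<and>
      caputo (2 * \<beta>) (\<lambda>s. u x z s) t =
        a\<^sup>2 * deriv (deriv (\<lambda>\<zeta>. u x \<zeta> t)) z - lam * deriv (\<lambda>\<zeta>. u x \<zeta> t) z) \<and>
    (\<forall>x>0. \<forall>t>0.
      caputo_differentiable (2 * \<beta>) (\<lambda>s. u x 0 s) t \<and>
      (\<lambda>\<xi>. u \<xi> 0 t) differentiable (at x) \<and>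
      deriv (\<lambda>\<xi>. u \<xi> 0 t) differentiable (at x) \<and>
      (\<exists>u\<^sub>z. ((\<lambda>\<zeta>. u x \<zeta> t) has_real_derivative u\<^sub>z) (at 0 within {0..}) \<and>
        caputo (2 * \<beta>) (\<lambda>s. u x 0 s) t =
          deriv (deriv (\<lambda>\<xi>. u \<xi> 0 t)) x - 2 * \<gamma> * deriv (\<lambda>\<xi>. u \<xi> 0 t) x + \<alpha> * u\<^sub>z)) \<and>
    (\<forall>t>0. \<exists>u\<^sub>x. ((\<lambda>\<xi>. u \<xi> 0 t) has_real_derivative u\<^sub>x) (at 0 within {0..}) \<and>
      u\<^sub>x - 2 * \<gamma> * u 0 0 t = - 2 * \<gamma> * A) \<and>
    (\<forall>T>0. \<forall>\<epsilon>>0. \<exists>R. \<forall>x\<ge>0. \<forall>z\<ge>0. \<forall>t\<in>{0..T}. x\<^sup>2 + z\<^sup>2 > R \<longrightarrow> \<bar>u x z t\<bar> < \<epsilon>) \<and>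
    (\<forall>x\<ge>0. \<forall>z\<ge>0. u x z 0 = 0)"

end

theory Submission
  imports
    Defs
    "HOL-Complex_Analysis.Complex_Analysis"
    "HOL-Probability.Distributions"
    "HOL-Real_Asymp.Real_Asymp"
begin

text \<open>
  Existence. Write \<open>P p = p\<^sup>2\<^sup>\<beta>\<close>. In the Laplace variable \<open>p\<close> dual to \<open>t\<close> the problem becomes
  algebraic: decay in \<open>z\<close> selects the root \<open>m\<close> of \<open>a\<^sup>2 m\<^sup>2 + \<lambda> m = P\<close> with nonnegative real part,
  decay in \<open>x\<close> selects \<open>s\<close> with \<open>s\<^sup>2 = \<gamma>\<^sup>2 + P + \<alpha> m\<close>, and the transform of \<open>u\<close> is
  \<open>2\<gamma>A exp (-x (s - \<gamma>)) exp (-z m) / (p (s + \<gamma>))\<close>, which is \<open>O(\<bar>p\<bar>\<^sup>-\<^sup>1\<^sup>-\<^sup>\<beta>)\<close> on \<open>Re p = 1\<close>.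
  Its Bromwich integral is therefore absolutely convergent, and for \<open>x > 0\<close> the integrand decays
  faster than any power, so all derivatives may be taken under the integral sign and the equations
  reduce to the identities for \<open>m\<close> and \<open>s\<close>. Only the \<open>x\<close>-derivative at \<open>x = z = 0\<close> needs more:
  there one integrates by parts in \<open>p\<close> first.

  Formula. The factor of the integrand that depends on \<open>x\<close> has the Laplace transform
  \<open>exp (-x s) / (s + \<gamma>)\<close> in \<open>\<tau>\<close>, evaluated at \<open>P + \<alpha> m\<close>; exchanging the integrals over \<open>\<tau>\<close> and \<open>p\<close>
  gives the stated formula.

  Uniqueness. A Caputo derivative of order less than one is positive at the time of a positive
  maximum, while the right-hand sides of the equations are nonpositive there.
\<close>

section \<open>Parametric integrals\<close>

text \<open>The right half-plane suffices because 2 \<beta> < 1: there |arg P| < pi \<beta> < pi/2,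
  so Re P \<ge> cos (pi \<beta>) |p|^(2 \<beta>), both radicands stay off the branch cut and both
  square roots have real part at least a multiple of |p|^\<beta>. At x = z = 0 no exponential helps,
  and only the factor 1/(s + \<gamma>) is left to improve on 1/p. The corner is delicate because one
  x-derivative cancels exactly that factor: the symbol 1/p remains, which is not absolutely
  integrable on a line. Multiplying by t, that is differentiating the symbol in p, leaves O(|p|^(2
  \<beta> - 2)), which is integrable, uniformly in small x. The interior equation contains no
  x-derivative, so the maximum principle runs on slices of fixed x: a maximum over the face z = 0 is
  first shown to dominate every slice, and only then is the one-sided z-derivative at it known to be
  nonpositive.\<close>

lemma tendsto_integral_dominated:
  fixes h :: "'a::first_countable_topology \<Rightarrow> 'b \<Rightarrow> 'c::{banach, second_countable_topology}"
  assumes meas: "\<And>s. s \<in> S \<Longrightarrow> h s \<in> borel_measurable M"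
    and lim: "\<And>y. ((\<lambda>s. h s y) \<longlongrightarrow> l y) (at a within S)"
    and l: "l \<in> borel_measurable M"
    and int: "integrable M g"
    and bound: "\<And>s y. s \<in> S \<Longrightarrow> s \<noteq> a \<Longrightarrow> norm (h s y) \<le> g y"
  shows "((\<lambda>s. integral\<^sup>L M (h s)) \<longlongrightarrow> integral\<^sup>L M l) (at a within S)"
  \<comment> \<open>First countability lets the limit be tested along sequences, where dominated
    convergence is available. These sequences avoid \<open>a\<close>, so the bound is asked for only
    at \<open>s \<noteq> a\<close>, as difference quotients require.\<close>
  unfolding tendsto_at_iff_sequentially o_def
proof safe
  fix X :: "nat \<Rightarrow> 'a"
  assume X: "\<forall>i. X i \<in> S - {a}" and "X \<longlonglongrightarrow> a"
  show "(\<lambda>n. integral\<^sup>L M (h (X n))) \<longlonglongrightarrow> integral\<^sup>L M l"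
  proof (rule integral_dominated_convergence[OF l _ int])
    show "AE y in M. (\<lambda>i. h (X i) y) \<longlonglongrightarrow> l y"
      using lim X \<open>X \<longlonglongrightarrow> a\<close> unfolding tendsto_at_iff_sequentially o_def by blast
  qed (use X meas bound in auto)
qed

lemma continuous_on_integral_dominated:
  fixes h :: "'a::first_countable_topology \<Rightarrow> 'b \<Rightarrow> 'c::{banach, second_countable_topology}"
  assumes meas: "\<And>s. s \<in> S \<Longrightarrow> h s \<in> borel_measurable M"
    and cont: "\<And>y. continuous_on S (\<lambda>s. h s y)"
    and int: "integrable M g"
    and bound: "\<And>s y. s \<in> S \<Longrightarrow> norm (h s y) \<le> g y"
  shows "continuous_on S (\<lambda>s. integral\<^sup>L M (h s))"
  unfolding continuous_on
proof
  fix a assume "a \<in> S"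
  show "((\<lambda>s. integral\<^sup>L M (h s)) \<longlongrightarrow> integral\<^sup>L M (h a)) (at a within S)"
    using cont \<open>a \<in> S\<close> unfolding continuous_on
    by (intro tendsto_integral_dominated[OF meas _ meas int bound]) auto
qed

text \<open>Where Q does not vanish, exp (-\<zeta> \<rho>) has modulus at most 1 on the convex set
  S, so the mean value bound dominates every difference quotient by |Q \<rho>|. The sign condition
  is tied to Q so that an indicator inside Q can discard part of the domain.\<close>

lemma has_field_derivative_exp_integral:
  fixes Q \<rho> :: "'b \<Rightarrow> complex"
  assumes Q: "integrable M Q" and Q\<rho>: "integrable M (\<lambda>y. Q y * \<rho> y)"
    and meas[measurable]: "\<rho> \<in> borel_measurable M"
    and S: "convex S" "\<xi> \<in> S"
    and re: "\<And>\<zeta> y. \<zeta> \<in> S \<Longrightarrow> Q y \<noteq> 0 \<Longrightarrow> 0 \<le> Re (\<zeta> * \<rho> y)"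
  shows "((\<lambda>\<zeta>. \<integral>y. Q y * exp (- \<zeta> * \<rho> y) \<partial>M) has_field_derivative
           - (\<integral>y. Q y * \<rho> y * exp (- \<xi> * \<rho> y) \<partial>M)) (at \<xi> within S)"
proof -
  have [measurable]: "Q \<in> borel_measurable M"
    using Q by (rule borel_measurable_integrable)
  have le1: "norm (Q y * exp (- \<zeta> * \<rho> y)) \<le> norm (Q y)" if "\<zeta> \<in> S" for \<zeta> y
    using re[OF that, of y] by (cases "Q y = 0") (auto simp: norm_mult)
  have intQ: "integrable M (\<lambda>y. Q y * exp (- \<zeta> * \<rho> y))" if "\<zeta> \<in> S" for \<zeta>
    using le1[OF that] by (intro Bochner_Integration.integrable_bound[OF Q]) auto
  define h where "h \<zeta> y = (Q y * exp (- \<zeta> * \<rho> y) - Q y * exp (- \<xi> * \<rho> y)) / (\<zeta> - \<xi>)" for \<zeta> y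
  have h_meas: "h \<zeta> \<in> borel_measurable M" for \<zeta>
    unfolding h_def[abs_def] by measurable
  have der: "((\<lambda>\<zeta>. Q y * exp (- \<zeta> * \<rho> y)) has_field_derivative - (Q y * \<rho> y * exp (- \<zeta> * \<rho> y)))
      (at \<zeta> within S)" for y \<zeta>
    by (auto intro!: derivative_eq_intros)
  have "((\<lambda>\<zeta>. integral\<^sup>L M (h \<zeta>)) \<longlongrightarrow> (\<integral>y. - (Q y * \<rho> y * exp (- \<xi> * \<rho> y)) \<partial>M)) (at \<xi> within S)"
  proof (rule tendsto_integral_dominated)
    show "((\<lambda>\<zeta>. h \<zeta> y) \<longlongrightarrow> - (Q y * \<rho> y * exp (- \<xi> * \<rho> y))) (at \<xi> within S)" for y
      using der[of y \<xi>] unfolding has_field_derivative_iff h_def .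
    show "integrable M (\<lambda>y. norm (Q y * \<rho> y))"
      using Q\<rho> by simp
    show "norm (h \<zeta> y) \<le> norm (Q y * \<rho> y)" if "\<zeta> \<in> S" "\<zeta> \<noteq> \<xi>" for \<zeta> y
    proof -
      have "norm (Q y * exp (- \<zeta> * \<rho> y) - Q y * exp (- \<xi> * \<rho> y)) \<le> norm (Q y * \<rho> y) * norm (\<zeta> - \<xi>)"
      proof (rule field_differentiable_bound[OF S(1) der])
        show "norm (- (Q y * \<rho> y * exp (- z * \<rho> y))) \<le> norm (Q y * \<rho> y)" if "z \<in> S" for z
          using mult_right_mono[OF le1[OF that, of y], of "norm (\<rho> y)"]
          by (simp add: norm_mult mult_ac)
      qed (use that S in auto)
      then show ?thesis
        using that by (simp add: h_def norm_divide divide_simps)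
    qed
  qed (auto simp: h_meas)
  moreover have "\<forall>\<^sub>F \<zeta> in at \<xi> within S. integral\<^sup>L M (h \<zeta>) =
     ((\<integral>y. Q y * exp (- \<zeta> * \<rho> y) \<partial>M) - (\<integral>y. Q y * exp (- \<xi> * \<rho> y) \<partial>M)) / (\<zeta> - \<xi>)"
    using intQ S(2) unfolding h_def
    by (auto simp: eventually_at_filter intro!: eventuallyI)
  ultimately show ?thesis
    unfolding has_field_derivative_iff
    by (auto elim!: Lim_transform_eventually)
qed

text \<open>The half-line embedded in the complex plane is convex, so complex differentiation within
  it applies; \<xi> = 0 gives the one-sided derivative required at z = 0.\<close>

lemma has_vector_derivative_exp_integral:
  fixes Q \<rho> :: "'b \<Rightarrow> complex" and \<xi> :: real
  assumes Q: "integrable M Q" and Q\<rho>: "integrable M (\<lambda>y. Q y * \<rho> y)"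
    and meas: "\<rho> \<in> borel_measurable M"
    and re: "\<And>y. Q y \<noteq> 0 \<Longrightarrow> 0 \<le> Re (\<rho> y)" and \<xi>: "0 \<le> \<xi>"
  shows "((\<lambda>\<zeta>. \<integral>y. Q y * exp (- of_real \<zeta> * \<rho> y) \<partial>M) has_vector_derivative
           - (\<integral>y. Q y * \<rho> y * exp (- of_real \<xi> * \<rho> y) \<partial>M)) (at \<xi> within {0..})"
proof -
  have "((\<lambda>\<zeta>. \<integral>y. Q y * exp (- \<zeta> * \<rho> y) \<partial>M) has_field_derivative
           - (\<integral>y. Q y * \<rho> y * exp (- of_real \<xi> * \<rho> y) \<partial>M)) (at (of_real \<xi>) within of_real ` {0..})"
    using re \<xi>
    by (intro has_field_derivative_exp_integral[OF Q Q\<rho> meas] convex_linear_image)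
       (auto intro!: mult_nonneg_nonneg simp: linear_iff scaleR_conv_of_real)
  moreover have "(complex_of_real has_vector_derivative 1) (at \<xi> within {0..})"
    unfolding has_vector_derivative_def using bounded_linear_imp_has_derivative[OF bounded_linear_of_real]
    by (simp add: scaleR_conv_of_real)
  ultimately show ?thesis
    by (drule_tac field_vector_diff_chain_within) (simp_all add: o_def)
qed

text \<open>A majorant that separates the variables reduces joint integrability to two
  one-dimensional integrals. Each exchange of a Bromwich integral with an integral over time or over
  \<tau> rests on it.\<close>

lemma Fubini_lborel_product_bound:
  fixes F :: "real \<Rightarrow> real \<Rightarrow> 'c::{banach, second_countable_topology}"
  assumes meas[measurable]: "(\<lambda>(x, y). F x y) \<in> borel_measurable (lborel \<Otimes>\<^sub>M lborel)"
    and g: "integrable lborel g" and h: "integrable lborel h"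
    and bound: "\<And>x y. norm (F x y) \<le> g x * (h y :: real)"
  shows "(\<integral>x. (\<integral>y. F x y \<partial>lborel) \<partial>lborel) = (\<integral>y. (\<integral>x. F x y \<partial>lborel) \<partial>lborel)"
    and "integrable lborel (\<lambda>x. \<integral>y. F x y \<partial>lborel)"
proof -
  have Fx: "integrable lborel (F x)" for x
    using bound by (intro Bochner_Integration.integrable_bound[OF integrable_mult_right[OF h, of "g x"]])
      (auto intro: order_trans[OF bound] abs_ge_self)
  have "integrable (lborel \<Otimes>\<^sub>M lborel) (\<lambda>(x, y). F x y)"
  proof (rule lborel_pair.Fubini_integrable)
    show "integrable lborel (\<lambda>x. LINT y|lborel. norm (case (x, y) of (x, y) \<Rightarrow> F x y))"
    proof (rule Bochner_Integration.integrable_bound[OF integrable_mult_left[OF g, of "integral\<^sup>L lborel h"]])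
      show "AE x in lborel. norm (LINT y|lborel. norm (case (x, y) of (x, y) \<Rightarrow> F x y))
            \<le> norm (g x * integral\<^sup>L lborel h)"
      proof (rule AE_I2)
        fix x
        have "(LINT y|lborel. norm (F x y)) \<le> (LINT y|lborel. g x * h y)"
          using bound Fx h by (intro integral_mono) auto
        then show "norm (LINT y|lborel. norm (case (x, y) of (x, y) \<Rightarrow> F x y))
            \<le> norm (g x * integral\<^sup>L lborel h)"
          by (simp add: integral_nonneg_AE)
      qed
    qed simp
  qed (use Fx in auto)
  from lborel_pair.Fubini_integral[OF this] lborel_pair.integrable_fst'[OF this]
  show "(\<integral>x. (\<integral>y. F x y \<partial>lborel) \<partial>lborel) = (\<integral>y. (\<integral>x. F x y \<partial>lborel) \<partial>lborel)"
    and "integrable lborel (\<lambda>x. \<integral>y. F x y \<partial>lborel)"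
    by simp_all
qed

section \<open>Integrable powers on vertical lines\<close>

lemma set_integrable_lborel_iff:
  fixes f :: "real \<Rightarrow> 'a::euclidean_space"
  assumes [measurable]: "set_borel_measurable borel A f"
  shows "set_integrable lborel A f \<longleftrightarrow> f absolutely_integrable_on A"
  using assms unfolding set_integrable_def set_borel_measurable_def
  by (simp add: integrable_completion)

text \<open>The integrable tail of x^(-k) on [\<sigma>, \<infinity>), once shifted and once shifted
  and reflected, covers the two half-lines.\<close>

lemma integrable_abs_powr:
  fixes k \<sigma> :: real
  assumes "1 < k" "0 < \<sigma>"
  shows "integrable lborel (\<lambda>\<omega>. (\<sigma> + \<bar>\<omega>\<bar>) powr - k)"
proof -
  have "(\<lambda>x. x powr - k) absolutely_integrable_on {\<sigma>..}"
    using has_integral_powr_to_inf[of "-k" \<sigma>] assms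
    by (intro nonnegative_absolutely_integrable_1) (auto simp: integrable_on_def)
  then have "set_integrable lborel {\<sigma>..} (\<lambda>x. x powr - k)"
    by (subst set_integrable_lborel_iff) (auto simp: set_borel_measurable_def)
  then have *: "integrable lborel (\<lambda>x. indicator {\<sigma>..} x * x powr - k)"
    by (simp add: set_integrable_def)
  have "integrable lborel (\<lambda>x. indicator {\<sigma>..} (\<sigma> + x) * (\<sigma> + x) powr - k)"
    using lborel_integrable_real_affine[OF *, of 1 \<sigma>] by simp
  moreover have "integrable lborel (\<lambda>x. indicator {\<sigma>..} (\<sigma> - x) * (\<sigma> - x) powr - k)"
    using lborel_integrable_real_affine[OF *, of "-1" \<sigma>] by simp
  ultimately have "integrable lborel (\<lambda>x. indicator {\<sigma>..} (\<sigma> + x) * (\<sigma> + x) powr - k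
      + indicator {\<sigma>..} (\<sigma> - x) * (\<sigma> - x) powr - k)"
    by (rule Bochner_Integration.integrable_add)
  then show ?thesis
    by (rule Bochner_Integration.integrable_bound) (auto simp: indicator_def abs_if)
qed

text \<open>The standard majorant on the line Re p = \<sigma>; it follows from \<sigma> + |\<omega>|
  \<le> 2 |\<sigma> + i \<omega>|.\<close>

lemma integrable_norm_line:
  fixes k \<sigma> :: real
  assumes "1 < k" "0 < \<sigma>"
  shows "integrable lborel (\<lambda>\<omega>. norm (Complex \<sigma> \<omega>) powr - k)"
proof (rule Bochner_Integration.integrable_bound[OF integrable_mult_right[OF integrable_abs_powr[OF assms], of "2 powr k"]])
  show "(\<lambda>\<omega>. norm (Complex \<sigma> \<omega>) powr - k) \<in> borel_measurable lborel"
    unfolding cmod_def by simp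
  show "AE \<omega> in lborel. norm (norm (Complex \<sigma> \<omega>) powr - k) \<le> norm (2 powr k * (\<sigma> + \<bar>\<omega>\<bar>) powr - k)"
  proof (rule AE_I2)
    fix \<omega>
    have "\<sigma> + \<bar>\<omega>\<bar> \<le> 2 * norm (Complex \<sigma> \<omega>)"
      using abs_Re_le_cmod[of "Complex \<sigma> \<omega>"] abs_Im_le_cmod[of "Complex \<sigma> \<omega>"] assms by simp
    then have "(2 * norm (Complex \<sigma> \<omega>)) powr - k \<le> (\<sigma> + \<bar>\<omega>\<bar>) powr - k"
      using assms by (intro powr_mono2') auto
    then have "2 powr k * (2 * norm (Complex \<sigma> \<omega>)) powr - k \<le> 2 powr k * (\<sigma> + \<bar>\<omega>\<bar>) powr - k"
      by (intro mult_left_mono) auto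
    then have "norm (Complex \<sigma> \<omega>) powr - k \<le> 2 powr k * (\<sigma> + \<bar>\<omega>\<bar>) powr - k"
      by (simp add: powr_mult powr_add[symmetric] flip: mult.assoc)
    then show "norm (norm (Complex \<sigma> \<omega>) powr - k) \<le> norm (2 powr k * (\<sigma> + \<bar>\<omega>\<bar>) powr - k)"
      by simp
  qed
qed

section \<open>Line integrals of holomorphic functions and Lerch's theorem\<close>

text \<open>The line is approximated by the left side of a rectangle of width R and height 2 R. The
  other three sides have total length 4 R and lie in |w| \<ge> R, so they contribute O(R^(1 - k)),
  which vanishes as R grows because k > 1. The left side runs downwards, hence v is -i times the
  line integral.\<close>

lemma line_integral_eq_rectangle:
  fixes H :: "complex \<Rightarrow> complex"
  assumes "1 < k" "0 < \<sigma>"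
    and int: "integrable lborel (\<lambda>\<omega>. H (Complex \<sigma> \<omega>))"
    and bound: "\<And>w. \<sigma> \<le> Re w \<Longrightarrow> R0 \<le> norm w \<Longrightarrow> norm (H w) \<le> C * norm w powr - k"
    and rect: "\<And>R. R0 \<le> R \<Longrightarrow>
      (H has_contour_integral v) (rectpath (Complex \<sigma> (- R)) (Complex (\<sigma> + R) R))"
  shows "(LBINT \<omega>. H (Complex \<sigma> \<omega>)) = \<i> * v"
proof -
  define I where "I R = (LBINT \<omega>:{-R..R}. H (Complex \<sigma> \<omega>))" for R
  define J where "J n = I (real n)" for n
  have est: "norm (I R - \<i> * v) \<le> 4 * \<bar>C\<bar> * R powr (1 - k)" if R: "R0 \<le> R" "0 < R" for R
  proof -
    define a1 a2 a3 a4 where "a1 = Complex \<sigma> (- R)" and "a2 = Complex (\<sigma> + R) (- R)"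
      and "a3 = Complex (\<sigma> + R) R" and "a4 = Complex \<sigma> R"
    note a = a1_def a2_def a3_def a4_def
    have rp: "rectpath a1 a3 = linepath a1 a2 +++ linepath a2 a3 +++ linepath a3 a4 +++ linepath a4 a1"
      by (simp add: rectpath_def Let_def a)
    have v: "(H has_contour_integral v) (linepath a1 a2 +++ linepath a2 a3 +++ linepath a3 a4 +++ linepath a4 a1)"
      using rect[OF R(1)] rp by (simp add: a)
    then have ci: "H contour_integrable_on (linepath a1 a2 +++ linepath a2 a3 +++ linepath a3 a4 +++ linepath a4 a1)"
      by (rule has_contour_integral_integrable)
    then have c12: "H contour_integrable_on linepath a1 a2"
      and c2: "H contour_integrable_on (linepath a2 a3 +++ linepath a3 a4 +++ linepath a4 a1)"
      by (auto dest: contour_integrable_joinD1 contour_integrable_joinD2)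
    from c2 have c23: "H contour_integrable_on linepath a2 a3"
      and c3: "H contour_integrable_on (linepath a3 a4 +++ linepath a4 a1)"
      by (auto dest: contour_integrable_joinD1 contour_integrable_joinD2)
    from c3 have c34: "H contour_integrable_on linepath a3 a4"
      and c41: "H contour_integrable_on linepath a4 a1"
      by (auto dest: contour_integrable_joinD1 contour_integrable_joinD2)
    have sum: "v = contour_integral (linepath a1 a2) H + (contour_integral (linepath a2 a3) H
        + (contour_integral (linepath a3 a4) H + contour_integral (linepath a4 a1) H))"
      using contour_integral_unique[OF v] c12 c2 c23 c3 c34 c41 by (simp add: contour_integral_join)
    have set_int: "set_integrable lborel {-R..R} (\<lambda>\<omega>. H (Complex \<sigma> \<omega>))"
      unfolding set_integrable_def using int by (intro integrable_mult_indicator) auto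
    have "((\<lambda>\<omega>. H (Complex \<sigma> \<omega>)) has_integral I R) {-R..R}"
      unfolding I_def using set_borel_integral_eq_integral[OF set_int] by (simp add: has_integral_integral)
    then have "(H has_contour_integral (\<i> * I R)) (linepath a1 a4)"
      using R by (subst has_contour_integral_linepath_same_Re_iff[where a = "-R" and b = R]) (auto simp: a)
    then have "(H has_contour_integral - (\<i> * I R)) (linepath a4 a1)"
      by (rule has_contour_integral_reverse_linepath)
    then have c4: "contour_integral (linepath a4 a1) H = - (\<i> * I R)"
      by (rule contour_integral_unique)
    have seg: "norm (H w) \<le> \<bar>C\<bar> * R powr - k" if "\<sigma> \<le> Re w" "R \<le> norm w" for w
    proof -
      have "norm (H w) \<le> C * norm w powr - k"
        using bound[of w] that R by simp
      also have "\<dots> \<le> \<bar>C\<bar> * R powr - k"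
        using that R \<open>1 < k\<close> by (intro mult_mono powr_mono2') auto
      finally show ?thesis .
    qed
    have b12: "norm (contour_integral (linepath a1 a2) H) \<le> \<bar>C\<bar> * R powr - k * norm (a2 - a1)"
    proof (rule contour_integral_bound_linepath[OF c12])
      fix w assume "w \<in> closed_segment a1 a2"
      moreover have "closed_segment a1 a2 \<subseteq> {w. \<sigma> \<le> Re w} \<inter> {w. Im w \<le> - R}"
        using R by (intro closed_segment_subset convex_Int convex_halfspace_Re_ge convex_halfspace_Im_le) (auto simp: a)
      ultimately show "norm (H w) \<le> \<bar>C\<bar> * R powr - k"
        using abs_Im_le_cmod[of w] by (intro seg) auto
    qed simp
    have b23: "norm (contour_integral (linepath a2 a3) H) \<le> \<bar>C\<bar> * R powr - k * norm (a3 - a2)"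
    proof (rule contour_integral_bound_linepath[OF c23])
      fix w assume "w \<in> closed_segment a2 a3"
      moreover have "closed_segment a2 a3 \<subseteq> {w. \<sigma> + R \<le> Re w}"
        using R by (intro closed_segment_subset convex_halfspace_Re_ge) (auto simp: a)
      ultimately show "norm (H w) \<le> \<bar>C\<bar> * R powr - k"
        using complex_Re_le_cmod[of w] R \<open>0 < \<sigma>\<close> by (intro seg) auto
    qed simp
    have b34: "norm (contour_integral (linepath a3 a4) H) \<le> \<bar>C\<bar> * R powr - k * norm (a4 - a3)"
    proof (rule contour_integral_bound_linepath[OF c34])
      fix w assume "w \<in> closed_segment a3 a4"
      moreover have "closed_segment a3 a4 \<subseteq> {w. \<sigma> \<le> Re w} \<inter> {w. R \<le> Im w}"
        using R by (intro closed_segment_subset convex_Int convex_halfspace_Re_ge convex_halfspace_Im_ge) (auto simp: a)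
      ultimately show "norm (H w) \<le> \<bar>C\<bar> * R powr - k"
        using abs_Im_le_cmod[of w] by (intro seg) auto
    qed simp
    have n: "norm (a2 - a1) = R" "norm (a3 - a2) = 2 * R" "norm (a4 - a3) = R"
      using R by (auto simp: a cmod_def real_sqrt_mult)
    have "\<i> * (I R - \<i> * v) = contour_integral (linepath a1 a2) H + (contour_integral (linepath a2 a3) H
        + contour_integral (linepath a3 a4) H)"
      using sum c4 by (simp add: algebra_simps)
    then have "norm (I R - \<i> * v) = norm (contour_integral (linepath a1 a2) H + (contour_integral (linepath a2 a3) H
        + contour_integral (linepath a3 a4) H))"
      by (metis norm_mult norm_ii mult_1)
    also have "\<dots> \<le> 4 * \<bar>C\<bar> * (R powr - k * R)"
      using b12 b23 b34 unfolding n
      by (intro order_trans[OF norm_triangle_ineq] order_trans[OF add_left_mono[OF norm_triangle_ineq]]) (simp add: algebra_simps)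
    also have "R powr - k * R = R powr (1 - k)"
      using powr_mult_base[of R "-k"] R by (simp add: mult.commute)
    finally show ?thesis .
  qed
  have "J \<longlonglongrightarrow> (LBINT \<omega>. H (Complex \<sigma> \<omega>))"
    unfolding J_def I_def set_lebesgue_integral_def
  proof (rule integral_dominated_convergence)
    show "integrable lborel (\<lambda>\<omega>. norm (H (Complex \<sigma> \<omega>)))"
      using int by simp
    show "AE \<omega> in lborel. (\<lambda>n. indicat_real {- real n..real n} \<omega> *\<^sub>R H (Complex \<sigma> \<omega>)) \<longlonglongrightarrow> H (Complex \<sigma> \<omega>)"
    proof (rule AE_I2, rule tendsto_eventually)
      fix \<omega> :: real
      obtain N :: nat where "\<bar>\<omega>\<bar> \<le> real N"
        using real_arch_simple by blast
      then show "\<forall>\<^sub>F n in sequentially. indicat_real {- real n..real n} \<omega> *\<^sub>R H (Complex \<sigma> \<omega>) = H (Complex \<sigma> \<omega>)"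
        by (intro eventually_sequentiallyI[of N]) (auto simp: indicator_def)
    qed
  qed (use int borel_measurable_integrable[OF int] in \<open>auto simp: indicator_def\<close>)
  moreover have "J \<longlonglongrightarrow> \<i> * v"
  proof -
    have "(\<lambda>n. J n - \<i> * v) \<longlonglongrightarrow> 0"
    proof (rule Lim_null_comparison)
      obtain N :: nat where "R0 \<le> real N"
        using real_arch_simple by blast
      then show "\<forall>\<^sub>F n in sequentially. norm (J n - \<i> * v) \<le> 4 * \<bar>C\<bar> * real n powr (1 - k)"
        unfolding J_def by (intro eventually_sequentiallyI[of "max N 1"] est) auto
      show "(\<lambda>n. 4 * \<bar>C\<bar> * real n powr (1 - k)) \<longlonglongrightarrow> 0"
        using \<open>1 < k\<close> by real_asymp
    qed
    then show ?thesis
      using Lim_null by blast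
  qed
  ultimately show ?thesis
    by (rule LIMSEQ_unique)
qed

text \<open>The decay is imposed on the whole half-plane Re p \<ge> \<sigma>, not only on its edge,
  so that contours can be closed to the right. The domain of holomorphy does not depend on \<sigma>,
  so one symbol may be integrated along several lines.\<close>

definition decaying :: "real \<Rightarrow> (complex \<Rightarrow> complex) \<Rightarrow> bool" where
  "decaying \<sigma> G \<longleftrightarrow> G holomorphic_on {p. 0 < Re p} \<and>
    (\<exists>C k. 1 < k \<and> (\<forall>p. \<sigma> \<le> Re p \<longrightarrow> norm (G p) \<le> C * norm p powr - k))"

lemma decayingI:
  assumes "G holomorphic_on {p. 0 < Re p}" "1 < k"
    and "\<And>p. \<sigma> \<le> Re p \<Longrightarrow> norm (G p) \<le> C * norm p powr - k"
  shows "decaying \<sigma> G"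
  using assms unfolding decaying_def by blast

lemma continuous_Complex: "continuous_on A (Complex \<sigma>)"
  unfolding Complex_eq by (intro continuous_intros)

lemma continuous_on_line:
  assumes "continuous_on {p. 0 < Re p} G" "0 < \<sigma>"
  shows "continuous_on UNIV (\<lambda>\<omega>. G (Complex \<sigma> \<omega>))"
  using assms(2) by (intro continuous_on_compose2[OF assms(1) continuous_Complex]) auto

lemma measurable_line:
  assumes "continuous_on {p. 0 < Re p} G" "0 < \<sigma>"
  shows "(\<lambda>\<omega>. G (Complex \<sigma> \<omega>)) \<in> borel_measurable borel"
  using continuous_on_line[OF assms] by (rule borel_measurable_continuous_onI)

lemma integrable_line_bound:
  assumes "(\<lambda>\<omega>. G (Complex \<sigma> \<omega>)) \<in> borel_measurable borel" "1 < k" "0 < \<sigma>"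
    and "\<And>\<omega>. norm (G (Complex \<sigma> \<omega>) :: complex) \<le> C * norm (Complex \<sigma> \<omega>) powr - k"
  shows "integrable lborel (\<lambda>\<omega>. G (Complex \<sigma> \<omega>))"
  using assms
  by (intro Bochner_Integration.integrable_bound[OF integrable_mult_right[OF integrable_norm_line[of k \<sigma>], of C]])
     (auto intro: order_trans[OF _ abs_ge_self])

lemma decaying_integrable:
  assumes "decaying \<sigma> G" "0 < \<sigma>"
  shows "integrable lborel (\<lambda>\<omega>. G (Complex \<sigma> \<omega>))"
proof -
  obtain C k where "1 < k" "\<And>p. \<sigma> \<le> Re p \<Longrightarrow> norm (G p) \<le> C * norm p powr - k"
    using assms unfolding decaying_def by blast
  then show ?thesis
    using assms
    by (intro integrable_line_bound[of G \<sigma> k C] measurable_line holomorphic_on_imp_continuous_on)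
       (auto simp: decaying_def)
qed

section \<open>Cauchy's theorem and formula on a vertical line\<close>

lemma line_integral_zero:
  assumes "decaying \<sigma> H" "0 < \<sigma>"
  shows "(LBINT \<omega>. H (Complex \<sigma> \<omega>)) = 0"
proof -
  obtain C k where k: "1 < k" "\<And>p. \<sigma> \<le> Re p \<Longrightarrow> norm (H p) \<le> C * norm p powr - k"
    and hol: "H holomorphic_on {p. 0 < Re p}"
    using assms unfolding decaying_def by blast
  have "(LBINT \<omega>. H (Complex \<sigma> \<omega>)) = \<i> * 0"
  proof (rule line_integral_eq_rectangle[where ?R0.0 = 1, OF k(1) assms(2) decaying_integrable[OF assms] k(2)])
    fix R :: real assume R: "1 \<le> R"
    have "path_image (rectpath (Complex \<sigma> (- R)) (Complex (\<sigma> + R) R)) \<subseteq> {p. 0 < Re p}"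
      using R assms(2) path_image_rectpath_subset_cbox[of "Complex \<sigma> (- R)" "Complex (\<sigma> + R) R"]
      by (fastforce simp: in_cbox_complex_iff)
    then show "(H has_contour_integral 0) (rectpath (Complex \<sigma> (- R)) (Complex (\<sigma> + R) R))"
      by (intro Cauchy_theorem_convex_simple[OF hol]) (auto intro: convex_halfspace_Re_gt)
  qed
  then show ?thesis
    by simp
qed

text \<open>The pole p is the only singularity of the quotient to the right of the line. For |w|
  \<ge> |p| + 1 the factor 1 / (w - p) has modulus at most 1, so the quotient inherits the decay of
  G on the far sides.\<close>

lemma line_integral_Cauchy:
  fixes G :: "complex \<Rightarrow> complex"
  assumes "decaying \<sigma> G" "0 < \<sigma>" "\<sigma> < Re p"
  shows "(LBINT \<omega>. G (Complex \<sigma> \<omega>) / (p - Complex \<sigma> \<omega>)) = 2 * pi * G p"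
proof -
  obtain C k where k: "1 < k" "\<And>p. \<sigma> \<le> Re p \<Longrightarrow> norm (G p) \<le> C * norm p powr - k"
    and hol: "G holomorphic_on {p. 0 < Re p}"
    using assms unfolding decaying_def by blast
  define H where "H w = G w / (w - p)" for w
  have "(LBINT \<omega>. H (Complex \<sigma> \<omega>)) = \<i> * (2 * pi * \<i> * G p)"
  proof (rule line_integral_eq_rectangle[where ?R0.0 = "norm p + 1", OF k(1) assms(2)])
    have "Complex \<sigma> \<omega> \<noteq> p" for \<omega>
      using assms(3) by auto
    then have "continuous_on UNIV (\<lambda>\<omega>. H (Complex \<sigma> \<omega>))"
      unfolding H_def
      by (intro continuous_intros continuous_on_line[OF holomorphic_on_imp_continuous_on[OF hol] assms(2)]
          continuous_Complex) auto
    then show "integrable lborel (\<lambda>\<omega>. H (Complex \<sigma> \<omega>))"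
    proof (intro integrable_line_bound[OF borel_measurable_continuous_onI k(1) assms(2), where C = "C / (Re p - \<sigma>)"])
      fix \<omega>
      have "Re p - \<sigma> \<le> norm (Complex \<sigma> \<omega> - p)"
        using abs_Re_le_cmod[of "Complex \<sigma> \<omega> - p"] by simp
      then have "norm (H (Complex \<sigma> \<omega>)) \<le> norm (G (Complex \<sigma> \<omega>)) / (Re p - \<sigma>)"
        unfolding H_def norm_divide using assms(3) by (intro divide_left_mono) (auto intro!: mult_pos_pos)
      also have "\<dots> \<le> C * norm (Complex \<sigma> \<omega>) powr - k / (Re p - \<sigma>)"
        using assms(3) k(2)[of "Complex \<sigma> \<omega>"] by (intro divide_right_mono) auto
      finally show "norm (H (Complex \<sigma> \<omega>)) \<le> C / (Re p - \<sigma>) * norm (Complex \<sigma> \<omega>) powr - k"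
        by simp
    qed
    show "norm (H w) \<le> C * norm w powr - k" if "\<sigma> \<le> Re w" "norm p + 1 \<le> norm w" for w
    proof -
      have "1 \<le> norm (w - p)"
        using norm_triangle_ineq2[of w p] that by simp
      then have "norm (H w) \<le> norm (G w)"
        unfolding H_def norm_divide using divide_left_mono[of 1 "norm (w - p)" "norm (G w)"]
        by (cases "w = p") auto
      then show ?thesis
        using k(2)[OF that(1)] by simp
    qed
    fix R assume R: "norm p + 1 \<le> R"
    have p: "p \<in> box (Complex \<sigma> (- R)) (Complex (\<sigma> + R) R)"
      using R abs_Re_le_cmod[of p] abs_Im_le_cmod[of p] assms by (auto simp: in_box_complex_iff)
    have "path_image (rectpath (Complex \<sigma> (- R)) (Complex (\<sigma> + R) R)) \<subseteq> {p. 0 < Re p} - {p}"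
      using R assms(2) p path_image_rectpath_cbox_minus_box[of "Complex \<sigma> (- R)" "Complex (\<sigma> + R) R"]
        norm_ge_zero[of p]
      by (fastforce simp: in_cbox_complex_iff simp del: norm_ge_zero)
    then have "(H has_contour_integral (2 * pi * \<i> *
        winding_number (rectpath (Complex \<sigma> (- R)) (Complex (\<sigma> + R) R)) p * G p))
        (rectpath (Complex \<sigma> (- R)) (Complex (\<sigma> + R) R))"
      unfolding H_def using assms
      by (intro Cauchy_integral_formula_convex_simple[OF _ hol])
         (auto intro: convex_halfspace_Re_gt simp: interior_open open_halfspace_Re_gt)
    then show "(H has_contour_integral (2 * pi * \<i> * G p)) (rectpath (Complex \<sigma> (- R)) (Complex (\<sigma> + R) R))"
      using winding_number_rectpath[OF p] by simp
  qed
  moreover have "(LBINT \<omega>. G (Complex \<sigma> \<omega>) / (p - Complex \<sigma> \<omega>)) = - (LBINT \<omega>. H (Complex \<sigma> \<omega>))"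
    unfolding H_def
    by (subst Bochner_Integration.integral_minus[symmetric], rule Bochner_Integration.integral_cong)
       (auto simp: minus_divide_right)
  ultimately show ?thesis
    by simp
qed

text \<open>In the variable y = exp (-t) the vanishing at p0, p0 + 1, p0 + 2, ... says that all
  monomials in y integrate to zero against f weighted by exp (-p0 t). By the Weierstrass theorem so
  do all continuous functions of y, and a tent around exp (-t0) contradicts f t0 > 0. One sign is
  enough, since \<open>lerch\<close> applies the result to both differences.\<close>

lemma lerch_real:
  fixes f :: "real \<Rightarrow> real"
  assumes cont: "continuous_on {0<..} f"
    and int: "\<And>p. p0 \<le> p \<Longrightarrow> set_integrable lborel {0..} (\<lambda>t. exp (- p * t) * f t)"
    and zero: "\<And>p. p0 \<le> p \<Longrightarrow> (LBINT t:{0..}. exp (- p * t) * f t) = 0"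
    and t0: "0 < t0"
  shows "f t0 \<le> 0"
proof (rule ccontr)
  assume "\<not> f t0 \<le> 0"
  then have pos: "0 < f t0"
    by simp
  define h where "h t = indicator {0..} t * (exp (- p0 * t) * f t)" for t
  have h: "integrable lborel h"
    using int[of p0] unfolding set_integrable_def h_def by simp
  note [measurable] = borel_measurable_integrable[OF h]
  have pw: "indicator {0..} t * (exp (- (p0 + real n) * t) * f t) = exp (- t) ^ n * h t" for n t
    unfolding h_def by (simp add: exp_of_nat_mult[symmetric] exp_add[symmetric] algebra_simps)
  have mono_int: "integrable lborel (\<lambda>t. exp (- t) ^ n * h t)" for n
    using int[of "p0 + real n"] unfolding set_integrable_def using pw[of _ n] by simp
  have mono_zero: "(LBINT t. exp (- t) ^ n * h t) = 0" for n
    using zero[of "p0 + real n"] unfolding set_lebesgue_integral_def using pw[of _ n] by simp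
  have poly: "(LBINT t. q (exp (- t)) * h t) = 0" if q: "real_polynomial_function q" for q :: "real \<Rightarrow> real"
  proof -
    obtain a n where "q = (\<lambda>x. \<Sum>i\<le>n. a i * x ^ i)"
      using q unfolding real_polynomial_function_iff_sum by blast
    then have "(LBINT t. q (exp (- t)) * h t) = (LBINT t. (\<Sum>i\<le>n. a i * (exp (- t) ^ i * h t)))"
      by (simp add: sum_distrib_right mult.assoc)
    also have "\<dots> = 0"
      using mono_int mono_zero by (subst Bochner_Integration.integral_sum) auto
    finally show ?thesis .
  qed
  have all: "(LBINT t. \<phi> (exp (- t)) * h t) = 0" if \<phi>: "continuous_on UNIV \<phi>" for \<phi> :: "real \<Rightarrow> real"
  proof -
    have [measurable]: "\<phi> \<in> borel_measurable borel"
      using \<phi> by (rule borel_measurable_continuous_onI)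
    have "\<bar>LBINT t. \<phi> (exp (- t)) * h t\<bar> \<le> e * (LBINT t. \<bar>h t\<bar>)" if "0 < e" for e
    proof -
      have "continuous_on {0..1} \<phi>"
        using \<phi> continuous_on_subset by blast
      from Stone_Weierstrass_real_polynomial_function[OF compact_Icc this \<open>0 < e\<close>] obtain q
        where q: "real_polynomial_function q" "\<And>x. x \<in> {0..1} \<Longrightarrow> \<bar>\<phi> x - q x\<bar> < e"
        by blast
      have [measurable]: "q \<in> borel_measurable borel"
        by (intro borel_measurable_continuous_onI continuous_on_polymonial_function)
           (simp add: q real_polynomial_function_eq[symmetric])
      have bd: "\<bar>(\<phi> (exp (- t)) - q (exp (- t))) * h t\<bar> \<le> e * \<bar>h t\<bar>" for t
      proof (cases "0 \<le> t")
        case True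
        then show ?thesis
          using q(2)[of "exp (- t)"] by (auto simp: abs_mult intro!: mult_right_mono)
      qed (simp add: h_def)
      have i1: "integrable lborel (\<lambda>t. (\<phi> (exp (- t)) - q (exp (- t))) * h t)"
        using bd by (intro Bochner_Integration.integrable_bound[OF integrable_mult_right[OF integrable_abs[OF h], of e]])
          (auto intro: order_trans abs_ge_self)
      have i2: "integrable lborel (\<lambda>t. q (exp (- t)) * h t)"
      proof -
        obtain a n where "q = (\<lambda>x. \<Sum>i\<le>n. a i * x ^ i)"
          using q unfolding real_polynomial_function_iff_sum by blast
        then have "(\<lambda>t. q (exp (- t)) * h t) = (\<lambda>t. (\<Sum>i\<le>n. a i * (exp (- t) ^ i * h t)))"
          by (simp add: sum_distrib_right mult.assoc)
        then show ?thesis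
          using mono_int by simp
      qed
      have "(LBINT t. \<phi> (exp (- t)) * h t) = (LBINT t. (\<phi> (exp (- t)) - q (exp (- t))) * h t + q (exp (- t)) * h t)"
        by (simp add: algebra_simps)
      also have "\<dots> = (LBINT t. (\<phi> (exp (- t)) - q (exp (- t))) * h t)"
        using i1 i2 poly[OF q(1)] by simp
      also have "\<bar>\<dots>\<bar> \<le> (LBINT t. \<bar>(\<phi> (exp (- t)) - q (exp (- t))) * h t\<bar>)"
        by (rule integral_abs_bound)
      also have "\<dots> \<le> (LBINT t. e * \<bar>h t\<bar>)"
        using i1 h bd by (intro integral_mono) auto
      finally show ?thesis
        by simp
    qed
    note * = this
    define J where "J = \<bar>LBINT t. \<phi> (exp (- t)) * h t\<bar>"
    define K where "K = (LBINT t. \<bar>h t\<bar>)"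
    have K: "0 \<le> K"
      unfolding K_def by simp
    have "J \<le> 0 + e" if "0 < e" for e
    proof -
      \<comment> \<open>Dividing by K + 1 instead of K covers the case that h vanishes almost
        everywhere.\<close>
      have "J \<le> e / (K + 1) * K"
        using *[of "e / (K + 1)"] K that unfolding J_def K_def by simp
      also have "\<dots> \<le> e"
        using K that by (simp add: field_simps)
      finally show ?thesis
        by simp
    qed
    then have "J \<le> 0"
      by (rule field_le_epsilon)
    then show ?thesis
      by (simp add: J_def)
  qed
  have "isCont f t0"
    using cont t0 by (simp add: continuous_on_eq_continuous_at)
  then obtain r where r: "0 < r" "\<And>t. \<bar>t - t0\<bar> < r \<Longrightarrow> 0 < f t"
    using pos unfolding continuous_at_eps_delta
    by (smt (verit) dist_real_def)
  \<comment> \<open>Within r of t0 the values of f are positive, and d \<le> t0 keeps the interval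
    inside [0, \<infinity>), where h is not cut off.\<close>
  define d where "d = min r t0"
  \<comment> \<open>In y = exp (-t) this is a tent over the image of (t0 - d, t0 + d), so \<phi>
    (exp (-t)) is positive exactly on that interval.\<close>
  define \<phi> where "\<phi> y = max 0 (min (y - exp (- (t0 + d))) (exp (- (t0 - d)) - y))" for y :: real
  have d: "0 < d" "d \<le> r" "d \<le> t0"
    using r t0 by (auto simp: d_def)
  have \<phi>_pos: "0 < \<phi> (exp (- t)) \<longleftrightarrow> \<bar>t - t0\<bar> < d" for t
    unfolding \<phi>_def by (auto simp: less_max_iff_disj)
  have \<phi>_nonneg: "0 \<le> \<phi> y" for y
    by (simp add: \<phi>_def)
  have pos': "0 < \<phi> (exp (- t)) * h t" if "\<bar>t - t0\<bar> < d" for t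
  proof -
    have "0 < h t"
      using r(2)[of t] that d unfolding h_def by (auto simp: indicator_def)
    then show ?thesis
      using \<phi>_pos[of t] that by simp
  qed
  have nonneg: "0 \<le> \<phi> (exp (- t)) * h t" for t
  proof (cases "\<bar>t - t0\<bar> < d")
    case False
    then have "\<phi> (exp (- t)) = 0"
      using \<phi>_pos[of t] \<phi>_nonneg[of "exp (- t)"] by simp
    then show ?thesis
      by simp
  qed (use pos' in \<open>simp add: less_imp_le\<close>)
  have cont\<phi>: "continuous_on UNIV \<phi>"
    unfolding \<phi>_def by (intro continuous_intros)
  have "integrable lborel (\<lambda>t. \<phi> (exp (- t)) * h t)"
  proof (rule Bochner_Integration.integrable_bound[OF integrable_mult_right[OF h, of "exp (- (t0 - d))"]])
    have [measurable]: "\<phi> \<in> borel_measurable borel"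
      using cont\<phi> by (rule borel_measurable_continuous_onI)
    show "(\<lambda>t. \<phi> (exp (- t)) * h t) \<in> borel_measurable lborel"
      by measurable
    have "\<bar>\<phi> (exp (- t))\<bar> \<le> exp (- (t0 - d))" for t
      unfolding \<phi>_def by (smt (verit) exp_gt_zero)
    then show "AE t in lborel. norm (\<phi> (exp (- t)) * h t) \<le> norm (exp (- (t0 - d)) * h t)"
      by (auto simp: abs_mult intro!: mult_right_mono)
  qed
  then have "AE t in lborel. \<phi> (exp (- t)) * h t = 0"
    using all[OF cont\<phi>] nonneg by (subst integral_nonneg_eq_0_iff_AE[symmetric]) auto
  then have "AE t in lborel. t \<notin> {t0 - d<..<t0 + d}"
  proof (rule AE_mp, intro AE_I2 impI notI)
    fix t assume "\<phi> (exp (- t)) * h t = 0" "t \<in> {t0 - d<..<t0 + d}"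
    with pos'[of t] show False
      by (auto simp: abs_less_iff)
  qed
  then have "{t0 - d<..<t0 + d} \<in> null_sets lborel"
    by (subst (asm) AE_iff_null_sets[symmetric]) auto
  then show False
    using d by (simp add: null_sets_def)
qed

lemma lerch:
  fixes f g :: "real \<Rightarrow> real"
  assumes cont: "continuous_on {0<..} f" "continuous_on {0<..} g"
    and int: "\<And>p. p0 \<le> p \<Longrightarrow> set_integrable lborel {0..} (\<lambda>t. exp (- p * t) * f t)"
      "\<And>p. p0 \<le> p \<Longrightarrow> set_integrable lborel {0..} (\<lambda>t. exp (- p * t) * g t)"
    and eq: "\<And>p. p0 \<le> p \<Longrightarrow> (LBINT t:{0..}. exp (- p * t) * f t) = (LBINT t:{0..}. exp (- p * t) * g t)"
    and t: "0 < t"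
  shows "f t = g t"
proof -
  have "f t - g t \<le> 0"
    using cont int eq
    by (intro lerch_real[of "\<lambda>t. f t - g t" p0, OF _ _ _ t])
       (auto intro!: continuous_intros set_integral_diff simp: right_diff_distrib)
  moreover have "g t - f t \<le> 0"
    using cont int eq
    by (intro lerch_real[of "\<lambda>t. g t - f t" p0, OF _ _ _ t])
       (auto intro!: continuous_intros set_integral_diff simp: right_diff_distrib)
  ultimately show ?thesis
    by simp
qed

section \<open>Bromwich integrals\<close>

lemma exp_integral_half_line:
  fixes a :: complex
  assumes "0 < Re a"
  shows "set_integrable lborel {0..} (\<lambda>t. exp (- a * of_real t))"
    and "(LBINT t:{0..}. exp (- a * of_real t)) = 1 / a"
proof -
  have a0: "a \<noteq> 0"
    using assms by auto
  have "set_integrable lborel {0..} (\<lambda>t. exp (- (Re a) * t))"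
    using integrable_on_exp_minus_to_infinity[OF assms, of 0]
    by (subst set_integrable_lborel_iff)
       (auto simp: set_borel_measurable_def intro!: nonnegative_absolutely_integrable_1)
  then show int: "set_integrable lborel {0..} (\<lambda>t. exp (- a * of_real t))"
    unfolding set_integrable_def
    by (rule Bochner_Integration.integrable_bound) (auto simp: indicator_def)
  have lim: "(\<lambda>n. exp (- a * of_real (real n))) \<longlonglongrightarrow> 0"
  proof (rule Lim_null_comparison)
    show "\<forall>\<^sub>F n in sequentially. norm (exp (- a * of_real (real n))) \<le> exp (- Re a * real n)"
      by simp
    show "(\<lambda>n. exp (- Re a * real n)) \<longlonglongrightarrow> 0"
      using assms by real_asymp
  qed
  have "(\<lambda>n. LBINT t:{0..real n}. exp (- a * of_real t)) \<longlonglongrightarrow> (LBINT t:{0..}. exp (- a * of_real t))"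
    unfolding set_lebesgue_integral_def
  proof (rule integral_dominated_convergence)
    show "integrable lborel (\<lambda>t. norm (indicat_real {0..} t *\<^sub>R exp (- a * of_real t)))"
      using int unfolding set_integrable_def by (rule integrable_norm)
    show "AE t in lborel. (\<lambda>n. indicat_real {0..real n} t *\<^sub>R exp (- a * of_real t))
        \<longlonglongrightarrow> indicat_real {0..} t *\<^sub>R exp (- a * of_real t)"
    proof (rule AE_I2, rule tendsto_eventually)
      fix t :: real
      obtain N :: nat where "t \<le> real N"
        using real_arch_simple by blast
      then show "\<forall>\<^sub>F n in sequentially. indicat_real {0..real n} t *\<^sub>R exp (- a * of_real t)
          = indicat_real {0..} t *\<^sub>R exp (- a * of_real t)"
        by (intro eventually_sequentiallyI[of N]) (auto simp: indicator_def)
    qed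
  qed (auto simp: indicator_def)
  moreover have "(LBINT t:{0..real n}. exp (- a * of_real t)) = (1 - exp (- a * of_real (real n))) / a" for n
  proof -
    have vd: "((\<lambda>t. - exp (- a * of_real t) / a) has_vector_derivative exp (- a * of_real t)) (at t within {0..real n})" for t
    proof -
      have "((\<lambda>z. - exp (- a * z) / a) has_field_derivative exp (- a * of_real t)) (at (of_real t))"
        using a0 by (auto intro!: derivative_eq_intros)
      from has_vector_derivative_real_field[OF this] show ?thesis
        by simp
    qed
    have "continuous_on {0..real n} (\<lambda>t. exp (- a * of_real t))"
      by (intro continuous_intros)
    from integral_FTC_atLeastAtMost[OF _ vd this]
    have "(\<integral>t. indicator {0..real n} t *\<^sub>R exp (- a * of_real t) \<partial>lborel)
        = - exp (- a * of_real (real n)) / a - - exp (- a * of_real 0) / a"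
      by (simp del: scaleR_eq_0_iff)
    then show ?thesis
      by (simp add: set_lebesgue_integral_def diff_divide_distrib)
  qed
  moreover have "(\<lambda>n. (1 - exp (- a * of_real (real n))) / a) \<longlonglongrightarrow> (1 - 0) / a"
    using a0 by (intro tendsto_intros lim) auto
  ultimately show "(LBINT t:{0..}. exp (- a * of_real t)) = 1 / a"
    using LIMSEQ_unique by fastforce
qed

text \<open>The inversion integral along p = \<sigma> + i \<omega>; dp = i d\<omega> cancels the i
  of 1 / (2 pi i).\<close>

definition bromwich :: "real \<Rightarrow> (complex \<Rightarrow> complex) \<Rightarrow> real \<Rightarrow> complex" where
  "bromwich \<sigma> G t =
    (LBINT \<omega>. exp (of_real t * Complex \<sigma> \<omega>) * G (Complex \<sigma> \<omega>)) / of_real (2 * pi)"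

lemma norm_exp_line [simp]: "norm (exp (of_real t * Complex \<sigma> \<omega>)) = exp (\<sigma> * t)"
  by (simp add: mult.commute)

lemma borel_measurable_exp_line [measurable]:
  assumes "f \<in> borel_measurable M" "g \<in> borel_measurable M"
  shows "(\<lambda>x. exp (of_real (f x) * Complex \<sigma> (g x))) \<in> borel_measurable M"
  using assms unfolding Complex_eq by measurable

lemma norm_bromwich_le:
  assumes "integrable lborel (\<lambda>\<omega>. G (Complex \<sigma> \<omega>))"
  shows "norm (bromwich \<sigma> G t) \<le> exp (\<sigma> * t) * ((LBINT \<omega>. norm (G (Complex \<sigma> \<omega>))) / (2 * pi))"
proof -
  have "norm (LBINT \<omega>. exp (of_real t * Complex \<sigma> \<omega>) * G (Complex \<sigma> \<omega>))
      \<le> (LBINT \<omega>. norm (exp (of_real t * Complex \<sigma> \<omega>) * G (Complex \<sigma> \<omega>)))"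
    by (rule integral_norm_bound)
  also have "\<dots> = exp (\<sigma> * t) * (LBINT \<omega>. norm (G (Complex \<sigma> \<omega>)))"
    by (simp add: norm_mult del: norm_exp_eq_Re)
  finally show ?thesis
    by (simp add: bromwich_def norm_divide divide_right_mono)
qed

lemma integrable_bromwich:
  assumes "integrable lborel (\<lambda>\<omega>. G (Complex \<sigma> \<omega>))"
  shows "integrable lborel (\<lambda>\<omega>. exp (of_real t * Complex \<sigma> \<omega>) * G (Complex \<sigma> \<omega>))"
  using borel_measurable_integrable[OF assms]
  by (intro Bochner_Integration.integrable_bound[OF integrable_mult_right[OF assms, of "exp (\<sigma> * t)"]])
     (auto simp: norm_mult simp del: norm_exp_eq_Re)

text \<open>With the real exponential taken out, the integrand has modulus |G| whatever t is. That
  gives one majorant for all t in continuity arguments.\<close>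

lemma bromwich_factor:
  "bromwich \<sigma> G t = exp (of_real (\<sigma> * t)) *
      (LBINT \<omega>. exp (of_real t * Complex 0 \<omega>) * G (Complex \<sigma> \<omega>)) / of_real (2 * pi)"
proof -
  have "exp (of_real t * Complex \<sigma> \<omega>) = exp (of_real (\<sigma> * t)) * exp (of_real t * Complex 0 \<omega>)" for \<omega>
    unfolding exp_add[symmetric] by (simp add: Complex_eq algebra_simps)
  then have "(LBINT \<omega>. exp (of_real t * Complex \<sigma> \<omega>) * G (Complex \<sigma> \<omega>)) =
      (LBINT \<omega>. exp (of_real (\<sigma> * t)) * (exp (of_real t * Complex 0 \<omega>) * G (Complex \<sigma> \<omega>)))"
    by (simp only: mult.assoc)
  then show ?thesis
    unfolding bromwich_def by simp
qed

lemma continuous_on_bromwich: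
  assumes int: "integrable lborel (\<lambda>\<omega>. G (Complex \<sigma> \<omega>))"
  shows "continuous_on UNIV (bromwich \<sigma> G)"
proof -
  note [measurable] = borel_measurable_integrable[OF int]
  have "continuous_on UNIV (\<lambda>t. LBINT \<omega>. exp (of_real t * Complex 0 \<omega>) * G (Complex \<sigma> \<omega>))"
    using int by (intro continuous_on_integral_dominated[where g = "\<lambda>\<omega>. norm (G (Complex \<sigma> \<omega>))"])
      (auto intro!: continuous_intros simp: norm_mult simp del: norm_exp_eq_Re)
  then have "continuous_on UNIV (\<lambda>t. exp (of_real (\<sigma> * t)) *
      (LBINT \<omega>. exp (of_real t * Complex 0 \<omega>) * G (Complex \<sigma> \<omega>)) / of_real (2 * pi))"
    by (intro continuous_intros) auto
  then show ?thesis
    by (simp add: bromwich_factor[abs_def])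
qed

text \<open>For t \<le> 0 the factor exp (t p) has modulus at most 1 on Re p \<ge> \<sigma>, so the
  contour closes to the right without meeting a pole. This causality yields the initial condition
  and truncates convolutions at t.\<close>

lemma bromwich_nonpos:
  assumes G: "decaying \<sigma> G" "0 < \<sigma>" and t: "t \<le> 0"
  shows "bromwich \<sigma> G t = 0"
proof -
  obtain C k where k: "1 < k" "\<And>p. \<sigma> \<le> Re p \<Longrightarrow> norm (G p) \<le> C * norm p powr - k"
    and hol: "G holomorphic_on {p. 0 < Re p}"
    using G unfolding decaying_def by blast
  have "decaying \<sigma> (\<lambda>p. exp (of_real t * p) * G p)"
  proof (rule decayingI[OF _ k(1)])
    show "(\<lambda>p. exp (of_real t * p) * G p) holomorphic_on {p. 0 < Re p}"
      by (intro holomorphic_intros hol)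
    show "norm (exp (of_real t * p) * G p) \<le> C * norm p powr - k" if "\<sigma> \<le> Re p" for p
    proof -
      have "norm (exp (of_real t * p)) \<le> 1"
        using that t G(2) by (simp add: mult_nonpos_nonneg)
      then have "norm (exp (of_real t * p) * G p) \<le> norm (G p)"
        unfolding norm_mult by (intro mult_left_le_one_le) auto
      then show ?thesis
        using k(2)[OF that] by simp
    qed
  qed
  from line_integral_zero[OF this G(2)] show ?thesis
    by (simp add: bromwich_def)
qed

text \<open>Integrating in t first turns exp (-(p - w) t) into 1 / (p - w), and Cauchy's formula on
  the line evaluates the rest. The gap Re p - \<sigma> > 0 supplies the decay in t.\<close>

lemma laplace_bromwich:
  assumes G: "decaying \<sigma> G" "0 < \<sigma>" and p: "\<sigma> < Re p"
  shows "set_integrable lborel {0..} (\<lambda>t. exp (- p * of_real t) * bromwich \<sigma> G t)"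
    and "(LBINT t:{0..}. exp (- p * of_real t) * bromwich \<sigma> G t) = G p"
proof -
  have int: "integrable lborel (\<lambda>\<omega>. G (Complex \<sigma> \<omega>))"
    using decaying_integrable[OF G] .
  note [measurable] = borel_measurable_integrable[OF int]
  define F where "F t \<omega> = indicator {0..} t *\<^sub>R (exp (- p * of_real t) *
      (exp (of_real t * Complex \<sigma> \<omega>) * G (Complex \<sigma> \<omega>))) / of_real (2 * pi)" for t \<omega>
  have "integrable lborel (\<lambda>t. indicator {0..} t *\<^sub>R exp (- of_real (Re p - \<sigma>) * of_real t :: complex))"
    using exp_integral_half_line(1)[of "of_real (Re p - \<sigma>)"] p unfolding set_integrable_def by simp
  then have g: "integrable lborel (\<lambda>t. indicator {0..} t * exp (- (Re p - \<sigma>) * t))"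
    by (rule Bochner_Integration.integrable_bound) (auto simp: indicator_def)
  have bound: "norm (F t \<omega>) \<le> indicator {0..} t * exp (- (Re p - \<sigma>) * t) * (norm (G (Complex \<sigma> \<omega>)) / (2 * pi))" for t \<omega>
    by (auto simp: F_def norm_divide norm_mult exp_add[symmetric] algebra_simps indicator_def)
  have meas: "(\<lambda>(t, \<omega>). F t \<omega>) \<in> borel_measurable (lborel \<Otimes>\<^sub>M lborel)"
    unfolding F_def by measurable
  note fub = Fubini_lborel_product_bound[OF meas g integrable_divide_zero[OF integrable_norm[OF int]] bound]
  have 1: "(\<lambda>t. LBINT \<omega>. F t \<omega>) =
      (\<lambda>t. indicator {0..} t *\<^sub>R (exp (- p * of_real t) * bromwich \<sigma> G t))"
    unfolding F_def bromwich_def by (auto simp: fun_eq_iff scaleR_conv_of_real)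
  show "set_integrable lborel {0..} (\<lambda>t. exp (- p * of_real t) * bromwich \<sigma> G t)"
    using fub(2) unfolding 1 set_integrable_def .
  have inner: "(LBINT t. F t \<omega>) = G (Complex \<sigma> \<omega>) / (p - Complex \<sigma> \<omega>) / of_real (2 * pi)" for \<omega>
  proof -
    have "exp (- p * of_real t) * exp (of_real t * Complex \<sigma> \<omega>) = exp (- (p - Complex \<sigma> \<omega>) * of_real t)" for t
      unfolding exp_add[symmetric] by (simp add: algebra_simps)
    then have "F t \<omega> = (indicator {0..} t *\<^sub>R exp (- (p - Complex \<sigma> \<omega>) * of_real t)) * (G (Complex \<sigma> \<omega>) / of_real (2 * pi))" for t
      unfolding F_def by (simp add: mult.assoc[symmetric] scaleR_conv_of_real)
    then have "(LBINT t. F t \<omega>) = (LBINT t. (indicator {0..} t *\<^sub>R exp (- (p - Complex \<sigma> \<omega>) * of_real t)) * (G (Complex \<sigma> \<omega>) / of_real (2 * pi)))"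
      by presburger
    also have "\<dots> = 1 / (p - Complex \<sigma> \<omega>) * (G (Complex \<sigma> \<omega>) / of_real (2 * pi))"
      using exp_integral_half_line(2)[of "p - Complex \<sigma> \<omega>"] p unfolding set_lebesgue_integral_def
      by (subst integral_mult_left_zero) simp
    finally show ?thesis
      by simp
  qed
  have "(LBINT t:{0..}. exp (- p * of_real t) * bromwich \<sigma> G t)
      = (LBINT t. LBINT \<omega>. F t \<omega>)"
    unfolding 1 set_lebesgue_integral_def by simp
  also have "\<dots> = (LBINT \<omega>. LBINT t. F t \<omega>)"
    by (rule fub(1))
  also have "\<dots> = (LBINT \<omega>. G (Complex \<sigma> \<omega>) / (p - Complex \<sigma> \<omega>) / of_real (2 * pi))"
    by (simp only: inner)
  also have "\<dots> = G p"
    using line_integral_Cauchy[OF G p] by (subst integral_divide_zero) simp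
  finally show "(LBINT t:{0..}. exp (- p * of_real t) * bromwich \<sigma> G t) = G p" .
qed

lemma laplace_Re:
  fixes f :: "real \<Rightarrow> complex" and p :: real
  assumes "set_integrable lborel {0..} (\<lambda>t. exp (- of_real p * of_real t) * f t)"
  shows "set_integrable lborel {0..} (\<lambda>t. exp (- p * t) * Re (f t))"
    and "(LBINT t:{0..}. exp (- p * t) * Re (f t)) = Re (LBINT t:{0..}. exp (- of_real p * of_real t) * f t)"
    and "set_integrable lborel {0..} (\<lambda>t. exp (- p * t) * Im (f t))"
    and "(LBINT t:{0..}. exp (- p * t) * Im (f t)) = Im (LBINT t:{0..}. exp (- of_real p * of_real t) * f t)"
proof -
  have *: "exp (- of_real p * of_real t) = complex_of_real (exp (- p * t))" for t
    unfolding exp_of_real[symmetric] by simp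
  note int = assms[unfolded set_integrable_def *]
  show "set_integrable lborel {0..} (\<lambda>t. exp (- p * t) * Re (f t))"
    using integrable_Re[OF int] unfolding set_integrable_def by simp
  show "set_integrable lborel {0..} (\<lambda>t. exp (- p * t) * Im (f t))"
    using integrable_Im[OF int] unfolding set_integrable_def by simp
  show "(LBINT t:{0..}. exp (- p * t) * Re (f t)) = Re (LBINT t:{0..}. exp (- of_real p * of_real t) * f t)"
    using integral_Re[OF int] unfolding set_lebesgue_integral_def * by simp
  show "(LBINT t:{0..}. exp (- p * t) * Im (f t)) = Im (LBINT t:{0..}. exp (- of_real p * of_real t) * f t)"
    using integral_Im[OF int] unfolding set_lebesgue_integral_def * by simp
qed

text \<open>Both functions are continuous and have the transform G to the right of both lines, so
  Lerch's theorem identifies them. Real and imaginary parts are compared separately because that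
  theorem is about real functions.\<close>

lemma bromwich_shift:
  assumes G: "decaying \<sigma> G" "decaying \<sigma>' G" and pos: "0 < \<sigma>" "0 < \<sigma>'"
  shows "bromwich \<sigma> G t = bromwich \<sigma>' G t"
proof (cases "0 < t")
  case True
  define p0 where "p0 = max \<sigma> \<sigma>' + 1"
  have cont: "continuous_on {0<..} (\<lambda>t. Re (bromwich \<sigma> G t))" "continuous_on {0<..} (\<lambda>t. Im (bromwich \<sigma> G t))"
    if "decaying \<sigma> G" "0 < \<sigma>" for \<sigma>
    using continuous_on_bromwich[OF decaying_integrable[OF that]]
    by (auto intro!: continuous_intros intro: continuous_on_subset)
  have L: "set_integrable lborel {0..} (\<lambda>t. exp (- of_real p * of_real t) * bromwich \<sigma> G t)"
    "(LBINT t:{0..}. exp (- of_real p * of_real t) * bromwich \<sigma> G t) = G (of_real p)"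
    if "decaying \<sigma> G" "0 < \<sigma>" "\<sigma> < p" for p \<sigma>
    using laplace_bromwich[OF that(1,2), of "of_real p"] that by simp_all
  have p0: "\<sigma> < p" "\<sigma>' < p" if "p0 \<le> p" for p
    using that by (auto simp: p0_def)
  have "Re (bromwich \<sigma> G t) = Re (bromwich \<sigma>' G t)"
  proof (rule lerch[OF cont(1)[OF G(1) pos(1)] cont(1)[OF G(2) pos(2)] _ _ _ True])
    fix p assume p: "p0 \<le> p"
    note L1 = L[OF G(1) pos(1) p0(1)[OF p]] and L2 = L[OF G(2) pos(2) p0(2)[OF p]]
    show "set_integrable lborel {0..} (\<lambda>t. exp (- p * t) * Re (bromwich \<sigma> G t))"
      "set_integrable lborel {0..} (\<lambda>t. exp (- p * t) * Re (bromwich \<sigma>' G t))"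
      "(LBINT t:{0..}. exp (- p * t) * Re (bromwich \<sigma> G t)) = (LBINT t:{0..}. exp (- p * t) * Re (bromwich \<sigma>' G t))"
      unfolding laplace_Re(2)[OF L1(1)] laplace_Re(2)[OF L2(1)] L1(2) L2(2)
      by (rule laplace_Re(1)[OF L1(1)] laplace_Re(1)[OF L2(1)] refl)+
  qed
  moreover have "Im (bromwich \<sigma> G t) = Im (bromwich \<sigma>' G t)"
  proof (rule lerch[OF cont(2)[OF G(1) pos(1)] cont(2)[OF G(2) pos(2)] _ _ _ True])
    fix p assume p: "p0 \<le> p"
    note L1 = L[OF G(1) pos(1) p0(1)[OF p]] and L2 = L[OF G(2) pos(2) p0(2)[OF p]]
    show "set_integrable lborel {0..} (\<lambda>t. exp (- p * t) * Im (bromwich \<sigma> G t))"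
      "set_integrable lborel {0..} (\<lambda>t. exp (- p * t) * Im (bromwich \<sigma>' G t))"
      "(LBINT t:{0..}. exp (- p * t) * Im (bromwich \<sigma> G t)) = (LBINT t:{0..}. exp (- p * t) * Im (bromwich \<sigma>' G t))"
      unfolding laplace_Re(4)[OF L1(1)] laplace_Re(4)[OF L2(1)] L1(2) L2(2)
      by (rule laplace_Re(3)[OF L1(1)] laplace_Re(3)[OF L2(1)] refl)+
  qed
  ultimately show ?thesis
    by (simp add: complex_eq_iff)
qed (use bromwich_nonpos assms in auto)

text \<open>Reflecting \<omega> conjugates the integrand, so the integral equals its own
  conjugate.\<close>

lemma bromwich_real:
  assumes "\<And>p. 0 < Re p \<Longrightarrow> G (cnj p) = cnj (G p)" "0 < \<sigma>"
  shows "Im (bromwich \<sigma> G t) = 0"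
proof -
  define h where "h \<omega> = exp (of_real t * Complex \<sigma> \<omega>) * G (Complex \<sigma> \<omega>)" for \<omega>
  have "h (- \<omega>) = cnj (h \<omega>)" for \<omega>
  proof -
    have *: "Complex \<sigma> (- \<omega>) = cnj (Complex \<sigma> \<omega>)"
      by (simp add: complex_eq_iff)
    show ?thesis
      unfolding h_def * using assms by (simp add: exp_cnj)
  qed
  then have "integral\<^sup>L lborel h = cnj (integral\<^sup>L lborel h)"
    using lborel_integral_real_affine[of "-1" h 0] by (simp add: integral_cnj[symmetric])
  then have "Im (integral\<^sup>L lborel h) = 0"
    by (simp add: complex_eq_iff)
  moreover have "bromwich \<sigma> G t = (1 / (2 * pi)) *\<^sub>R integral\<^sup>L lborel h"
    by (simp add: bromwich_def h_def[abs_def] scaleR_conv_of_real)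
  ultimately show ?thesis
    by simp
qed

text \<open>By causality the range [0, t] may be replaced by [0, \<infinity>), after which the inner
  integral over r is the transform of \<phi> on the line. Convolution thus multiplies symbols, which
  serves both the Caputo kernel r^(-\<delta>) and \<open>g2\<close>.\<close>

lemma convolution_bromwich:
  assumes G: "decaying \<sigma> G" "0 < \<sigma>"
    and \<phi>: "set_integrable lborel {0..} (\<lambda>r. exp (- \<sigma> * r) * \<phi> r)"
    and \<Phi>: "\<And>\<omega>. (LBINT r:{0..}. exp (- Complex \<sigma> \<omega> * of_real r) * of_real (\<phi> r)) = \<Phi> (Complex \<sigma> \<omega>)"
  shows "set_integrable lborel {0..t} (\<lambda>r. bromwich \<sigma> G (t - r) * of_real (\<phi> r))"
    and "(LBINT r:{0..t}. bromwich \<sigma> G (t - r) * of_real (\<phi> r)) = bromwich \<sigma> (\<lambda>p. G p * \<Phi> p) t"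
proof -
  have int: "integrable lborel (\<lambda>\<omega>. G (Complex \<sigma> \<omega>))"
    using decaying_integrable[OF G] .
  note [measurable] = borel_measurable_integrable[OF int]
  \<comment> \<open>\<phi> itself may fail to be integrable; the factor exp (\<sigma> (t - r)) of
    the Bromwich integrand supplies the weight.\<close>
  define \<psi> where "\<psi> r = indicator {0..} r * (exp (- \<sigma> * r) * \<phi> r)" for r
  have \<psi>: "integrable lborel \<psi>"
    using \<phi> unfolding set_integrable_def \<psi>_def by simp
  note [measurable] = borel_measurable_integrable[OF \<psi>]
  define F where "F r \<omega> = of_real (\<psi> r) * (exp (of_real \<sigma> * of_real r) *
      (exp (of_real (t - r) * Complex \<sigma> \<omega>) * G (Complex \<sigma> \<omega>))) / of_real (2 * pi)" for r \<omega>
  have bound: "norm (F r \<omega>) \<le> \<bar>\<psi> r\<bar> * (exp (\<sigma> * t) * norm (G (Complex \<sigma> \<omega>)) / (2 * pi))" for r \<omega>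
  proof -
    have "exp (\<sigma> * r) * exp (\<sigma> * (t - r)) = exp (\<sigma> * t)"
      by (simp add: exp_add[symmetric] algebra_simps)
    then have "norm (F r \<omega>) = \<bar>\<psi> r\<bar> * (exp (\<sigma> * t) * norm (G (Complex \<sigma> \<omega>)) / (2 * pi))"
      unfolding F_def norm_divide norm_mult norm_exp_line by (simp add: mult.assoc[symmetric])
    then show ?thesis
      by simp
  qed
  have meas: "(\<lambda>(r, \<omega>). F r \<omega>) \<in> borel_measurable (lborel \<Otimes>\<^sub>M lborel)"
    unfolding F_def by measurable
  note fub = Fubini_lborel_product_bound[OF meas integrable_abs[OF \<psi>]
      integrable_divide_zero[OF integrable_mult_right[OF integrable_norm[OF int]]] bound]
  have 1: "(LBINT \<omega>. F r \<omega>) =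
      indicator {0..t} r *\<^sub>R (bromwich \<sigma> G (t - r) * of_real (\<phi> r))" for r
  proof (cases "r \<le> t")
    case True
    have "(LBINT \<omega>. F r \<omega>) = of_real (\<psi> r) * (exp (of_real \<sigma> * of_real r) * bromwich \<sigma> G (t - r))"
      unfolding F_def bromwich_def by simp
    moreover have "complex_of_real (exp (- \<sigma> * r)) * exp (of_real \<sigma> * of_real r) = 1"
      unfolding exp_of_real[symmetric] by (simp add: exp_add[symmetric])
    ultimately show ?thesis
      using True by (auto simp: \<psi>_def indicator_def)
  next
    case False
    then have "bromwich \<sigma> G (t - r) = 0"
      by (intro bromwich_nonpos[OF G]) auto
    then have "(LBINT \<omega>. exp (of_real (t - r) * Complex \<sigma> \<omega>) * G (Complex \<sigma> \<omega>)) = 0"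
      unfolding bromwich_def using pi_gt_zero by (simp del: of_real_mult)
    then show ?thesis
      using False unfolding F_def by simp
  qed
  show "set_integrable lborel {0..t} (\<lambda>r. bromwich \<sigma> G (t - r) * of_real (\<phi> r))"
    using fub(2) unfolding 1 set_integrable_def .
  have "(LBINT r:{0..t}. bromwich \<sigma> G (t - r) * of_real (\<phi> r)) = (LBINT r. LBINT \<omega>. F r \<omega>)"
    unfolding 1 set_lebesgue_integral_def by simp
  also have "\<dots> = (LBINT \<omega>. LBINT r. F r \<omega>)"
    by (rule fub(1))
  also have "(\<lambda>\<omega>. LBINT r. F r \<omega>) = (\<lambda>\<omega>. exp (of_real t * Complex \<sigma> \<omega>) * (G (Complex \<sigma> \<omega>) * \<Phi> (Complex \<sigma> \<omega>)) / of_real (2 * pi))"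
  proof
    fix \<omega>
    have "F r \<omega> = (indicator {0..} r *\<^sub>R (exp (- Complex \<sigma> \<omega> * of_real r) * of_real (\<phi> r))) *
        (exp (of_real t * Complex \<sigma> \<omega>) * G (Complex \<sigma> \<omega>) / of_real (2 * pi))" for r
    proof -
      have "exp (of_real (t - r) * Complex \<sigma> \<omega>) = exp (- Complex \<sigma> \<omega> * of_real r) * exp (of_real t * Complex \<sigma> \<omega>)"
        by (simp add: exp_add[symmetric] algebra_simps)
      note E = this
      have "complex_of_real (exp (- \<sigma> * r)) * exp (of_real \<sigma> * of_real r) = 1"
        unfolding exp_of_real[symmetric] by (simp add: exp_add[symmetric])
      then have X: "complex_of_real (\<psi> r) * (exp (of_real \<sigma> * of_real r) * X) = indicator {0..} r *\<^sub>R (of_real (\<phi> r) * X)" for X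
        by (auto simp: \<psi>_def indicator_def)
      show ?thesis
        unfolding F_def E X by (simp add: scaleR_conv_of_real mult_ac)
    qed
    then have "(LBINT r. F r \<omega>) = (LBINT r. (indicator {0..} r *\<^sub>R (exp (- Complex \<sigma> \<omega> * of_real r) * of_real (\<phi> r))) *
        (exp (of_real t * Complex \<sigma> \<omega>) * G (Complex \<sigma> \<omega>) / of_real (2 * pi)))"
      by presburger
    also have "\<dots> = \<Phi> (Complex \<sigma> \<omega>) * (exp (of_real t * Complex \<sigma> \<omega>) * G (Complex \<sigma> \<omega>) / of_real (2 * pi))"
      using \<Phi>[of \<omega>] unfolding set_lebesgue_integral_def by (subst integral_mult_left_zero) simp
    finally show "(LBINT r. F r \<omega>) = exp (of_real t * Complex \<sigma> \<omega>) * (G (Complex \<sigma> \<omega>) * \<Phi> (Complex \<sigma> \<omega>)) / of_real (2 * pi)"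
      by (simp add: mult_ac)
  qed
  finally show "(LBINT r:{0..t}. bromwich \<sigma> G (t - r) * of_real (\<phi> r)) = bromwich \<sigma> (\<lambda>p. G p * \<Phi> p) t"
    unfolding bromwich_def by simp
qed

text \<open>\<open>inverse_laplace\<close> picks some inverse, and Lerch's theorem pins it down on
  (0, \<infinity>). Decay is required for every \<sigma> > 0 because the transform must equal G on
  all of Re p > 0; a given p is reached from the line \<sigma> = Re p / 2.\<close>

lemma inverse_laplace_bromwich:
  assumes G: "\<And>\<sigma>. 0 < \<sigma> \<Longrightarrow> decaying \<sigma> G"
    and sym: "\<And>p. 0 < Re p \<Longrightarrow> G (cnj p) = cnj (G p)"
  shows "is_inverse_laplace G (\<lambda>t. Re (bromwich 1 G t))"
    and "\<And>t. 0 < t \<Longrightarrow> inverse_laplace G t = Re (bromwich 1 G t)"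
proof -
  have cont: "continuous_on {0<..} (\<lambda>t. Re (bromwich 1 G t))"
    by (intro continuous_on_Re continuous_on_subset[OF continuous_on_bromwich[OF decaying_integrable[OF G]]]) auto
  have L: "set_integrable lborel {0..} (\<lambda>t. exp (- p * of_real t) * complex_of_real (Re (bromwich 1 G t)))"
    "laplace (\<lambda>t. Re (bromwich 1 G t)) p = G p" if "0 < Re p" for p
  proof -
    have "complex_of_real (Re (bromwich 1 G t)) = bromwich (Re p / 2) G t" for t
      using bromwich_real[of G 1 t, OF sym] bromwich_shift[OF G G, of 1 "Re p / 2" t] that
      by (simp add: complex_eq_iff)
    then show "set_integrable lborel {0..} (\<lambda>t. exp (- p * of_real t) * complex_of_real (Re (bromwich 1 G t)))"
      "laplace (\<lambda>t. Re (bromwich 1 G t)) p = G p"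
      using laplace_bromwich[OF G, of "Re p / 2" p] that by (simp_all add: laplace_def)
  qed
  show 1: "is_inverse_laplace G (\<lambda>t. Re (bromwich 1 G t))"
    unfolding is_inverse_laplace_def using cont L by blast
  show "inverse_laplace G t = Re (bromwich 1 G t)" if t: "0 < t" for t
  proof -
    define f where "f = inverse_laplace G"
    have f: "is_inverse_laplace G f"
      unfolding f_def inverse_laplace_def by (rule someI[of "is_inverse_laplace G", OF 1])
    have "f t = Re (bromwich 1 G t)"
    proof (rule lerch[OF _ cont _ _ _ t])
      show "continuous_on {0<..} f"
        using f unfolding is_inverse_laplace_def by blast
      fix p :: real assume p: "1 \<le> p"
      then have "0 < Re (of_real p)"
        by simp
      note f' = f[unfolded is_inverse_laplace_def laplace_def, THEN conjunct2, rule_format, OF this]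
      note L' = L[unfolded laplace_def, OF \<open>0 < Re (of_real p)\<close>]
      show "set_integrable lborel {0..} (\<lambda>t. exp (- p * t) * f t)"
        using laplace_Re(1)[OF f'[THEN conjunct1]] by simp
      show "set_integrable lborel {0..} (\<lambda>t. exp (- p * t) * Re (bromwich 1 G t))"
        using laplace_Re(1)[OF L'(1)] by simp
      show "(LBINT t:{0..}. exp (- p * t) * f t) = (LBINT t:{0..}. exp (- p * t) * Re (bromwich 1 G t))"
        using laplace_Re(2)[OF f'[THEN conjunct1]] laplace_Re(2)[OF L'(1)] f'[THEN conjunct2] L'(2) by simp
    qed
    then show ?thesis
      by (simp add: f_def)
  qed
qed

text \<open>Both sides are holomorphic on the right half-plane and agree on the positive reals,
  which accumulate at 1. Complex transforms thus follow from real integrals.\<close>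

lemma laplace_analytic_continuation:
  fixes \<phi> :: "real \<Rightarrow> real"
  assumes int: "\<And>r. 0 < r \<Longrightarrow> set_integrable lborel {0..} (\<lambda>t. exp (- r * t) * \<phi> t)"
    and G: "G holomorphic_on {p. 0 < Re p}"
    and eq: "\<And>r. 0 < r \<Longrightarrow> of_real (LBINT t:{0..}. exp (- r * t) * \<phi> t) = G (of_real r)"
    and p: "0 < Re p"
  shows "(LBINT t:{0..}. exp (- p * of_real t) * complex_of_real (\<phi> t)) = G p"
proof -
  define L where "L p = (LBINT t:{0..}. exp (- p * of_real t) * complex_of_real (\<phi> t))" for p
  have hol: "L holomorphic_on {p. 0 < Re p}"
    unfolding holomorphic_on_def
  proof
    fix p assume "p \<in> {p. 0 < Re p}"
    then have p: "0 < Re p"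
      by simp
    \<comment> \<open>Half of Re p goes into the weight of Q; the other half keeps p - r in the
      interior of Re \<zeta> \<ge> 0, where the derivative is two-sided.\<close>
    define r where "r = Re p / 2"
    have r: "0 < r"
      using p by (simp add: r_def)
    define Q where "Q t = complex_of_real (indicator {0..} t * (exp (- r * t) * \<phi> t))" for t
    define M where "M \<zeta> = (\<integral>t. Q t * exp (- \<zeta> * of_real t) \<partial>lborel)" for \<zeta>
    have Q: "integrable lborel Q"
      using int[OF r] unfolding set_integrable_def Q_def real_scaleR_def by (rule integrable_of_real)
    note [measurable] = borel_measurable_integrable[OF Q]
    have r2: "integrable lborel (\<lambda>t. 2 / r * (indicator {0..} t * (exp (- (r / 2) * t) * \<phi> t)))"
      using int[of "r / 2"] r unfolding set_integrable_def by (intro integrable_mult_right) simp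
    have Qt: "integrable lborel (\<lambda>t. Q t * of_real t)"
    proof (rule Bochner_Integration.integrable_bound[OF r2 _ AE_I2])
      fix t :: real
      show "norm (Q t * of_real t) \<le> norm (2 / r * (indicator {0..} t * (exp (- (r / 2) * t) * \<phi> t)))"
      proof (cases "0 \<le> t")
        case True
        \<comment> \<open>The factor t that differentiation produces is traded for half of the decay
          rate: t \<le> (2 / r) exp (r t / 2).\<close>
        have "r / 2 * t \<le> exp (r / 2 * t)"
          using exp_ge_add_one_self[of "r / 2 * t"] by linarith
        then have "exp (- r * t) * (r / 2 * t) \<le> exp (- r * t) * exp (r / 2 * t)"
          by (intro mult_left_mono) auto
        also have "\<dots> = exp (- (r / 2) * t)"
          unfolding exp_add[symmetric] by (simp add: field_simps)
        finally have "exp (- r * t) * t \<le> 2 / r * exp (- (r / 2) * t)"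
          using r by (simp add: field_simps)
        from mult_right_mono[OF this, of "\<bar>\<phi> t\<bar>"] show ?thesis
          using True r by (simp add: Q_def norm_mult abs_mult mult_ac)
      qed (simp add: Q_def)
    qed measurable
    have der: "(M has_field_derivative - (\<integral>t. Q t * of_real t * exp (- (p - of_real r) * of_real t) \<partial>lborel))
        (at (p - of_real r) within {\<zeta>. 0 \<le> Re \<zeta>})"
      unfolding M_def using p
      by (intro has_field_derivative_exp_integral[OF Q Qt] convex_halfspace_Re_ge)
         (auto simp: Q_def r_def indicator_def split: if_splits)
    have interior: "p - of_real r \<in> interior {\<zeta>. 0 \<le> Re \<zeta>}"
    proof -
      have "{\<zeta>. 0 < Re \<zeta>} \<subseteq> interior {\<zeta>. 0 \<le> Re \<zeta>}"
        by (rule interior_maximal[OF _ open_halfspace_Re_gt]) auto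
      then show ?thesis
        using p by (auto simp: r_def)
    qed
    note der = der[unfolded at_within_interior[OF interior]]
    have "((\<lambda>q. q - of_real r) has_field_derivative 1) (at p)"
      by (auto intro!: derivative_eq_intros)
    from DERIV_chain2[OF der this] have "(\<lambda>q. M (q - of_real r)) field_differentiable (at p)"
      unfolding field_differentiable_def by blast
    moreover have "M (q - of_real r) = L q" for q
    proof -
      have "exp (- q * of_real t) = complex_of_real (exp (- r * t)) * exp (- (q - of_real r) * of_real t)" for t
        unfolding exp_of_real[symmetric] exp_add[symmetric] by (simp add: algebra_simps)
      then show ?thesis
        unfolding M_def L_def Q_def set_lebesgue_integral_def
        by (intro Bochner_Integration.integral_cong) (auto simp: indicator_def)
    qed
    ultimately show "L field_differentiable (at p within {p. 0 < Re p})"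
      by (simp add: field_differentiable_at_within)
  qed
  have "L p - G p = 0"
  proof (rule analytic_continuation[of "\<lambda>p. L p - G p" "{p. 0 < Re p}" "of_real ` {0<..}" 1])
    show "(\<lambda>p. L p - G p) holomorphic_on {p. 0 < Re p}"
      by (intro holomorphic_intros hol G)
    show "connected {p. 0 < Re p}"
      by (intro convex_connected convex_halfspace_Re_gt)
    show "(1 :: complex) islimpt of_real ` {0<..}"
      unfolding islimpt_approachable
    proof (intro allI impI)
      fix e :: real assume "0 < e"
      then show "\<exists>x'\<in>of_real ` {0<..}. x' \<noteq> (1 :: complex) \<and> dist x' 1 < e"
        by (intro bexI[of _ "complex_of_real (1 + e / 2)"] imageI conjI) (auto simp: dist_norm norm_mult)
    qed
    show "L z - G z = 0" if z: "z \<in> of_real ` {0<..}" for z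
    proof -
      obtain r where "z = of_real r" "r \<in> {0<..}"
        using z by (rule imageE)
      then have r: "z = of_real r" "0 < r"
        by simp_all
      have "L (of_real r) = (LBINT t:{0..}. complex_of_real (exp (- r * t) * \<phi> t))"
        unfolding L_def by (simp add: exp_of_real[symmetric])
      also have "\<dots> = of_real (LBINT t:{0..}. exp (- r * t) * \<phi> t)"
        by (rule set_integral_complex_of_real)
      also have "\<dots> = G z"
        using eq r by simp
      finally show ?thesis
        using r by simp
    qed
  qed (use p in \<open>auto simp: open_halfspace_Re_gt\<close>)
  then show ?thesis
    by (simp add: L_def)
qed

text \<open>The Gamma integral after the substitution u = r t. Besides the Caputo kernel it supplies
  integrability of \<tau>^(-1/2) and similar weights, and with \<delta> = -1 the transform of
  t.\<close>

lemma laplace_powr_real: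
  fixes \<delta> r :: real
  assumes "\<delta> < 1" "0 < r"
  shows "set_integrable lborel {0..} (\<lambda>t. exp (- r * t) * t powr - \<delta>)"
    and "(LBINT t:{0..}. exp (- r * t) * t powr - \<delta>) = Gamma (1 - \<delta>) * r powr (\<delta> - 1)"
proof -
  have hi: "((\<lambda>t. t powr - \<delta> / exp t) has_integral Gamma (1 - \<delta>)) {0..}"
    using Gamma_integral_real[of "1 - \<delta>"] assms by simp
  then have "(\<lambda>t. t powr - \<delta> / exp t) absolutely_integrable_on {0..}"
    by (intro nonnegative_absolutely_integrable_1) (auto simp: integrable_on_def)
  then have si: "set_integrable lborel {0..} (\<lambda>t. t powr - \<delta> / exp t)"
    by (subst set_integrable_lborel_iff) (auto simp: set_borel_measurable_def)
  define f where "f u = indicator {0..} u *\<^sub>R (u powr - \<delta> / exp u)" for u :: real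
  have f: "integrable lborel f"
    using si unfolding set_integrable_def f_def .
  have f_val: "integral\<^sup>L lborel f = Gamma (1 - \<delta>)"
    using set_borel_integral_eq_integral(2)[OF si] integral_unique[OF hi]
    unfolding set_lebesgue_integral_def f_def by simp
  have eq: "f (0 + r * t) = r powr - \<delta> * (indicator {0..} t *\<^sub>R (exp (- r * t) * t powr - \<delta>))" for t
    using assms unfolding f_def
    by (auto simp: indicator_def powr_mult exp_minus divide_inverse zero_le_mult_iff)
  have rr: "r powr \<delta> * r powr - \<delta> = 1"
    using assms by (simp add: powr_add[symmetric])
  have "integrable lborel (\<lambda>t. r powr \<delta> * (r powr - \<delta> * (indicator {0..} t *\<^sub>R (exp (- r * t) * t powr - \<delta>))))"
    using lborel_integrable_real_affine[OF f, of r 0] assms unfolding eq by (intro integrable_mult_right) auto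
  then show "set_integrable lborel {0..} (\<lambda>t. exp (- r * t) * t powr - \<delta>)"
    unfolding set_integrable_def using rr by (simp add: mult.assoc[symmetric])
  have "Gamma (1 - \<delta>) = r * (LBINT t. f (0 + r * t))"
    using lborel_integral_real_affine[of r f 0] assms f_val by simp
  also have "(LBINT t. f (0 + r * t)) = r powr - \<delta> * (LBINT t:{0..}. exp (- r * t) * t powr - \<delta>)"
    unfolding eq set_lebesgue_integral_def by (rule integral_mult_right_zero)
  finally have "Gamma (1 - \<delta>) * r powr (\<delta> - 1)
      = r * (r powr - \<delta> * (LBINT t:{0..}. exp (- r * t) * t powr - \<delta>)) * (r powr \<delta> / r)"
    using assms by (simp add: powr_diff)
  then show "(LBINT t:{0..}. exp (- r * t) * t powr - \<delta>) = Gamma (1 - \<delta>) * r powr (\<delta> - 1)"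
    using rr assms by (simp add: field_simps)
qed

lemma laplace_powr:
  fixes \<delta> :: real
  assumes "\<delta> < 1" "0 < Re p"
  shows "(LBINT t:{0..}. exp (- p * of_real t) * complex_of_real (t powr - \<delta>))
    = of_real (Gamma (1 - \<delta>)) * p powr of_real (\<delta> - 1)"
proof (rule laplace_analytic_continuation[OF laplace_powr_real(1)[OF assms(1)] _ _ assms(2)])
  show "(\<lambda>p. of_real (Gamma (1 - \<delta>)) * p powr of_real (\<delta> - 1)) holomorphic_on {p. 0 < Re p}"
    by (intro holomorphic_intros) (auto simp: complex_nonpos_Reals_iff)
  show "of_real (LBINT t:{0..}. exp (- r * t) * t powr - \<delta>)
      = of_real (Gamma (1 - \<delta>)) * complex_of_real r powr of_real (\<delta> - 1)" if "0 < r" for r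
    using laplace_powr_real(2)[OF assms(1) that] powr_of_real[of r "\<delta> - 1"] that by simp
qed

section \<open>The heat kernel with a Robin boundary condition\<close>

lemma set_integral_Ioi_eq_Ici:
  fixes f :: "real \<Rightarrow> 'a::{banach, second_countable_topology}"
  assumes [measurable]: "f \<in> borel_measurable borel"
  shows "(LBINT s:{x<..}. f s) = (LBINT s:{x..}. f s)"
  unfolding set_lebesgue_integral_def
proof (rule integral_cong_AE)
  show "AE s in lborel. indicat_real {x<..} s *\<^sub>R f s = indicat_real {x..} s *\<^sub>R f s"
    using AE_lborel_singleton[of x] by eventually_elim (auto simp: indicator_def)
qed measurable

lemma gaussian_set_integrable: "set_integrable lborel {y..} (\<lambda>s::real. exp (- s\<^sup>2))"
proof -
  have *: "integrable lborel (\<lambda>s::real. indicator {0..} s *\<^sub>R exp (- s\<^sup>2))"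
    using gaussian_moment_0 by (simp add: has_bochner_integral_iff)
  have "integrable lborel (\<lambda>s::real. indicator {0..} s *\<^sub>R exp (- s\<^sup>2) + indicator {0..} (0 + (-1) * s) *\<^sub>R exp (- (0 + (-1) * s)\<^sup>2))"
    by (intro Bochner_Integration.integrable_add lborel_integrable_real_affine[OF *] *) simp
  then show ?thesis
    unfolding set_integrable_def
    by (rule Bochner_Integration.integrable_bound) (auto simp: indicator_def)
qed

lemma erfc_0: "erfc 0 = 1"
  using gaussian_moment_0 by (simp add: erfc_def set_lebesgue_integral_def has_bochner_integral_iff)

lemma erfc_nonneg: "0 \<le> erfc y"
  unfolding erfc_def set_lebesgue_integral_def by (intro mult_nonneg_nonneg integral_nonneg_AE) auto

lemma has_real_derivative_erfc:
  "(erfc has_real_derivative - (2 / sqrt pi) * exp (- y\<^sup>2)) (at y)"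
proof -
  define T where "T y = (LBINT s:{y..}. exp (- s\<^sup>2))" for y :: real
  \<comment> \<open>A fixed base point to the left of y turns the moving lower limit into a moving
    upper limit.\<close>
  define a where "a = y - 1"
  have T: "T x = T a - integral {a..x} (\<lambda>s. exp (- s\<^sup>2))" if "a \<le> x" for x
  proof -
    have si: "set_integrable lborel {a..x} (\<lambda>s::real. exp (- s\<^sup>2))"
      using gaussian_set_integrable[of a] by (rule set_integrable_subset) auto
    have "T a = (LBINT s:{a..x} \<union> {x<..}. exp (- s\<^sup>2))"
    proof -
      have "{a..} = {a..x} \<union> {x<..}"
        using that by auto
      then show ?thesis
        unfolding T_def by simp
    qed
    also have "\<dots> = (LBINT s:{a..x}. exp (- s\<^sup>2)) + (LBINT s:{x<..}. exp (- s\<^sup>2))"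
    proof (rule set_integral_Un[OF _ si])
      show "set_integrable lborel {x<..} (\<lambda>s::real. exp (- s\<^sup>2))"
        using gaussian_set_integrable[of x] by (rule set_integrable_subset) auto
    qed auto
    also have "(LBINT s:{x<..}. exp (- s\<^sup>2)) = T x"
      unfolding T_def by (rule set_integral_Ioi_eq_Ici) simp
    also have "(LBINT s:{a..x}. exp (- s\<^sup>2)) = integral {a..x} (\<lambda>s. exp (- s\<^sup>2))"
      using set_borel_integral_eq_integral(2)[OF si] .
    finally show ?thesis
      by simp
  qed
  have "((\<lambda>x. integral {a..x} (\<lambda>s. exp (- s\<^sup>2))) has_real_derivative exp (- y\<^sup>2)) (at y within {a..y + 1})"
    by (rule integral_has_real_derivative) (auto intro!: continuous_intros simp: a_def)
  then have "((\<lambda>x. integral {a..x} (\<lambda>s. exp (- s\<^sup>2))) has_real_derivative exp (- y\<^sup>2)) (at y)"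
    by (simp add: a_def at_within_Icc_at)
  from DERIV_cmult[OF DERIV_diff[OF DERIV_const[of "T a"] this], of "2 / sqrt pi"]
  have "((\<lambda>x. 2 / sqrt pi * (T a - integral {a..x} (\<lambda>s. exp (- s\<^sup>2)))) has_real_derivative - (2 / sqrt pi) * exp (- y\<^sup>2)) (at y)"
    by simp
  then show ?thesis
  proof (rule has_field_derivative_transform_within_open)
    show "2 / sqrt pi * (T a - integral {a..x} (\<lambda>s. exp (- s\<^sup>2))) = erfc x" if "x \<in> {a<..}" for x
      using T[of x] that unfolding erfc_def T_def by simp
  qed (auto simp: a_def)
qed

lemma DERIV_erfc [derivative_intros]:
  assumes "(f has_real_derivative f') (at x within S)"
  shows "((\<lambda>x. erfc (f x)) has_real_derivative - (2 / sqrt pi) * exp (- (f x)\<^sup>2) * f') (at x within S)"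
  using DERIV_chain2[OF has_real_derivative_erfc assms] by simp

lemma isCont_erfc: "isCont erfc y"
  using has_real_derivative_erfc by (rule DERIV_isCont)

lemma continuous_on_erfc [continuous_intros]: "continuous_on A f \<Longrightarrow> continuous_on A (\<lambda>x. erfc (f x))"
  by (rule continuous_on_compose2[OF continuous_at_imp_continuous_on[of UNIV erfc]]) (auto intro: isCont_erfc)

lemma borel_measurable_erfc [measurable]: "erfc \<in> borel_measurable borel"
  by (intro borel_measurable_continuous_onI continuous_intros)

text \<open>The function erfc y + erfc (-y) has zero derivative and the value 2 at 0.\<close>

lemma erfc_minus: "erfc (- y) = 2 - erfc y"
proof -
  have "\<forall>y. ((\<lambda>y. erfc y + erfc (- y)) has_real_derivative 0) (at y)"
    by (auto intro!: derivative_eq_intros)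
  from DERIV_isconst_all[OF this, of y 0] show ?thesis
    by (simp add: erfc_0)
qed

lemma erfc_le_2: "erfc y \<le> 2"
  using erfc_nonneg[of "- y"] by (simp add: erfc_minus)

lemma tendsto_erfc_at_top: "(erfc \<longlongrightarrow> 0) at_top"
proof -
  have "((\<lambda>y. \<integral>s. indicator {y..} s *\<^sub>R exp (- s\<^sup>2 :: real) \<partial>lborel) \<longlongrightarrow> (\<integral>s. 0 \<partial>(lborel :: real measure))) at_top"
  proof (rule integral_dominated_convergence_at_top[where w = "\<lambda>s. indicator {0..} s *\<^sub>R exp (- s\<^sup>2)"])
    show "integrable lborel (\<lambda>s::real. indicator {0..} s *\<^sub>R exp (- s\<^sup>2))"
      using gaussian_set_integrable[of 0] by (simp add: set_integrable_def)
    show "AE s in lborel. ((\<lambda>y. indicator {y..} s *\<^sub>R exp (- s\<^sup>2 :: real)) \<longlongrightarrow> 0) at_top"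
    proof (rule AE_I2, rule tendsto_eventually)
      fix s :: real
      show "\<forall>\<^sub>F y in at_top. indicator {y..} s *\<^sub>R exp (- s\<^sup>2 :: real) = 0"
        using eventually_gt_at_top[of s] by eventually_elim simp
    qed
    show "\<forall>\<^sub>F y in at_top. AE s in lborel. norm (indicator {y..} s *\<^sub>R exp (- s\<^sup>2 :: real)) \<le> indicator {0..} s *\<^sub>R exp (- s\<^sup>2)"
      using eventually_ge_at_top[of 0] by eventually_elim (auto simp: indicator_def)
  qed auto
  from tendsto_mult[OF tendsto_const[of "2 / sqrt pi"] this] show ?thesis
    by (simp add: erfc_def[abs_def] set_lebesgue_integral_def)
qed

lemma tendsto_erfc_at_bot: "(erfc \<longlongrightarrow> 2) at_bot"
proof -
  have "((\<lambda>y. 2 - erfc (- y)) \<longlongrightarrow> 2 - 0) at_bot"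
    by (intro tendsto_intros filterlim_compose[OF tendsto_erfc_at_top] filterlim_uminus_at_top_at_bot)
  then show ?thesis
    by (simp add: erfc_minus)
qed

text \<open>For x \<ge> 0, exp (\<gamma>^2 \<tau>) times this function is the response of the heat
  equation on the half-line to a unit impulse in the boundary condition -v_x + \<gamma> v at x =
  0.\<close>

definition robin_kernel :: "real \<Rightarrow> real \<Rightarrow> real \<Rightarrow> real" where
  "robin_kernel \<gamma> x \<tau> = 1 / sqrt (pi * \<tau>) * exp (- (x\<^sup>2 / (4 * \<tau>) + \<tau> * \<gamma>\<^sup>2))
     - \<gamma> * exp (\<gamma> * x) * erfc (x / (2 * sqrt \<tau>) + \<gamma> * sqrt \<tau>)"

lemma borel_measurable_robin_kernel [measurable]: "robin_kernel \<gamma> x \<in> borel_measurable borel"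
  unfolding robin_kernel_def[abs_def] by measurable

text \<open>The Gaussian factor is at most 1 and erfc at most 2, so the only singularity is
  \<tau>^(-1/2). The bound also holds at \<tau> = 0, where the singular terms on both sides are 0 by
  convention.\<close>

lemma abs_robin_kernel_le:
  assumes "0 \<le> \<tau>" "0 < \<gamma>"
  shows "\<bar>robin_kernel \<gamma> x \<tau>\<bar> \<le> \<tau> powr - (1 / 2) + 2 * \<gamma> * exp (\<gamma> * x)"
proof -
  have "sqrt \<tau> \<le> sqrt (pi * \<tau>)"
  proof (rule real_sqrt_le_mono)
    have "1 * \<tau> \<le> pi * \<tau>"
      using assms pi_ge_two by (intro mult_right_mono) linarith+
    then show "\<tau> \<le> pi * \<tau>"
      by simp
  qed
  then have "1 / sqrt (pi * \<tau>) \<le> 1 / sqrt \<tau>"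
  proof (cases "\<tau> = 0")
    case False
    then have "0 < sqrt \<tau>"
      using assms by simp
    with \<open>sqrt \<tau> \<le> sqrt (pi * \<tau>)\<close> show ?thesis
      using frac_le[of 1 1 "sqrt \<tau>" "sqrt (pi * \<tau>)"] by simp
  qed simp
  also have "\<dots> = \<tau> powr - (1 / 2)"
    using assms by (simp add: powr_minus_divide powr_half_sqrt)
  finally have A: "1 / sqrt (pi * \<tau>) \<le> \<tau> powr - (1 / 2)" .
  have "exp (- (x\<^sup>2 / (4 * \<tau>) + \<tau> * \<gamma>\<^sup>2)) \<le> 1"
  proof -
    have "0 \<le> x\<^sup>2 / (4 * \<tau>) + \<tau> * \<gamma>\<^sup>2"
      using assms by (intro add_nonneg_nonneg divide_nonneg_nonneg mult_nonneg_nonneg) simp_all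
    then show ?thesis
      by simp
  qed
  with A have "1 / sqrt (pi * \<tau>) * exp (- (x\<^sup>2 / (4 * \<tau>) + \<tau> * \<gamma>\<^sup>2)) \<le> \<tau> powr - (1 / 2) * 1"
    by (rule mult_mono) (simp_all add: assms)
  moreover have "\<gamma> * exp (\<gamma> * x) * erfc (x / (2 * sqrt \<tau>) + \<gamma> * sqrt \<tau>) \<le> \<gamma> * exp (\<gamma> * x) * 2"
    using assms by (intro mult_left_mono erfc_le_2) simp
  moreover have "0 \<le> 1 / sqrt (pi * \<tau>) * exp (- (x\<^sup>2 / (4 * \<tau>) + \<tau> * \<gamma>\<^sup>2))"
    using assms by simp
  moreover have "0 \<le> \<gamma> * exp (\<gamma> * x) * erfc (x / (2 * sqrt \<tau>) + \<gamma> * sqrt \<tau>)"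
    using assms erfc_nonneg by simp
  ultimately show ?thesis
    unfolding robin_kernel_def abs_le_iff by linarith
qed

lemma set_integrable_robin_kernel:
  assumes "0 < \<gamma>" "0 < r"
  shows "set_integrable lborel {0..} (\<lambda>\<tau>. exp (- r * \<tau>) * robin_kernel \<gamma> x \<tau>)"
proof -
  have "set_integrable lborel {0..} (\<lambda>\<tau>. exp (- r * \<tau>) * \<tau> powr - (1 / 2) + exp (- r * \<tau>) * \<tau> powr - 0 * (2 * \<gamma> * exp (\<gamma> * x)))"
    using assms by (intro set_integral_add set_integrable_mult_left impI laplace_powr_real(1)) auto
  then show ?thesis
    unfolding set_integrable_def
  proof (rule Bochner_Integration.integrable_bound)
    show "AE \<tau> in lborel. norm (indicat_real {0..} \<tau> *\<^sub>R (exp (- r * \<tau>) * robin_kernel \<gamma> x \<tau>))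
      \<le> norm (indicat_real {0..} \<tau> *\<^sub>R (exp (- r * \<tau>) * \<tau> powr - (1 / 2) + exp (- r * \<tau>) * \<tau> powr - 0 * (2 * \<gamma> * exp (\<gamma> * x))))"
      using AE_lborel_singleton[of 0]
    proof eventually_elim
      fix \<tau> :: real assume "\<tau> \<noteq> 0"
      show "norm (indicat_real {0..} \<tau> *\<^sub>R (exp (- r * \<tau>) * robin_kernel \<gamma> x \<tau>))
        \<le> norm (indicat_real {0..} \<tau> *\<^sub>R (exp (- r * \<tau>) * \<tau> powr - (1 / 2) + exp (- r * \<tau>) * \<tau> powr - 0 * (2 * \<gamma> * exp (\<gamma> * x))))"
      proof (cases "0 < \<tau>")
        case True
        then have "\<bar>exp (- r * \<tau>) * robin_kernel \<gamma> x \<tau>\<bar> \<le> exp (- r * \<tau>) * (\<tau> powr - (1 / 2) + 2 * \<gamma> * exp (\<gamma> * x))"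
          using mult_left_mono[OF abs_robin_kernel_le[of \<tau> \<gamma> x], of "exp (- r * \<tau>)"] assms
          by (simp add: abs_mult)
        then show ?thesis
          using True by (simp add: distrib_left)
      qed (use \<open>\<tau> \<noteq> 0\<close> in simp)
    qed
  qed measurable
qed

text \<open>The integrand has an antiderivative in closed form. The derivative of \<Theta> c carries
  the Gaussian factor exp (-(x^2 / (4 \<tau>) + c^2 \<tau>)); since s^2 = q + \<gamma>^2, the
  choices c = s, c = -s, and c = \<gamma> with weight exp (-q \<tau>), share one such factor and can
  be combined.\<close>

lemma laplace_robin_kernel_real:
  assumes \<gamma>: "0 < \<gamma>" and q: "0 < q" and x: "0 \<le> x"
  defines "s \<equiv> sqrt (q + \<gamma>\<^sup>2)"
  shows "(LBINT \<tau>:{0..}. exp (- q * \<tau>) * robin_kernel \<gamma> x \<tau>) = exp (- x * s) / (s + \<gamma>)"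
proof -
  have s2: "s\<^sup>2 = q + \<gamma>\<^sup>2" and s: "\<gamma> < s"
    using q \<gamma> by (auto simp: s_def intro!: real_less_rsqrt)
  define \<Theta> where "\<Theta> c \<tau> = exp (c * x) * erfc (x / (2 * sqrt \<tau>) + c * sqrt \<tau>)" for c \<tau>
  have d\<Theta>: "(\<Theta> c has_real_derivative - (1 / sqrt pi) * exp (- (x\<^sup>2 / (4 * \<tau>) + c\<^sup>2 * \<tau>)) * (c / sqrt \<tau> - x / (2 * \<tau> * sqrt \<tau>))) (at \<tau>)"
    if \<tau>: "0 < \<tau>" for c \<tau>
  proof -
    define arg where "arg = x / (2 * sqrt \<tau>) + c * sqrt \<tau>"
    have "((\<lambda>\<tau>. x / (2 * sqrt \<tau>) + c * sqrt \<tau>) has_real_derivative (c / sqrt \<tau> - x / (2 * \<tau> * sqrt \<tau>)) / 2) (at \<tau>)"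
      using \<tau> by (auto intro!: derivative_eq_intros simp: field_simps)
    from DERIV_cmult[OF DERIV_erfc[OF this], of "exp (c * x)"]
    have "(\<Theta> c has_real_derivative exp (c * x) * (- (2 / sqrt pi) * exp (- arg\<^sup>2) * ((c / sqrt \<tau> - x / (2 * \<tau> * sqrt \<tau>)) / 2))) (at \<tau>)"
      unfolding \<Theta>_def arg_def .
    moreover have "exp (c * x) * exp (- arg\<^sup>2) = exp (- (x\<^sup>2 / (4 * \<tau>) + c\<^sup>2 * \<tau>))"
    proof -
      have "arg\<^sup>2 = x\<^sup>2 / (4 * \<tau>) + c * x + c\<^sup>2 * \<tau>"
        using \<tau> unfolding arg_def by (simp add: power2_sum power_divide power_mult_distrib field_simps)
      then show ?thesis
        by (simp add: exp_add[symmetric])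
    qed
    moreover have "exp (c * x) * (- (2 / sqrt pi) * exp (- arg\<^sup>2) * (D / 2)) = - (1 / sqrt pi) * (exp (c * x) * exp (- arg\<^sup>2)) * D" for D
      by simp
    ultimately show ?thesis
      by (simp only:)
  qed
  \<comment> \<open>Integrating the erfc term of the kernel by parts fixes the first coefficient.
    The other two make the \<tau>^(-3/2) terms cancel and leave \<tau>^(-1/2) with coefficient (s^2
    - \<gamma>^2) / q = 1.\<close>
  define Z where "Z \<tau> = \<gamma> / q * (exp (- q * \<tau>) * \<Theta> \<gamma> \<tau>) - (\<gamma> + s) / (2 * q) * \<Theta> s \<tau> + (s - \<gamma>) / (2 * q) * \<Theta> (- s) \<tau>" for \<tau>
  have dZ: "(Z has_real_derivative exp (- q * \<tau>) * robin_kernel \<gamma> x \<tau>) (at \<tau>)" if \<tau>: "0 < \<tau>" for \<tau>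
  proof -
    define E where "E = exp (- (x\<^sup>2 / (4 * \<tau>) + s\<^sup>2 * \<tau>)) / sqrt pi"
    define A where "A = 1 / sqrt \<tau>"
    define B where "B = x / (2 * \<tau> * sqrt \<tau>)"
    have e1: "exp (- q * \<tau>) * exp (- (x\<^sup>2 / (4 * \<tau>) + \<gamma>\<^sup>2 * \<tau>)) = E * sqrt pi"
      unfolding exp_add[symmetric] E_def s2 by (simp add: algebra_simps)
    define D where "D c = - (1 / sqrt pi) * exp (- (x\<^sup>2 / (4 * \<tau>) + c\<^sup>2 * \<tau>)) * (c / sqrt \<tau> - x / (2 * \<tau> * sqrt \<tau>))" for c
    have d\<Theta>': "(\<Theta> c has_real_derivative D c) (at \<tau>)" for c
      unfolding D_def by (rule d\<Theta>[OF \<tau>])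
    have "((\<lambda>\<tau>. exp (- q * \<tau>)) has_real_derivative exp (- q * \<tau>) * (- q)) (at \<tau>)"
      by (auto intro!: derivative_eq_intros)
    from DERIV_add[OF DERIV_diff[OF DERIV_cmult[OF DERIV_mult[OF this d\<Theta>'], of "\<gamma> / q"]
        DERIV_cmult[OF d\<Theta>', of "(\<gamma> + s) / (2 * q)"]] DERIV_cmult[OF d\<Theta>', of "(s - \<gamma>) / (2 * q)"]]
    have "(Z has_real_derivative
        \<gamma> / q * (exp (- q * \<tau>) * (- q) * \<Theta> \<gamma> \<tau> + D \<gamma> * exp (- q * \<tau>)) - (\<gamma> + s) / (2 * q) * D s
        + (s - \<gamma>) / (2 * q) * D (- s)) (at \<tau>)"
      unfolding Z_def .
    also have "\<gamma> / q * (exp (- q * \<tau>) * (- q) * \<Theta> \<gamma> \<tau> + D \<gamma> * exp (- q * \<tau>)) - (\<gamma> + s) / (2 * q) * D s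
        + (s - \<gamma>) / (2 * q) * D (- s)
      = - \<gamma> * (exp (- q * \<tau>) * \<Theta> \<gamma> \<tau>) + E * (- \<gamma> / q * (\<gamma> * A - B) + (\<gamma> + s) / (2 * q) * (s * A - B) + (s - \<gamma>) / (2 * q) * (s * A + B))"
    proof -
      have "D \<gamma> * exp (- q * \<tau>) = - (exp (- q * \<tau>) * exp (- (x\<^sup>2 / (4 * \<tau>) + \<gamma>\<^sup>2 * \<tau>))) / sqrt pi * (\<gamma> * A - B)"
        by (simp add: D_def A_def B_def)
      also have "\<dots> = - E * (\<gamma> * A - B)"
        unfolding e1 by simp
      finally have t1: "D \<gamma> * exp (- q * \<tau>) = - E * (\<gamma> * A - B)" .
      have t2: "D s = - E * (s * A - B)"
        by (simp add: D_def A_def B_def E_def)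
      have t3: "D (- s) = E * (s * A + B)"
      proof -
        have "- s / sqrt \<tau> - x / (2 * \<tau> * sqrt \<tau>) = - (s * A + B)"
          by (simp add: A_def B_def)
        then have "D (- s) = - (1 / sqrt pi) * exp (- (x\<^sup>2 / (4 * \<tau>) + (- s)\<^sup>2 * \<tau>)) * - (s * A + B)"
          unfolding D_def by (simp only:)
        moreover have "- (1 / sqrt pi) * X * - Y = X / sqrt pi * Y" for X Y :: real
          by simp
        ultimately show ?thesis
          by (simp only: E_def power2_minus)
      qed
      have ring: "T + c1 * (- E * u) - c2 * (- E * v) + c3 * (E * w) = T + E * (- c1 * u + c2 * v + c3 * w)"
        for T c1 c2 c3 u v w :: real
        by (simp add: algebra_simps)
      have t4: "\<gamma> / q * (exp (- q * \<tau>) * (- q) * \<Theta> \<gamma> \<tau>) = - \<gamma> * (exp (- q * \<tau>) * \<Theta> \<gamma> \<tau>)"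
        using q by simp
      show ?thesis
        unfolding distrib_left[of "\<gamma> / q"] t1 t2 t3 t4 ring by simp
    qed
    also have "- \<gamma> / q * (\<gamma> * A - B) + (\<gamma> + s) / (2 * q) * (s * A - B) + (s - \<gamma>) / (2 * q) * (s * A + B) = (s\<^sup>2 - \<gamma>\<^sup>2) / q * A"
      using q by (simp add: field_simps power2_eq_square)
    also have "- \<gamma> * (exp (- q * \<tau>) * \<Theta> \<gamma> \<tau>) + E * ((s\<^sup>2 - \<gamma>\<^sup>2) / q * A) = exp (- q * \<tau>) * robin_kernel \<gamma> x \<tau>"
    proof -
      have "exp (- q * \<tau>) * (1 / sqrt (pi * \<tau>) * exp (- (x\<^sup>2 / (4 * \<tau>) + \<tau> * \<gamma>\<^sup>2)))
        = (exp (- q * \<tau>) * exp (- (x\<^sup>2 / (4 * \<tau>) + \<gamma>\<^sup>2 * \<tau>))) / sqrt pi * A"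
        by (simp add: A_def real_sqrt_mult mult.commute)
      also have "\<dots> = E * A"
        unfolding e1 by simp
      finally have "exp (- q * \<tau>) * (1 / sqrt (pi * \<tau>) * exp (- (x\<^sup>2 / (4 * \<tau>) + \<tau> * \<gamma>\<^sup>2))) = E * A" .
      then show ?thesis
        unfolding robin_kernel_def right_diff_distrib \<Theta>_def s2 using q by simp
    qed
    finally show ?thesis .
  qed
  have arg_top: "filterlim (\<lambda>\<tau>. x / (2 * sqrt \<tau>) + c * sqrt \<tau>) at_top at_top" if "0 < c" for c
    using that by real_asymp
  have arg_bot: "filterlim (\<lambda>\<tau>. x / (2 * sqrt \<tau>) + c * sqrt \<tau>) at_bot at_top" if "c < 0" for c
    using that by real_asymp
  have arg_0: "filterlim (\<lambda>\<tau>. x / (2 * sqrt \<tau>) + c * sqrt \<tau>) at_top (at_right 0)" if "0 < x" for c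
    using that by real_asymp
  have exp_top: "((\<lambda>\<tau>. exp (- q * \<tau>)) \<longlongrightarrow> 0) at_top"
    using q by real_asymp
  \<comment> \<open>At infinity only \<Theta> (-s) survives, because erfc tends to 2 at minus
    infinity; q = (s - \<gamma>) (s + \<gamma>) then simplifies its coefficient.\<close>
  have lim_top: "(Z \<longlongrightarrow> \<gamma> / q * (0 * (exp (\<gamma> * x) * 0)) - (\<gamma> + s) / (2 * q) * (exp (s * x) * 0) + (s - \<gamma>) / (2 * q) * (exp (- s * x) * 2)) at_top"
    unfolding Z_def \<Theta>_def using \<gamma> s
    by (intro tendsto_intros exp_top filterlim_compose[OF tendsto_erfc_at_top arg_top]
        filterlim_compose[OF tendsto_erfc_at_bot arg_bot]) (use q in simp_all)
  also have "\<gamma> / q * (0 * (exp (\<gamma> * x) * 0)) - (\<gamma> + s) / (2 * q) * (exp (s * x) * 0) + (s - \<gamma>) / (2 * q) * (exp (- s * x) * 2) = exp (- x * s) / (s + \<gamma>)"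
  proof -
    have "q = (s - \<gamma>) * (s + \<gamma>)"
      using s2 by (simp add: power2_eq_square algebra_simps)
    then show ?thesis
      using s \<gamma> by (simp add: divide_simps mult.commute)
  qed
  finally have top: "(Z \<longlongrightarrow> exp (- x * s) / (s + \<gamma>)) at_top" .
  have bot: "(Z \<longlongrightarrow> 0) (at_right 0)"
  \<comment> \<open>For x > 0 every erfc argument tends to infinity; for x = 0 all of them tend to 0
    and the signed coefficients add up to 0.\<close>
  proof (cases "x = 0")
    case True
    have e0: "((\<lambda>\<tau>. erfc (c * sqrt \<tau>)) \<longlongrightarrow> erfc 0) (at_right 0)" for c
    proof (rule isCont_tendsto_compose[OF isCont_erfc])
      show "((\<lambda>\<tau>. c * sqrt \<tau>) \<longlongrightarrow> 0) (at_right 0)"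
        by real_asymp
    qed
    have x0: "((\<lambda>\<tau>. exp (- q * \<tau>)) \<longlongrightarrow> 1) (at_right 0)"
      by real_asymp
    have "(Z \<longlongrightarrow> \<gamma> / q * (1 * erfc 0) - (\<gamma> + s) / (2 * q) * erfc 0 + (s - \<gamma>) / (2 * q) * erfc 0) (at_right 0)"
    proof -
      have "Z = (\<lambda>\<tau>. \<gamma> / q * (exp (- q * \<tau>) * erfc (\<gamma> * sqrt \<tau>)) - (\<gamma> + s) / (2 * q) * erfc (s * sqrt \<tau>)
          + (s - \<gamma>) / (2 * q) * erfc ((- s) * sqrt \<tau>))"
        by (rule ext) (simp add: Z_def \<Theta>_def True)
      then show ?thesis
        using q by (auto simp only: intro!: tendsto_intros e0 x0)
    qed
    also have "\<gamma> / q * (1 * erfc 0) - (\<gamma> + s) / (2 * q) * erfc 0 + (s - \<gamma>) / (2 * q) * erfc 0 = 0"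
      using q by (simp add: erfc_0 field_simps)
    finally show ?thesis .
  next
    case False
    then have x: "0 < x"
      using x by simp
    have x0: "((\<lambda>\<tau>. exp (- q * \<tau>)) \<longlongrightarrow> 1) (at_right 0)"
      by real_asymp
    have "(Z \<longlongrightarrow> \<gamma> / q * (1 * (exp (\<gamma> * x) * 0)) - (\<gamma> + s) / (2 * q) * (exp (s * x) * 0) + (s - \<gamma>) / (2 * q) * (exp (- s * x) * 0)) (at_right 0)"
      unfolding Z_def \<Theta>_def
      by (intro tendsto_intros x0 filterlim_compose[OF tendsto_erfc_at_top arg_0] x) (use q in auto)
    then show ?thesis
      by simp
  qed
  have cont: "isCont (\<lambda>\<tau>. exp (- q * \<tau>) * robin_kernel \<gamma> x \<tau>) \<tau>" if "0 < \<tau>" for \<tau>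
    unfolding robin_kernel_def using that
    by (intro continuous_intros isCont_o2[OF _ isCont_erfc]) auto
  have int: "set_integrable lborel {0<..} (\<lambda>\<tau>. exp (- q * \<tau>) * robin_kernel \<gamma> x \<tau>)"
    using set_integrable_robin_kernel[OF \<gamma> q] by (rule set_integrable_subset) auto
  have "(LBINT \<tau>=0..\<infinity>. exp (- q * \<tau>) * robin_kernel \<gamma> x \<tau>) = exp (- x * s) / (s + \<gamma>) - 0"
  proof (rule interval_integral_FTC_integrable)
    show "set_integrable lborel (einterval 0 \<infinity>) (\<lambda>\<tau>. exp (- q * \<tau>) * robin_kernel \<gamma> x \<tau>)"
      using int by (simp add: zero_ereal_def)
    show "((Z \<circ> real_of_ereal) \<longlongrightarrow> 0) (at_right 0)"
      using bot by (simp add: zero_ereal_def ereal_tendsto_simps)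
    show "((Z \<circ> real_of_ereal) \<longlongrightarrow> exp (- x * s) / (s + \<gamma>)) (at_left \<infinity>)"
      using top by (simp add: ereal_tendsto_simps)
  qed (use dZ cont in \<open>auto simp: has_real_derivative_iff_has_vector_derivative[symmetric]\<close>)
  moreover have "(LBINT \<tau>=0..\<infinity>. exp (- q * \<tau>) * robin_kernel \<gamma> x \<tau>) = (LBINT \<tau>:{0<..}. exp (- q * \<tau>) * robin_kernel \<gamma> x \<tau>)"
    unfolding zero_ereal_def by (rule interval_integral_to_infinity_eq)
  moreover have "(LBINT \<tau>:{0<..}. exp (- q * \<tau>) * robin_kernel \<gamma> x \<tau>) = (LBINT \<tau>:{0..}. exp (- q * \<tau>) * robin_kernel \<gamma> x \<tau>)"
    by (rule set_integral_Ioi_eq_Ici) measurable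
  ultimately show ?thesis
    by simp
qed

lemma laplace_robin_kernel:
  assumes \<gamma>: "0 < \<gamma>" and q: "0 < Re q" and x: "0 \<le> x"
  shows "(LBINT \<tau>:{0..}. exp (- q * of_real \<tau>) * complex_of_real (robin_kernel \<gamma> x \<tau>))
    = exp (- of_real x * csqrt (q + of_real (\<gamma>\<^sup>2))) / (csqrt (q + of_real (\<gamma>\<^sup>2)) + of_real \<gamma>)"
proof (rule laplace_analytic_continuation[OF set_integrable_robin_kernel[OF \<gamma>] _ _ q])
  have nz: "csqrt z + of_real \<gamma> \<noteq> 0" for z
  proof
    assume "csqrt z + of_real \<gamma> = 0"
    then have "Re (csqrt z) + \<gamma> = 0"
      by (metis Re_complex_of_real plus_complex.simps(1) zero_complex.simps(1))
    then show False
      using \<gamma> Re_csqrt[of z] by linarith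
  qed
  have "q + of_real (\<gamma>\<^sup>2) \<notin> \<real>\<^sub>\<le>\<^sub>0" if "0 < Re q" for q
    using that by (auto simp: complex_nonpos_Reals_iff add_pos_nonneg not_le intro: add_pos_nonneg)
  then show "(\<lambda>q. exp (- of_real x * csqrt (q + of_real (\<gamma>\<^sup>2))) / (csqrt (q + of_real (\<gamma>\<^sup>2)) + of_real \<gamma>)) holomorphic_on {p. 0 < Re p}"
    by (intro holomorphic_intros nz) auto
  show "of_real (LBINT t:{0..}. exp (- r * t) * robin_kernel \<gamma> x t)
      = exp (- of_real x * csqrt (of_real r + of_real (\<gamma>\<^sup>2))) / (csqrt (of_real r + of_real (\<gamma>\<^sup>2)) + of_real \<gamma>)"
    if "0 < r" for r
  proof -
    have "csqrt (of_real r + of_real (\<gamma>\<^sup>2)) = of_real (sqrt (r + \<gamma>\<^sup>2))"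
      using that csqrt_of_real[of "r + \<gamma>\<^sup>2"] by simp
    then show ?thesis
      using laplace_robin_kernel_real[OF \<gamma> that x] by (simp add: exp_of_real[symmetric])
  qed
qed

section \<open>Uniqueness by the maximum principle\<close>

text \<open>With g = f t - f \<ge> 0, integration by parts writes the integral over [0, t - e] as a
  boundary term plus the integral of a nonnegative multiple of g. Dropping the latter leaves the
  lower bound g 0 * t^(-\<delta>) - g (t - e) * e^(-\<delta>), whose last term vanishes as e tends
  to 0 because f is differentiable at t and \<delta> < 1. Stopping at t - e avoids the singularity
  at t.\<close>

lemma caputo_max_pos:
  fixes f f' :: "real \<Rightarrow> real"
  assumes \<delta>: "0 < \<delta>" "\<delta> < 1" and t: "0 < t"
    and cont: "continuous_on {0..t} f"
    and deriv: "\<And>s. s \<in> {0<..t} \<Longrightarrow> (f has_real_derivative f' s) (at s)"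
    and int: "set_integrable lborel {0..t} (\<lambda>s. f' s / (t - s) powr \<delta>)"
    and max: "\<And>s. s \<in> {0..t} \<Longrightarrow> f s \<le> f t" and "f 0 < f t"
  shows "0 < (LBINT s:{0..t}. f' s / (t - s) powr \<delta>)"
proof -
  define g where "g s = f t - f s" for s
  define h where "h s = - (g s * (t - s) powr - \<delta>)" for s
  define k where "k s = f' s / (t - s) powr \<delta>" for s
  have der: "(f has_real_derivative f' s) (at s)" if "0 < s" "s \<le> t" for s
    using deriv[of s] that by simp
  have lower: "g 0 * t powr - \<delta> - g (t - e) * e powr - \<delta> \<le> (LBINT s:{0..t - e}. k s)" if e: "0 < e" "e < t" for e
  proof -
    have ki: "set_integrable lborel {0..t - e} k"
      using int unfolding k_def by (rule set_integrable_subset) (use e in auto)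
    define k' where "k' s = k s - \<delta> * g s * (t - s) powr (- \<delta> - 1)" for s
    have "(k' has_integral (h (t - e) - h 0)) {0..t - e}"
    proof (rule fundamental_theorem_of_calculus_interior)
      show "continuous_on {0..t - e} h"
        unfolding h_def g_def using e
        by (intro continuous_intros continuous_on_subset[OF cont]) auto
      show "(h has_vector_derivative k' s) (at s)" if s: "s \<in> {0<..<t - e}" for s
      proof -
        have "((\<lambda>s. (t - s) powr - \<delta>) has_real_derivative (- \<delta> * (t - s) powr (- \<delta> - 1) * - 1)) (at s)"
          using s e by (auto intro!: derivative_eq_intros)
        moreover have "(g has_real_derivative 0 - f' s) (at s)"
          unfolding g_def using s e by (intro DERIV_diff DERIV_const der) auto
        ultimately have "(h has_real_derivative - ((0 - f' s) * (t - s) powr - \<delta> + (- \<delta> * (t - s) powr (- \<delta> - 1) * - 1) * g s)) (at s)"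
          unfolding h_def by (intro DERIV_minus DERIV_mult)
        then show ?thesis
          unfolding has_real_derivative_iff_has_vector_derivative[symmetric] k'_def k_def
          by (simp add: powr_minus_divide algebra_simps)
      qed
    qed (use e in simp)
    moreover have "(k has_integral (LBINT s:{0..t - e}. k s)) {0..t - e}"
      using set_borel_integral_eq_integral[OF ki] by (simp add: has_integral_integral)
    ultimately have "h (t - e) - h 0 \<le> (LBINT s:{0..t - e}. k s)"
    proof (rule has_integral_le)
      show "k' s \<le> k s" if "s \<in> {0..t - e}" for s
        using max[of s] that e \<delta> unfolding k'_def g_def by simp
    qed
    then show ?thesis
      using e by (simp add: h_def)
  qed
  have lim1: "((\<lambda>e. LBINT s:{0..t - e}. k s) \<longlongrightarrow> (LBINT s:{0..t}. k s)) (at_right 0)"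
    unfolding set_lebesgue_integral_def
  proof -
    define q where "q s = indicator {0..t} s *\<^sub>R k s" for s
    have q: "integrable lborel q"
      using int unfolding set_integrable_def k_def q_def .
    have "((\<lambda>e. \<integral>s. indicator {0..t - e} s *\<^sub>R q s \<partial>lborel) \<longlongrightarrow> (\<integral>s. indicator {..<t} s *\<^sub>R q s \<partial>lborel)) (at_right 0)"
    proof (rule tendsto_integral_dominated)
      show "integrable lborel (\<lambda>s. norm (q s))"
        using q by simp
      show "((\<lambda>e. indicator {0..t - e} s *\<^sub>R q s) \<longlongrightarrow> indicator {..<t} s *\<^sub>R q s) (at_right 0)" for s
      proof (rule tendsto_eventually)
        show "\<forall>\<^sub>F e in at_right 0. indicator {0..t - e} s *\<^sub>R q s = indicator {..<t} s *\<^sub>R q s"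
          unfolding eventually_at_right_field
          by (intro exI[of _ "if s < t then t - s else 1"]) (auto simp: indicator_def q_def)
      qed
    qed (use borel_measurable_integrable[OF q] in \<open>auto simp: indicator_def\<close>)
    also have "(\<integral>s. indicator {..<t} s *\<^sub>R q s \<partial>lborel) = integral\<^sup>L lborel q"
    proof (rule integral_cong_AE)
      show "AE s in lborel. indicator {..<t} s *\<^sub>R q s = q s"
        using AE_lborel_singleton[of t] by eventually_elim (auto simp: indicator_def q_def)
    qed (use borel_measurable_integrable[OF q] in auto)
    finally have "((\<lambda>e. \<integral>s. indicator {0..t - e} s *\<^sub>R q s \<partial>lborel) \<longlongrightarrow> integral\<^sup>L lborel q) (at_right 0)" .
    moreover have "\<forall>\<^sub>F e in at_right 0. (\<integral>s. indicator {0..t - e} s *\<^sub>R q s \<partial>lborel) = (\<integral>s. indicator {0..t - e} s *\<^sub>R k s \<partial>lborel)"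
      unfolding eventually_at_right_field
      by (intro exI[of _ 1] conjI allI impI Bochner_Integration.integral_cong) (auto simp: indicator_def q_def)
    ultimately show "((\<lambda>e. \<integral>s. indicator {0..t - e} s *\<^sub>R k s \<partial>lborel) \<longlongrightarrow> (\<integral>s. indicator {0..t} s *\<^sub>R k s \<partial>lborel)) (at_right 0)"
      unfolding q_def[symmetric] by (rule Lim_transform_eventually)
  qed
  have lim2: "((\<lambda>e. g (t - e) * e powr - \<delta>) \<longlongrightarrow> 0) (at_right 0)"
  proof -
    have "((\<lambda>y. (f y - f t) / (y - t)) \<longlongrightarrow> f' t) (at t)"
      using der[of t] t by (simp add: has_field_derivative_iff)
    moreover have "filterlim (\<lambda>e. t - e) (at t) (at_right 0)"
      unfolding filterlim_at by (auto intro!: tendsto_eq_intros simp: eventually_at_filter)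
    ultimately have "((\<lambda>e. (f (t - e) - f t) / (t - e - t)) \<longlongrightarrow> f' t) (at_right 0)"
      by (rule filterlim_compose)
    then have "((\<lambda>e. g (t - e) / e) \<longlongrightarrow> f' t) (at_right 0)"
      by (simp add: g_def minus_divide_left[symmetric] minus_divide_right[symmetric] diff_divide_distrib)
    moreover have "((\<lambda>e. e powr (1 - \<delta>)) \<longlongrightarrow> 0) (at_right 0)"
      using \<delta> by real_asymp
    ultimately have "((\<lambda>e. g (t - e) / e * e powr (1 - \<delta>)) \<longlongrightarrow> f' t * 0) (at_right 0)"
      by (rule tendsto_mult)
    moreover have "\<forall>\<^sub>F e in at_right 0. g (t - e) / e * e powr (1 - \<delta>) = g (t - e) * e powr - \<delta>"
      unfolding eventually_at_right_field
      by (intro exI[of _ 1]) (auto simp: powr_diff powr_minus_divide)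
    ultimately show ?thesis
      by (auto elim: Lim_transform_eventually)
  qed
  have "g 0 * t powr - \<delta> - 0 \<le> (LBINT s:{0..t}. k s)"
  proof (rule tendsto_le[OF _ lim1 tendsto_diff[OF tendsto_const lim2]])
    show "\<forall>\<^sub>F e in at_right 0. g 0 * t powr - \<delta> - g (t - e) * e powr - \<delta> \<le> (LBINT s:{0..t - e}. k s)"
      unfolding eventually_at_right_field using t lower by (intro exI[of _ t]) auto
  qed simp
  moreover have "0 < g 0 * t powr - \<delta>"
    using t \<open>f 0 < f t\<close> by (simp add: g_def)
  ultimately show ?thesis
    unfolding k_def by simp
qed

text \<open>If c were positive, f' would be positive immediately to the right of z, and the mean
  value theorem would raise f above its maximum.\<close>

lemma second_derivative_at_max:
  fixes f f' :: "real \<Rightarrow> real"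
  assumes z: "0 < z"
    and f': "\<And>\<zeta>. 0 < \<zeta> \<Longrightarrow> (f has_real_derivative f' \<zeta>) (at \<zeta>)"
    and f'': "(f' has_real_derivative c) (at z)"
    and max: "\<And>\<zeta>. 0 < \<zeta> \<Longrightarrow> f \<zeta> \<le> f z"
  shows "f' z = 0" and "c \<le> 0"
proof -
  show z0: "f' z = 0"
    using DERIV_local_max[OF f'[OF z] z] max by (auto simp: abs_less_iff)
  show "c \<le> 0"
  proof (rule ccontr)
    assume "\<not> c \<le> 0"
    then obtain d where d: "0 < d" "\<And>h. 0 < h \<Longrightarrow> h < d \<Longrightarrow> f' z < f' (z + h)"
      using DERIV_pos_inc_right[OF f''] by auto
    obtain \<xi> where \<xi>: "z < \<xi>" "\<xi> < z + d / 2" "f (z + d / 2) - f z = (z + d / 2 - z) * f' \<xi>"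
      using MVT2[of z "z + d / 2" f f'] f' z d by auto
    have "0 < f' \<xi>"
      using d(2)[of "\<xi> - z"] \<xi> z0 d by simp
    then have "0 < (z + d / 2 - z) * f' \<xi>"
      using d by simp
    then have "f z < f (z + d / 2)"
      using \<xi>(3) by linarith
    then show False
      using max[of "z + d / 2"] z d by simp
  qed
qed

lemma one_sided_derivative_at_max:
  fixes f :: "real \<Rightarrow> real"
  assumes "(f has_real_derivative D) (at 0 within {0..})" and "\<And>x. 0 \<le> x \<Longrightarrow> f x \<le> f 0"
  shows "D \<le> 0"
proof (rule tendsto_upperbound)
  show "((\<lambda>y. (f y - f 0) / (y - 0)) \<longlongrightarrow> D) (at 0 within {0..})"
    using assms(1) by (simp add: has_field_derivative_iff)
  show "\<forall>\<^sub>F y in at 0 within {0..}. (f y - f 0) / (y - 0) \<le> 0"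
    using assms(2) by (auto simp: eventually_at_filter divide_le_0_iff intro!: eventuallyI)
  show "at (0::real) within {0..} \<noteq> bot"
    by (simp add: at_within_Ici_at_right)
qed

lemma caputo_less_one:
  assumes "0 < \<delta>" "\<delta> < 1"
  shows "caputo \<delta> f t = 1 / Gamma (1 - \<delta>) * (LBINT s:{0..t}. deriv f s / (t - s) powr \<delta>)"
    and "caputo_differentiable \<delta> f t \<longleftrightarrow>
      (\<forall>s\<in>{0<..t}. f differentiable (at s)) \<and> set_integrable lborel {0..t} (\<lambda>s. deriv f s / (t - s) powr \<delta>)"
proof -
  have m: "nat \<lceil>\<delta>\<rceil> = 1"
    using assms by (simp add: nat_eq_iff ceiling_eq_iff)
  show "caputo \<delta> f t = 1 / Gamma (1 - \<delta>) * (LBINT s:{0..t}. deriv f s / (t - s) powr \<delta>)"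
    using assms unfolding caputo_def Let_def m by simp
  show "caputo_differentiable \<delta> f t \<longleftrightarrow>
      (\<forall>s\<in>{0<..t}. f differentiable (at s)) \<and> set_integrable lborel {0..t} (\<lambda>s. deriv f s / (t - s) powr \<delta>)"
    using assms unfolding caputo_differentiable_def Let_def m by simp
qed

lemma caputo_less_at_max:
  assumes \<delta>: "0 < \<delta>" "\<delta> < 1" and t: "0 < t"
    and cont: "continuous_on {0..t} f" "continuous_on {0..t} g"
    and diff: "caputo_differentiable \<delta> f t" "caputo_differentiable \<delta> g t"
    and max: "\<And>s. s \<in> {0..t} \<Longrightarrow> f s - g s \<le> f t - g t" and "f 0 - g 0 < f t - g t"
  shows "caputo \<delta> g t < caputo \<delta> f t"
proof -
  note d = diff[unfolded caputo_less_one[OF \<delta>]]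
  have eq: "(deriv f s - deriv g s) / (t - s) powr \<delta> = deriv f s / (t - s) powr \<delta> - deriv g s / (t - s) powr \<delta>" for s
    by (rule diff_divide_distrib)
  have "0 < (LBINT s:{0..t}. (deriv f s - deriv g s) / (t - s) powr \<delta>)"
  proof (rule caputo_max_pos[OF \<delta> t, of "\<lambda>s. f s - g s"])
    show "((\<lambda>s. f s - g s) has_real_derivative deriv f s - deriv g s) (at s)" if "s \<in> {0<..t}" for s
      using d that by (intro DERIV_diff) (auto simp: DERIV_deriv_iff_real_differentiable)
    show "set_integrable lborel {0..t} (\<lambda>s. (deriv f s - deriv g s) / (t - s) powr \<delta>)"
      unfolding eq using d by (intro set_integral_diff) auto
  qed (use assms in \<open>auto intro!: continuous_intros\<close>)
  also have "\<dots> = (LBINT s:{0..t}. deriv f s / (t - s) powr \<delta>) - (LBINT s:{0..t}. deriv g s / (t - s) powr \<delta>)"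
    unfolding eq using d by (intro set_integral_diff) auto
  finally show ?thesis
    unfolding caputo_less_one[OF \<delta>] using Gamma_real_pos[of "1 - \<delta>"] \<delta> by (intro mult_strict_left_mono) auto
qed

text \<open>Applied in both orders this gives uniqueness. In the difference d = u - v the
  inhomogeneity A cancels, and a positive maximum of d up to a finite time T > 0 is excluded inside
  a slice of fixed x, on the face z = 0 and at the corner.\<close>

lemma lumped_solution_le:
  assumes \<beta>: "0 < \<beta>" "\<beta> < 1 / 2" and pos: "0 < a" "0 < lam" "0 < \<gamma>" "0 < \<alpha>"
    and u: "lumped_solution \<beta> a lam A \<gamma> \<alpha> u" and v: "lumped_solution \<beta> a lam A \<gamma> \<alpha> v"
    and xzt: "0 \<le> x" "0 \<le> z" "0 \<le> t"
  shows "u x z t \<le> v x z t"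
proof -
  have \<delta>: "0 < 2 * \<beta>" "2 * \<beta> < 1"
    using \<beta> by auto
  define T where "T = t + 1"
  define d where "d = (\<lambda>(x, z, t). u x z t - v x z t)"
  define Oct where "Oct = {0::real..} \<times> {0::real..} \<times> {0..T}"
  note u' = u[unfolded lumped_solution_def] and v' = v[unfolded lumped_solution_def]
  note u2 = u'[THEN conjunct2, THEN conjunct1, rule_format]
    and v2 = v'[THEN conjunct2, THEN conjunct1, rule_format]
    and u3 = u'[THEN conjunct2, THEN conjunct2, THEN conjunct1, rule_format]
    and v3 = v'[THEN conjunct2, THEN conjunct2, THEN conjunct1, rule_format]
  note u4 = u'[THEN conjunct2, THEN conjunct2, THEN conjunct2, THEN conjunct1, rule_format]
    and v4 = v'[THEN conjunct2, THEN conjunct2, THEN conjunct2, THEN conjunct1, rule_format]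
    and u5 = u'[THEN conjunct2, THEN conjunct2, THEN conjunct2, THEN conjunct2, THEN conjunct1, rule_format]
    and v5 = v'[THEN conjunct2, THEN conjunct2, THEN conjunct2, THEN conjunct2, THEN conjunct1, rule_format]
  have T: "0 < T"
    using xzt by (simp add: T_def)
  have uc: "continuous_on ({0..} \<times> {0..} \<times> {0..}) (\<lambda>(x, z, t). u x z t)"
    and vc: "continuous_on ({0..} \<times> {0..} \<times> {0..}) (\<lambda>(x, z, t). v x z t)"
    using u' v' by blast+
  have "continuous_on ({0..} \<times> {0..} \<times> {0..}) d"
    using continuous_on_diff[OF uc vc] by (simp add: d_def split_def)
  then have cont: "continuous_on Oct d"
    by (rule continuous_on_subset) (auto simp: Oct_def)
  have d0: "d (x, z, 0) = 0" if "0 \<le> x" "0 \<le> z" for x z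
    using u' v' that by (simp add: d_def)
  \<comment> \<open>The octant is unbounded, but outside a large box |u| and |v| are both below d p
    / 2, so d stays below the positive value d p and the maximum is attained inside the box.\<close>
  have attains: "\<exists>q\<in>S. \<forall>r\<in>S. d r \<le> d q" if S: "closed S" "S \<subseteq> Oct" and p: "p \<in> S" "0 < d p" for S p
  proof -
    define e where "e = d p / 2"
    have "0 < e"
      using p by (simp add: e_def)
    obtain R1 where R1: "\<And>x z t. 0 \<le> x \<Longrightarrow> 0 \<le> z \<Longrightarrow> t \<in> {0..T} \<Longrightarrow> x\<^sup>2 + z\<^sup>2 > R1 \<Longrightarrow> \<bar>u x z t\<bar> < e"
      using u5[OF T \<open>0 < e\<close>] by blast
    obtain R2 where R2: "\<And>x z t. 0 \<le> x \<Longrightarrow> 0 \<le> z \<Longrightarrow> t \<in> {0..T} \<Longrightarrow> x\<^sup>2 + z\<^sup>2 > R2 \<Longrightarrow> \<bar>v x z t\<bar> < e"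
      using v5[OF T \<open>0 < e\<close>] by blast
    \<comment> \<open>The 1 makes \<rho> < y imply \<rho> < y^2.\<close>
    define \<rho> where "\<rho> = max 1 (max R1 R2)"
    define B where "B = {0..\<rho>} \<times> {0..\<rho>} \<times> {0..T}"
    have small: "d r < d p" if r: "r \<in> Oct" "r \<notin> B" for r
    proof -
      obtain x z t where xzt: "r = (x, z, t)" "0 \<le> x" "0 \<le> z" "t \<in> {0..T}"
        using r unfolding Oct_def by auto
      have big: "\<rho> < y\<^sup>2" if "\<rho> < y" for y
        using that mult_strict_mono[of 1 y \<rho> y] by (simp add: \<rho>_def power2_eq_square)
      have "\<rho> < x \<or> \<rho> < z"
        using r xzt unfolding B_def by auto
      then have "\<rho> < x\<^sup>2 + z\<^sup>2"
        using big[of x] big[of z] zero_le_power2[of x] zero_le_power2[of z] by linarith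
      then have "\<bar>u x z t\<bar> < e" "\<bar>v x z t\<bar> < e"
        using R1[of x z t] R2[of x z t] xzt by (auto simp: \<rho>_def)
      then show ?thesis
        unfolding xzt d_def e_def by simp
    qed
    have "compact (S \<inter> B)"
      unfolding B_def using S by (intro closed_Int_compact compact_Times) auto
    moreover have "p \<in> S \<inter> B"
      using small[of p] p S by auto
    moreover have "continuous_on (S \<inter> B) d"
      using cont S by (auto intro: continuous_on_subset)
    ultimately obtain q where q: "q \<in> S \<inter> B" "\<And>r. r \<in> S \<inter> B \<Longrightarrow> d r \<le> d q"
      using continuous_attains_sup[of "S \<inter> B" d] by blast
    have "d r \<le> d q" if "r \<in> S" for r
      using q(2)[of r] q(2)[of p] small[of r] \<open>p \<in> S \<inter> B\<close> that S by fastforce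
    then show ?thesis
      using q by blast
  qed
  have slice: "continuous_on {0..t} (\<lambda>s. u x z s)" "continuous_on {0..t} (\<lambda>s. v x z s)"
    if "0 \<le> x" "0 \<le> z" for x z t
  proof -
    have c: "continuous_on {0..t} (\<lambda>s. (x, z, s))"
      by (intro continuous_intros)
    have "(\<lambda>s. (x, z, s)) ` {0..t} \<subseteq> {0..} \<times> {0..} \<times> {0..}"
      using that by auto
    from continuous_on_compose2[OF uc c this] continuous_on_compose2[OF vc c this]
    show "continuous_on {0..t} (\<lambda>s. u x z s)" "continuous_on {0..t} (\<lambda>s. v x z s)"
      by simp_all
  qed
  have caputo_pos: "caputo (2 * \<beta>) (\<lambda>s. v x z s) t < caputo (2 * \<beta>) (\<lambda>s. u x z s) t"
    if "0 \<le> x" "0 \<le> z" "0 < t" "caputo_differentiable (2 * \<beta>) (\<lambda>s. u x z s) t"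
      "caputo_differentiable (2 * \<beta>) (\<lambda>s. v x z s) t"
      "\<And>s. s \<in> {0..t} \<Longrightarrow> d (x, z, s) \<le> d (x, z, t)" "0 < d (x, z, t)" for x z t
    using that d0[of x z] by (intro caputo_less_at_max[OF \<delta>] slice) (auto simp: d_def)
  \<comment> \<open>The equation for z > 0 involves x only as a parameter, so the slice at x is
    compared with a bound C for the face z = 0. At a maximum above C the spatial terms of the
    difference are nonpositive, while its Caputo derivative is positive.\<close>
  have interior: "d (x, z, t) \<le> C"
    if C: "0 \<le> C" "\<And>x t. 0 \<le> x \<Longrightarrow> t \<in> {0..T} \<Longrightarrow> d (x, 0, t) \<le> C"
      and x: "0 < x" and z: "0 \<le> z" and t: "t \<in> {0..T}" for C x z t
  proof (rule ccontr)
    assume "\<not> d (x, z, t) \<le> C"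
    then have "C < d (x, z, t)"
      by simp
    have "closed ({x} \<times> {0::real..} \<times> {0..T})"
      by (intro closed_Times) auto
    then have "\<exists>q\<in>{x} \<times> {0..} \<times> {0..T}. \<forall>r\<in>{x} \<times> {0..} \<times> {0..T}. d r \<le> d q"
      using x z t C \<open>C < d (x, z, t)\<close> by (intro attains[of _ "(x, z, t)"]) (auto simp: Oct_def)
    then obtain z0 t0 where q: "0 \<le> z0" "t0 \<in> {0..T}"
      and max: "\<And>\<zeta> s. 0 \<le> \<zeta> \<Longrightarrow> s \<in> {0..T} \<Longrightarrow> d (x, \<zeta>, s) \<le> d (x, z0, t0)"
      by force
    have M: "C < d (x, z0, t0)"
      using max[of z t] z t \<open>C < d (x, z, t)\<close> by simp
    have "t0 \<noteq> 0"
      using M d0[of x z0] x q C by auto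
    then have t0: "0 < t0"
      using q by simp
    have "z0 \<noteq> 0"
      using M C(2)[of x t0] x q by auto
    then have z0: "0 < z0"
      using q by simp
    have U: "caputo_differentiable (2 * \<beta>) (\<lambda>s. u x \<zeta> s) t0" "(\<lambda>\<zeta>. u x \<zeta> t0) differentiable (at \<zeta>)"
      "deriv (\<lambda>\<zeta>. u x \<zeta> t0) differentiable (at \<zeta>)"
      "caputo (2 * \<beta>) (\<lambda>s. u x \<zeta> s) t0 = a\<^sup>2 * deriv (deriv (\<lambda>\<zeta>. u x \<zeta> t0)) \<zeta> - lam * deriv (\<lambda>\<zeta>. u x \<zeta> t0) \<zeta>"
      if "0 < \<zeta>" for \<zeta>
      using u2[OF x that t0] by blast+
    have V: "caputo_differentiable (2 * \<beta>) (\<lambda>s. v x \<zeta> s) t0" "(\<lambda>\<zeta>. v x \<zeta> t0) differentiable (at \<zeta>)"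
      "deriv (\<lambda>\<zeta>. v x \<zeta> t0) differentiable (at \<zeta>)"
      "caputo (2 * \<beta>) (\<lambda>s. v x \<zeta> s) t0 = a\<^sup>2 * deriv (deriv (\<lambda>\<zeta>. v x \<zeta> t0)) \<zeta> - lam * deriv (\<lambda>\<zeta>. v x \<zeta> t0) \<zeta>"
      if "0 < \<zeta>" for \<zeta>
      using v2[OF x that t0] by blast+
    have 1: "((\<lambda>\<zeta>. u x \<zeta> t0 - v x \<zeta> t0) has_real_derivative deriv (\<lambda>\<zeta>. u x \<zeta> t0) \<zeta> - deriv (\<lambda>\<zeta>. v x \<zeta> t0) \<zeta>) (at \<zeta>)"
      if "0 < \<zeta>" for \<zeta>
      using U(2)[OF that] V(2)[OF that] by (intro DERIV_diff) (simp_all add: DERIV_deriv_iff_real_differentiable)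
    have 2: "((\<lambda>\<zeta>. deriv (\<lambda>\<zeta>. u x \<zeta> t0) \<zeta> - deriv (\<lambda>\<zeta>. v x \<zeta> t0) \<zeta>) has_real_derivative
        deriv (deriv (\<lambda>\<zeta>. u x \<zeta> t0)) z0 - deriv (deriv (\<lambda>\<zeta>. v x \<zeta> t0)) z0) (at z0)"
      using U(3)[OF z0] V(3)[OF z0] by (intro DERIV_diff) (simp_all add: DERIV_deriv_iff_real_differentiable)
    have 3: "u x \<zeta> t0 - v x \<zeta> t0 \<le> u x z0 t0 - v x z0 t0" if "0 < \<zeta>" for \<zeta>
      using max[of \<zeta> t0] that q by (simp add: d_def)
    have "a\<^sup>2 * (deriv (deriv (\<lambda>\<zeta>. u x \<zeta> t0)) z0 - deriv (deriv (\<lambda>\<zeta>. v x \<zeta> t0)) z0)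
        - lam * (deriv (\<lambda>\<zeta>. u x \<zeta> t0) z0 - deriv (\<lambda>\<zeta>. v x \<zeta> t0) z0) \<le> 0"
      using second_derivative_at_max[OF z0 1 2 3] by (simp add: mult_nonneg_nonpos)
    then have "caputo (2 * \<beta>) (\<lambda>s. u x z0 s) t0 \<le> caputo (2 * \<beta>) (\<lambda>s. v x z0 s) t0"
      unfolding U(4)[OF z0] V(4)[OF z0] by (simp add: algebra_simps)
    moreover have "caputo (2 * \<beta>) (\<lambda>s. v x z0 s) t0 < caputo (2 * \<beta>) (\<lambda>s. u x z0 s) t0"
    proof (rule caputo_pos)
      show "d (x, z0, s) \<le> d (x, z0, t0)" if "s \<in> {0..t0}" for s
        using max[of z0 s] that q by simp
    qed (use x z0 t0 U(1) V(1) M C in auto)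
    ultimately show False
      by simp
  qed
  \<comment> \<open>No equation is available on x = 0, z > 0; the bound is carried there from x > 0
    by continuity.\<close>
  have interior0: "d (x, z, t) \<le> C"
    if C: "0 \<le> C" "\<And>x t. 0 \<le> x \<Longrightarrow> t \<in> {0..T} \<Longrightarrow> d (x, 0, t) \<le> C"
      and x: "0 \<le> x" and z: "0 \<le> z" and t: "t \<in> {0..T}" for C x z t
  proof (cases "x = 0")
    case True
    have "(d \<longlongrightarrow> d (0, z, t)) (at (0, z, t) within Oct)"
      using cont z t unfolding continuous_on Oct_def by auto
    moreover have "filterlim (\<lambda>x. (x, z, t)) (at (0, z, t) within Oct) (at_right 0)"
      unfolding filterlim_at using z t
      by (auto intro!: tendsto_intros simp: eventually_at_filter Oct_def)
    ultimately have "((\<lambda>x. d (x, z, t)) \<longlongrightarrow> d (0, z, t)) (at_right 0)"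
      by (rule filterlim_compose)
    then have "d (0, z, t) \<le> C"
    proof (rule tendsto_upperbound)
      show "\<forall>\<^sub>F x in at_right 0. d (x, z, t) \<le> C"
        unfolding eventually_at_right_field using interior[OF C _ z t] by (intro exI[of _ 1]) auto
    qed simp
    then show ?thesis
      using True by simp
  qed (use interior[OF C _ z t] x in simp)
  have boundary: "d (x, 0, t) \<le> 0" if x: "0 \<le> x" and t: "t \<in> {0..T}" for x t
  proof (rule ccontr)
    assume "\<not> d (x, 0, t) \<le> 0"
    have "closed ({0::real..} \<times> {0::real} \<times> {0..T})"
      by (intro closed_Times) auto
    then have "\<exists>q\<in>{0..} \<times> {0} \<times> {0..T}. \<forall>r\<in>{0..} \<times> {0} \<times> {0..T}. d r \<le> d q"
      using x t \<open>\<not> d (x, 0, t) \<le> 0\<close> by (intro attains[of _ "(x, 0, t)"]) (auto simp: Oct_def)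
    then obtain x0 t0 where q: "0 \<le> x0" "t0 \<in> {0..T}"
      and max0: "\<And>\<xi> s. 0 \<le> \<xi> \<Longrightarrow> s \<in> {0..T} \<Longrightarrow> d (\<xi>, 0, s) \<le> d (x0, 0, t0)"
      by force
    have M: "0 < d (x0, 0, t0)"
      using max0[of x t] x t \<open>\<not> d (x, 0, t) \<le> 0\<close> by simp
    \<comment> \<open>The maximum over the face z = 0 serves as C and is therefore a maximum over
      the whole octant up to time T; hence the one-sided z-derivative of d at it is
      nonpositive.\<close>
    have max: "d (\<xi>, \<zeta>, s) \<le> d (x0, 0, t0)" if "0 \<le> \<xi>" "0 \<le> \<zeta>" "s \<in> {0..T}" for \<xi> \<zeta> s
    proof (rule interior0)
      show "d (x, 0, t) \<le> d (x0, 0, t0)" if "0 \<le> x" "t \<in> {0..T}" for x t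
        using max0[OF that] .
    qed (use M that in simp_all)
    have "t0 \<noteq> 0"
      using M d0[of x0 0] q by auto
    then have t0: "0 < t0"
      using q by simp
    show False
    proof (cases "x0 = 0")
      case True
      obtain ux where ux: "((\<lambda>\<xi>. u \<xi> 0 t0) has_real_derivative ux) (at 0 within {0..})"
          "ux - 2 * \<gamma> * u 0 0 t0 = - 2 * \<gamma> * A"
        using u4[OF t0] by blast
      obtain vx where vx: "((\<lambda>\<xi>. v \<xi> 0 t0) has_real_derivative vx) (at 0 within {0..})"
          "vx - 2 * \<gamma> * v 0 0 t0 = - 2 * \<gamma> * A"
        using v4[OF t0] by blast
      \<comment> \<open>Subtracting the Robin conditions gives ux - vx = 2 \<gamma> d > 0, whereas a
        maximum at the endpoint forces a nonpositive one-sided derivative.\<close>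
      have "ux - vx \<le> 0"
      proof (rule one_sided_derivative_at_max[OF DERIV_diff[OF ux(1) vx(1)]])
        show "u \<xi> 0 t0 - v \<xi> 0 t0 \<le> u 0 0 t0 - v 0 0 t0" if "0 \<le> \<xi>" for \<xi>
          using max0[of \<xi> t0] that q True by (simp add: d_def)
      qed
      moreover have "ux - vx = 2 * \<gamma> * d (x0, 0, t0)"
        using ux(2) vx(2) True by (simp add: d_def algebra_simps)
      ultimately show False
        using M pos by (simp add: mult_le_0_iff)
    next
      case False
      then have x0: "0 < x0"
        using q by simp
      have U: "caputo_differentiable (2 * \<beta>) (\<lambda>s. u \<xi> 0 s) t0" "(\<lambda>\<xi>. u \<xi> 0 t0) differentiable (at \<xi>)"
        "deriv (\<lambda>\<xi>. u \<xi> 0 t0) differentiable (at \<xi>)"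
        "\<exists>u\<^sub>z. ((\<lambda>\<zeta>. u \<xi> \<zeta> t0) has_real_derivative u\<^sub>z) (at 0 within {0..}) \<and>
          caputo (2 * \<beta>) (\<lambda>s. u \<xi> 0 s) t0 =
          deriv (deriv (\<lambda>\<xi>. u \<xi> 0 t0)) \<xi> - 2 * \<gamma> * deriv (\<lambda>\<xi>. u \<xi> 0 t0) \<xi> + \<alpha> * u\<^sub>z"
        if "0 < \<xi>" for \<xi>
        using u3[OF that t0] by blast+
      have V: "caputo_differentiable (2 * \<beta>) (\<lambda>s. v \<xi> 0 s) t0" "(\<lambda>\<xi>. v \<xi> 0 t0) differentiable (at \<xi>)"
        "deriv (\<lambda>\<xi>. v \<xi> 0 t0) differentiable (at \<xi>)"
        "\<exists>u\<^sub>z. ((\<lambda>\<zeta>. v \<xi> \<zeta> t0) has_real_derivative u\<^sub>z) (at 0 within {0..}) \<and>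
          caputo (2 * \<beta>) (\<lambda>s. v \<xi> 0 s) t0 =
          deriv (deriv (\<lambda>\<xi>. v \<xi> 0 t0)) \<xi> - 2 * \<gamma> * deriv (\<lambda>\<xi>. v \<xi> 0 t0) \<xi> + \<alpha> * u\<^sub>z"
        if "0 < \<xi>" for \<xi>
        using v3[OF that t0] by blast+
      obtain uz where uz: "((\<lambda>\<zeta>. u x0 \<zeta> t0) has_real_derivative uz) (at 0 within {0..})"
          "caputo (2 * \<beta>) (\<lambda>s. u x0 0 s) t0 =
          deriv (deriv (\<lambda>\<xi>. u \<xi> 0 t0)) x0 - 2 * \<gamma> * deriv (\<lambda>\<xi>. u \<xi> 0 t0) x0 + \<alpha> * uz"
        using U(4)[OF x0] by blast
      obtain vz where vz: "((\<lambda>\<zeta>. v x0 \<zeta> t0) has_real_derivative vz) (at 0 within {0..})"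
          "caputo (2 * \<beta>) (\<lambda>s. v x0 0 s) t0 =
          deriv (deriv (\<lambda>\<xi>. v \<xi> 0 t0)) x0 - 2 * \<gamma> * deriv (\<lambda>\<xi>. v \<xi> 0 t0) x0 + \<alpha> * vz"
        using V(4)[OF x0] by blast
      have 1: "((\<lambda>\<xi>. u \<xi> 0 t0 - v \<xi> 0 t0) has_real_derivative deriv (\<lambda>\<xi>. u \<xi> 0 t0) \<xi> - deriv (\<lambda>\<xi>. v \<xi> 0 t0) \<xi>) (at \<xi>)"
        if "0 < \<xi>" for \<xi>
        using U(2)[OF that] V(2)[OF that] by (intro DERIV_diff) (simp_all add: DERIV_deriv_iff_real_differentiable)
      have 2: "((\<lambda>\<xi>. deriv (\<lambda>\<xi>. u \<xi> 0 t0) \<xi> - deriv (\<lambda>\<xi>. v \<xi> 0 t0) \<xi>) has_real_derivative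
          deriv (deriv (\<lambda>\<xi>. u \<xi> 0 t0)) x0 - deriv (deriv (\<lambda>\<xi>. v \<xi> 0 t0)) x0) (at x0)"
        using U(3)[OF x0] V(3)[OF x0] by (intro DERIV_diff) (simp_all add: DERIV_deriv_iff_real_differentiable)
      have 3: "u \<xi> 0 t0 - v \<xi> 0 t0 \<le> u x0 0 t0 - v x0 0 t0" if "0 < \<xi>" for \<xi>
        using max0[of \<xi> t0] that q by (simp add: d_def)
      have "uz - vz \<le> 0"
      proof (rule one_sided_derivative_at_max[OF DERIV_diff[OF uz(1) vz(1)]])
        show "u x0 \<zeta> t0 - v x0 \<zeta> t0 \<le> u x0 0 t0 - v x0 0 t0" if "0 \<le> \<zeta>" for \<zeta>
          using max[of x0 \<zeta> t0] that q by (simp add: d_def)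
      qed
      then have "\<alpha> * (uz - vz) \<le> 0"
        using pos by (simp add: mult_nonneg_nonpos)
      moreover note second_derivative_at_max[OF x0 1 2 3]
      moreover have "caputo (2 * \<beta>) (\<lambda>s. u x0 0 s) t0 - caputo (2 * \<beta>) (\<lambda>s. v x0 0 s) t0 =
          (deriv (deriv (\<lambda>\<xi>. u \<xi> 0 t0)) x0 - deriv (deriv (\<lambda>\<xi>. v \<xi> 0 t0)) x0)
          - 2 * \<gamma> * (deriv (\<lambda>\<xi>. u \<xi> 0 t0) x0 - deriv (\<lambda>\<xi>. v \<xi> 0 t0) x0) + \<alpha> * (uz - vz)"
        unfolding uz(2) vz(2) by (simp add: algebra_simps)
      ultimately have "caputo (2 * \<beta>) (\<lambda>s. u x0 0 s) t0 - caputo (2 * \<beta>) (\<lambda>s. v x0 0 s) t0 \<le> 0"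
        by simp
      moreover have "caputo (2 * \<beta>) (\<lambda>s. v x0 0 s) t0 < caputo (2 * \<beta>) (\<lambda>s. u x0 0 s) t0"
      proof (rule caputo_pos)
        show "d (x0, 0, s) \<le> d (x0, 0, t0)" if "s \<in> {0..t0}" for s
          using max0[of x0 s] that q by simp
      qed (use x0 t0 U(1) V(1) M in auto)
      ultimately show False
        by simp
    qed
  qed
  have "d (x, z, t) \<le> 0"
    using xzt by (intro interior0[OF order.refl boundary]) (simp_all add: T_def)
  then show ?thesis
    by (simp add: d_def)
qed

section \<open>Invariance under changes outside the closed octant\<close>

lemma deriv_cong_pos:
  fixes f g :: "real \<Rightarrow> real"
  assumes "\<And>s. 0 < s \<Longrightarrow> f s = g s" "0 < x"
  shows "deriv f x = deriv g x" and "f differentiable (at x) \<longleftrightarrow> g differentiable (at x)"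
proof -
  have ev: "eventually (\<lambda>s. f s = g s) (nhds x)"
    using eventually_nhds_in_open[of "{0<..}" x] assms by (auto elim: eventually_mono)
  show "deriv f x = deriv g x"
    by (rule deriv_cong_ev[OF ev refl])
  have "(f has_real_derivative D) (at x) \<longleftrightarrow> (g has_real_derivative D) (at x)" for D
    by (rule DERIV_cong_ev[OF refl ev refl])
  then show "f differentiable (at x) \<longleftrightarrow> g differentiable (at x)"
    by (simp add: real_differentiable_def)
qed

lemma has_real_derivative_cong_Ici:
  fixes f g :: "real \<Rightarrow> real"
  assumes "(f has_real_derivative D) (at 0 within {0..})" and "\<And>s. 0 \<le> s \<Longrightarrow> f s = g s"
  shows "(g has_real_derivative D) (at 0 within {0..})"
  by (rule has_field_derivative_transform_within[OF assms(1) zero_less_one]) (use assms(2) in auto)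

text \<open>The derivatives can differ only at s \<le> 0, and within [0, t] that is the single point
  0, a null set.\<close>

lemma caputo_cong_pos:
  fixes f g :: "real \<Rightarrow> real"
  assumes \<delta>: "0 < \<delta>" "\<delta> < 1" and eq: "\<And>s. 0 < s \<Longrightarrow> f s = g s"
  shows "caputo \<delta> f t = caputo \<delta> g t" and "caputo_differentiable \<delta> f t \<longleftrightarrow> caputo_differentiable \<delta> g t"
proof -
  have d: "indicator {0..t} s *\<^sub>R (deriv f s / (t - s) powr \<delta>) = indicator {0..t} s *\<^sub>R (deriv g s / (t - s) powr \<delta>)"
    if "s \<notin> {0}" for s
    using deriv_cong_pos(1)[of f g s, OF eq] that by (auto simp: indicator_def)
  have "(LBINT s:{0..t}. deriv f s / (t - s) powr \<delta>) = (LBINT s:{0..t}. deriv g s / (t - s) powr \<delta>)"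
    unfolding set_lebesgue_integral_def by (rule integral_discrete_difference[of "{0}"]) (rule d | simp)+
  then show "caputo \<delta> f t = caputo \<delta> g t"
    unfolding caputo_less_one[OF \<delta>] by simp
  have "set_integrable lborel {0..t} (\<lambda>s. deriv f s / (t - s) powr \<delta>) \<longleftrightarrow>
      set_integrable lborel {0..t} (\<lambda>s. deriv g s / (t - s) powr \<delta>)"
    unfolding set_integrable_def by (rule integrable_discrete_difference[of "{0}"]) (rule d | simp)+
  moreover have "(\<forall>s\<in>{0<..t}. f differentiable (at s)) \<longleftrightarrow> (\<forall>s\<in>{0<..t}. g differentiable (at s))"
    using deriv_cong_pos(2)[of f g, OF eq] by auto
  ultimately show "caputo_differentiable \<delta> f t \<longleftrightarrow> caputo_differentiable \<delta> g t"
    unfolding caputo_less_one[OF \<delta>] by simp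
qed

text \<open>The stated formula says nothing about u outside the closed octant, while
  \<open>deriv\<close> and \<open>caputo\<close> take functions on the whole line. This transfer
  gives the direction from the formula to the problem.\<close>

lemma lumped_solution_cong:
  assumes \<beta>: "0 < \<beta>" "\<beta> < 1 / 2" and u: "lumped_solution \<beta> a lam A \<gamma> \<alpha> u"
    and eq: "\<And>x z t. 0 \<le> x \<Longrightarrow> 0 \<le> z \<Longrightarrow> 0 \<le> t \<Longrightarrow> u x z t = v x z t"
  shows "lumped_solution \<beta> a lam A \<gamma> \<alpha> v"
proof -
  have \<delta>: "0 < 2 * \<beta>" "2 * \<beta> < 1"
    using \<beta> by auto
  note u' = u[unfolded lumped_solution_def]
  note u1 = u'[THEN conjunct1]
    and u2 = u'[THEN conjunct2, THEN conjunct1, rule_format]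
    and u3 = u'[THEN conjunct2, THEN conjunct2, THEN conjunct1, rule_format]
    and u4 = u'[THEN conjunct2, THEN conjunct2, THEN conjunct2, THEN conjunct1, rule_format]
    and u5 = u'[THEN conjunct2, THEN conjunct2, THEN conjunct2, THEN conjunct2, THEN conjunct1, rule_format]
    and u6 = u'[THEN conjunct2, THEN conjunct2, THEN conjunct2, THEN conjunct2, THEN conjunct2, rule_format]
  have cap: "caputo (2 * \<beta>) (\<lambda>s. v x z s) t = caputo (2 * \<beta>) (\<lambda>s. u x z s) t"
    "caputo_differentiable (2 * \<beta>) (\<lambda>s. v x z s) t \<longleftrightarrow> caputo_differentiable (2 * \<beta>) (\<lambda>s. u x z s) t"
    if "0 \<le> x" "0 \<le> z" for x z t
    by (rule caputo_cong_pos[OF \<delta>], simp add: eq that)+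
  show ?thesis
    unfolding lumped_solution_def
  proof (intro conjI allI impI)
    have "continuous_on ({0..} \<times> {0..} \<times> {0..}) (\<lambda>(x, z, t). v x z t) \<longleftrightarrow>
        continuous_on ({0..} \<times> {0..} \<times> {0..}) (\<lambda>(x, z, t). u x z t)"
      by (rule continuous_on_cong) (auto simp: eq)
    with u1 show "continuous_on ({0..} \<times> {0..} \<times> {0..}) (\<lambda>(x, z, t). v x z t)"
      by simp
  next
    fix x z t :: real assume xzt: "0 < x" "0 < z" "0 < t"
    have e: "v x \<zeta> t = u x \<zeta> t" if "0 < \<zeta>" for \<zeta>
      using xzt that eq by simp
    have e': "deriv (\<lambda>\<zeta>. v x \<zeta> t) \<zeta> = deriv (\<lambda>\<zeta>. u x \<zeta> t) \<zeta>" if "0 < \<zeta>" for \<zeta>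
      by (rule deriv_cong_pos(1)[OF e that])
    have e'': "deriv (deriv (\<lambda>\<zeta>. v x \<zeta> t)) z = deriv (deriv (\<lambda>\<zeta>. u x \<zeta> t)) z"
      by (rule deriv_cong_pos(1)[OF _ xzt(2)]) (rule e')
    have xz: "0 \<le> x" "0 \<le> z"
      using xzt by auto
    note U = u2[OF xzt]
    show "caputo_differentiable (2 * \<beta>) (\<lambda>s. v x z s) t"
      unfolding cap[OF xz] using U by blast
    show "(\<lambda>\<zeta>. v x \<zeta> t) differentiable at z"
      by (rule iffD2[OF deriv_cong_pos(2)[of "\<lambda>\<zeta>. v x \<zeta> t" "\<lambda>\<zeta>. u x \<zeta> t" z, OF e xzt(2)]]) (assumption, rule U[THEN conjunct2, THEN conjunct1])
    show "deriv (\<lambda>\<zeta>. v x \<zeta> t) differentiable at z"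
      by (rule iffD2[OF deriv_cong_pos(2)[of "deriv (\<lambda>\<zeta>. v x \<zeta> t)" "deriv (\<lambda>\<zeta>. u x \<zeta> t)" z, OF e' xzt(2)]]) (assumption, rule U[THEN conjunct2, THEN conjunct2, THEN conjunct1])
    show "caputo (2 * \<beta>) (\<lambda>s. v x z s) t = a\<^sup>2 * deriv (deriv (\<lambda>\<zeta>. v x \<zeta> t)) z - lam * deriv (\<lambda>\<zeta>. v x \<zeta> t) z"
      unfolding cap[OF xz] e'[OF xzt(2)] e'' using U by blast
  next
    fix x t :: real assume xt: "0 < x" "0 < t"
    have e: "v \<xi> 0 t = u \<xi> 0 t" if "0 < \<xi>" for \<xi>
      using xt that eq by simp
    have e': "deriv (\<lambda>\<xi>. v \<xi> 0 t) \<xi> = deriv (\<lambda>\<xi>. u \<xi> 0 t) \<xi>" if "0 < \<xi>" for \<xi>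
      by (rule deriv_cong_pos(1)[OF e that])
    have e'': "deriv (deriv (\<lambda>\<xi>. v \<xi> 0 t)) x = deriv (deriv (\<lambda>\<xi>. u \<xi> 0 t)) x"
      by (rule deriv_cong_pos(1)[OF _ xt(1)]) (rule e')
    have xz: "0 \<le> x" "0 \<le> (0::real)"
      using xt by auto
    note U = u3[OF xt]
    show "caputo_differentiable (2 * \<beta>) (\<lambda>s. v x 0 s) t"
      unfolding cap[OF xz] using U by blast
    show "(\<lambda>\<xi>. v \<xi> 0 t) differentiable at x"
      by (rule iffD2[OF deriv_cong_pos(2)[of "\<lambda>\<xi>. v \<xi> 0 t" "\<lambda>\<xi>. u \<xi> 0 t" x, OF e xt(1)]]) (assumption, rule U[THEN conjunct2, THEN conjunct1])
    show "deriv (\<lambda>\<xi>. v \<xi> 0 t) differentiable at x"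
      by (rule iffD2[OF deriv_cong_pos(2)[of "deriv (\<lambda>\<xi>. v \<xi> 0 t)" "deriv (\<lambda>\<xi>. u \<xi> 0 t)" x, OF e' xt(1)]]) (assumption, rule U[THEN conjunct2, THEN conjunct2, THEN conjunct1])
    obtain uz where uz: "((\<lambda>\<zeta>. u x \<zeta> t) has_real_derivative uz) (at 0 within {0..})"
        "caputo (2 * \<beta>) (\<lambda>s. u x 0 s) t =
          deriv (deriv (\<lambda>\<xi>. u \<xi> 0 t)) x - 2 * \<gamma> * deriv (\<lambda>\<xi>. u \<xi> 0 t) x + \<alpha> * uz"
      using U by blast
    have "((\<lambda>\<zeta>. v x \<zeta> t) has_real_derivative uz) (at 0 within {0..})"
      by (rule has_real_derivative_cong_Ici[OF uz(1)]) (use xt eq in simp)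
    moreover have "caputo (2 * \<beta>) (\<lambda>s. v x 0 s) t =
          deriv (deriv (\<lambda>\<xi>. v \<xi> 0 t)) x - 2 * \<gamma> * deriv (\<lambda>\<xi>. v \<xi> 0 t) x + \<alpha> * uz"
      unfolding cap[OF xz] e'[OF xt(1)] e'' by (rule uz(2))
    ultimately show "\<exists>u\<^sub>z. ((\<lambda>\<zeta>. v x \<zeta> t) has_real_derivative u\<^sub>z) (at 0 within {0..}) \<and>
        caputo (2 * \<beta>) (\<lambda>s. v x 0 s) t =
          deriv (deriv (\<lambda>\<xi>. v \<xi> 0 t)) x - 2 * \<gamma> * deriv (\<lambda>\<xi>. v \<xi> 0 t) x + \<alpha> * u\<^sub>z"
      by blast
  next
    fix t :: real assume t: "0 < t"
    obtain ux where ux: "((\<lambda>\<xi>. u \<xi> 0 t) has_real_derivative ux) (at 0 within {0..})"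
        "ux - 2 * \<gamma> * u 0 0 t = - 2 * \<gamma> * A"
      using u4[OF t] by blast
    have "((\<lambda>\<xi>. v \<xi> 0 t) has_real_derivative ux) (at 0 within {0..})"
      by (rule has_real_derivative_cong_Ici[OF ux(1)]) (use t eq in simp)
    moreover have "ux - 2 * \<gamma> * v 0 0 t = - 2 * \<gamma> * A"
      using ux(2) eq[of 0 0 t] t by simp
    ultimately show "\<exists>u\<^sub>x. ((\<lambda>\<xi>. v \<xi> 0 t) has_real_derivative u\<^sub>x) (at 0 within {0..}) \<and>
        u\<^sub>x - 2 * \<gamma> * v 0 0 t = - 2 * \<gamma> * A"
      by blast
  next
    fix T \<epsilon> :: real assume T: "0 < T" and \<epsilon>: "0 < \<epsilon>"
    obtain R where R: "\<forall>x\<ge>0. \<forall>z\<ge>0. \<forall>t\<in>{0..T}. x\<^sup>2 + z\<^sup>2 > R \<longrightarrow> \<bar>u x z t\<bar> < \<epsilon>"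
      using u5[OF T \<epsilon>] by blast
    have "\<forall>x\<ge>0. \<forall>z\<ge>0. \<forall>t\<in>{0..T}. x\<^sup>2 + z\<^sup>2 > R \<longrightarrow> \<bar>v x z t\<bar> < \<epsilon>"
    proof (intro allI impI ballI)
      fix x z t :: real assume xzt: "0 \<le> x" "0 \<le> z" "t \<in> {0..T}" and "x\<^sup>2 + z\<^sup>2 > R"
      then have "\<bar>u x z t\<bar> < \<epsilon>"
        using R by blast
      moreover have "u x z t = v x z t"
        using xzt by (intro eq) auto
      ultimately show "\<bar>v x z t\<bar> < \<epsilon>"
        by simp
    qed
    then show "\<exists>R. \<forall>x\<ge>0. \<forall>z\<ge>0. \<forall>t\<in>{0..T}. x\<^sup>2 + z\<^sup>2 > R \<longrightarrow> \<bar>v x z t\<bar> < \<epsilon>"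
      by blast
  next
    fix x z :: real assume xz: "0 \<le> x" "0 \<le> z"
    show "v x z 0 = 0"
      using u6[OF xz] eq[OF xz order.refl] by simp
  qed
qed

section \<open>Derivatives of Bromwich integrals\<close>

lemma bromwich_cong:
  assumes "\<And>\<omega>. G (Complex \<sigma> \<omega>) = H (Complex \<sigma> \<omega>)"
  shows "bromwich \<sigma> G t = bromwich \<sigma> H t"
  unfolding bromwich_def using assms by simp

lemma bromwich_cmult: "bromwich \<sigma> (\<lambda>p. c * G p) t = c * bromwich \<sigma> G t"
proof -
  have "(LBINT \<omega>. exp (of_real t * Complex \<sigma> \<omega>) * (c * G (Complex \<sigma> \<omega>))) =
      (LBINT \<omega>. c * (exp (of_real t * Complex \<sigma> \<omega>) * G (Complex \<sigma> \<omega>)))"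
    by (simp only: mult.left_commute)
  then show ?thesis
    unfolding bromwich_def by simp
qed

lemma bromwich_add:
  assumes "integrable lborel (\<lambda>\<omega>. G (Complex \<sigma> \<omega>))" "integrable lborel (\<lambda>\<omega>. H (Complex \<sigma> \<omega>))"
  shows "bromwich \<sigma> (\<lambda>p. G p + H p) t = bromwich \<sigma> G t + bromwich \<sigma> H t"
  using Bochner_Integration.integral_add[OF integrable_bromwich[OF assms(1), of t] integrable_bromwich[OF assms(2), of t]]
  unfolding bromwich_def by (simp add: distrib_left add_divide_distrib)

lemma bromwich_exp_derivative:
  assumes G: "integrable lborel (\<lambda>\<omega>. G (Complex \<sigma> \<omega>))"
    and G\<rho>: "integrable lborel (\<lambda>\<omega>. \<rho> (Complex \<sigma> \<omega>) * G (Complex \<sigma> \<omega>))"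
    and meas: "(\<lambda>\<omega>. \<rho> (Complex \<sigma> \<omega>)) \<in> borel_measurable borel"
    and re: "\<And>\<omega>. 0 \<le> Re (\<rho> (Complex \<sigma> \<omega>))" and \<xi>: "0 \<le> \<xi>"
  shows "((\<lambda>\<zeta>. bromwich \<sigma> (\<lambda>p. G p * exp (- of_real \<zeta> * \<rho> p)) t) has_vector_derivative
    - bromwich \<sigma> (\<lambda>p. \<rho> p * (G p * exp (- of_real \<xi> * \<rho> p))) t) (at \<xi> within {0..})"
proof -
  define Q where "Q \<omega> = exp (of_real t * Complex \<sigma> \<omega>) * G (Complex \<sigma> \<omega>) / of_real (2 * pi)" for \<omega>
  have Q: "integrable lborel Q"
    unfolding Q_def by (intro integrable_divide_zero integrable_bromwich G)
  have "integrable lborel (\<lambda>\<omega>. exp (of_real t * Complex \<sigma> \<omega>) * (\<rho> (Complex \<sigma> \<omega>) * G (Complex \<sigma> \<omega>)) / of_real (2 * pi))"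
    using integrable_bromwich[of "\<lambda>p. \<rho> p * G p", OF G\<rho>] by (intro integrable_divide_zero)
  also have "(\<lambda>\<omega>. exp (of_real t * Complex \<sigma> \<omega>) * (\<rho> (Complex \<sigma> \<omega>) * G (Complex \<sigma> \<omega>)) / of_real (2 * pi))
      = (\<lambda>\<omega>. Q \<omega> * \<rho> (Complex \<sigma> \<omega>))"
    unfolding Q_def by (simp add: mult_ac)
  finally have Q\<rho>: "integrable lborel (\<lambda>\<omega>. Q \<omega> * \<rho> (Complex \<sigma> \<omega>))" .
  have "bromwich \<sigma> (\<lambda>p. G p * exp (- of_real \<zeta> * \<rho> p)) t = (LBINT \<omega>. Q \<omega> * exp (- of_real \<zeta> * \<rho> (Complex \<sigma> \<omega>)))" for \<zeta>
    unfolding bromwich_def integral_divide_zero[symmetric] Q_def by (simp add: mult_ac)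
  moreover have "bromwich \<sigma> (\<lambda>p. \<rho> p * (G p * exp (- of_real \<xi> * \<rho> p))) t
      = (LBINT \<omega>. Q \<omega> * \<rho> (Complex \<sigma> \<omega>) * exp (- of_real \<xi> * \<rho> (Complex \<sigma> \<omega>)))"
    unfolding bromwich_def integral_divide_zero[symmetric] Q_def by (simp add: mult_ac)
  ultimately show ?thesis
    using has_vector_derivative_exp_integral[OF Q Q\<rho> _ re \<xi>] meas by simp
qed

lemma at_within_Ici: "a < x \<Longrightarrow> at x within {a..} = at (x :: real)"
  by (rule at_within_interior) simp

text \<open>The exponential exp (t p) has the wrong sign for \<open>bromwich_exp_derivative\<close>.
  Moving exp (T p) with T = t + 1 into the symbol leaves exp (-\<zeta> p) at \<zeta> = T - t = 1, an
  interior point of the half-line, so the derivative is two-sided.\<close>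

lemma bromwich_time_derivative:
  assumes G: "integrable lborel (\<lambda>\<omega>. G (Complex \<sigma> \<omega>))"
    and pG: "integrable lborel (\<lambda>\<omega>. Complex \<sigma> \<omega> * G (Complex \<sigma> \<omega>))" and "0 \<le> \<sigma>"
  shows "(bromwich \<sigma> G has_vector_derivative bromwich \<sigma> (\<lambda>p. p * G p) t) (at t)"
proof -
  define T where "T = t + 1"
  define H where "H p = exp (of_real T * p) * G p" for p
  have H: "integrable lborel (\<lambda>\<omega>. H (Complex \<sigma> \<omega>))"
    unfolding H_def by (rule integrable_bromwich[OF G])
  have "integrable lborel (\<lambda>\<omega>. exp (of_real T * Complex \<sigma> \<omega>) * (Complex \<sigma> \<omega> * G (Complex \<sigma> \<omega>)))"
    using integrable_bromwich[of "\<lambda>p. p * G p", OF pG] .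
  then have pH: "integrable lborel (\<lambda>\<omega>. Complex \<sigma> \<omega> * H (Complex \<sigma> \<omega>))"
    unfolding H_def by (simp only: mult.left_commute)
  have shift: "exp (of_real T * p) * exp (- of_real (T - y) * p) = exp (of_real y * p)" for y :: real and p :: complex
    unfolding exp_add[symmetric] by (simp add: algebra_simps)
  have H': "H p * exp (- of_real (T - y) * p) = exp (of_real y * p) * G p" for y p
  proof -
    have "exp (of_real T * p) * G p * exp (- of_real (T - y) * p) = exp (of_real T * p) * exp (- of_real (T - y) * p) * G p"
      by (simp only: mult_ac)
    then show ?thesis
      unfolding H_def shift .
  qed
  have H0: "bromwich \<sigma> (\<lambda>p. H p * exp (- of_real (T - y) * p)) 0 = bromwich \<sigma> G y" for y
    unfolding bromwich_def H' by simp
  have H1: "bromwich \<sigma> (\<lambda>p. p * (H p * exp (- of_real (T - t) * p))) 0 = bromwich \<sigma> (\<lambda>p. p * G p) t"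
    unfolding bromwich_def H' by (simp add: mult.left_commute)
  have "((\<lambda>\<zeta>. bromwich \<sigma> (\<lambda>p. H p * exp (- of_real \<zeta> * p)) 0) has_vector_derivative
    - bromwich \<sigma> (\<lambda>p. p * (H p * exp (- of_real (T - t) * p))) 0) (at (T - t) within {0..})"
    using \<open>0 \<le> \<sigma>\<close>
    by (intro bromwich_exp_derivative[OF H pH] borel_measurable_continuous_onI continuous_Complex) (auto simp: T_def)
  then have 1: "((\<lambda>\<zeta>. bromwich \<sigma> (\<lambda>p. H p * exp (- of_real \<zeta> * p)) 0) has_vector_derivative
    - bromwich \<sigma> (\<lambda>p. p * G p) t) (at (T - t))"
    unfolding H1 by (subst (asm) at_within_Ici) (auto simp: T_def)
  have "((\<lambda>y. T - y) has_real_derivative -1) (at t)"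
    by (auto intro!: derivative_eq_intros)
  then have "((\<lambda>y. T - y) has_vector_derivative -1) (at t)"
    by (simp add: has_real_derivative_iff_has_vector_derivative)
  from vector_diff_chain_at[OF this 1] show ?thesis
    unfolding o_def H0 by simp
qed

lemma has_real_derivative_Re:
  "(f has_vector_derivative D) F \<Longrightarrow> ((\<lambda>x. Re (f x)) has_real_derivative Re D) F"
  unfolding has_real_derivative_iff_has_vector_derivative
  by (rule bounded_linear.has_vector_derivative[OF bounded_linear_Re])

lemma has_real_derivative_at_0_from_limit:
  fixes f f' :: "real \<Rightarrow> real"
  assumes cont: "(f \<longlongrightarrow> f 0) (at_right 0)"
    and f': "\<And>x. 0 < x \<Longrightarrow> (f has_real_derivative f' x) (at x)"
    and lim: "(f' \<longlongrightarrow> L) (at_right 0)"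
  shows "(f has_real_derivative L) (at 0 within {0..})"
proof -
  have "((\<lambda>x. (f x - f 0) / x) \<longlongrightarrow> L) (at_right 0)"
  proof (rule lhopital_right_0[where f' = f' and g' = "\<lambda>x. 1"])
    show "((\<lambda>x. f x - f 0) \<longlongrightarrow> 0) (at_right 0)"
      using tendsto_diff[OF cont tendsto_const[of "f 0"]] by simp
    show "\<forall>\<^sub>F x in at_right 0. ((\<lambda>x. f x - f 0) has_real_derivative f' x) (at x)"
      using DERIV_diff[OF f' DERIV_const] by (auto simp: eventually_at_filter)
    show "\<forall>\<^sub>F x in at_right 0. ((\<lambda>x. x) has_real_derivative 1) (at (x :: real))"
      by (simp add: DERIV_ident)
    show "\<forall>\<^sub>F x in at_right 0. (x :: real) \<noteq> 0"
      by (simp add: eventually_at_filter)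
    show "filterlim (\<lambda>x. f' x / 1) (nhds L) (at_right 0)"
      using lim by simp
  qed (auto intro: tendsto_ident_at)
  then show ?thesis
    by (simp add: has_field_derivative_iff at_within_Ici_at_right)
qed

text \<open>Integration by parts along the line Re p = 1: the factor t comes from differentiating
  exp (t p), and the boundary terms vanish because G decays.\<close>

lemma bromwich_mult_time:
  assumes G: "decaying 1 G" and G': "\<And>p. 0 < Re p \<Longrightarrow> (G has_field_derivative G' p) (at p)"
    and int: "integrable lborel (\<lambda>\<omega>. G' (Complex 1 \<omega>))"
  shows "of_real t * bromwich 1 G t = - bromwich 1 G' t"
proof -
  define S where "S = {p :: complex. 0 < Re p}"
  have hol: "G holomorphic_on S"
    using G unfolding decaying_def S_def by blast
  have "open S"
    unfolding S_def by (rule open_halfspace_Re_gt)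
  have G'_eq: "G' p = deriv G p" if "p \<in> S" for p
    using G'[of p] that by (simp add: S_def DERIV_imp_deriv)
  have "deriv G holomorphic_on S"
    by (rule holomorphic_deriv[OF hol \<open>open S\<close>])
  then have "continuous_on S G'"
    using holomorphic_on_imp_continuous_on G'_eq by (metis (no_types, lifting) continuous_on_cong)
  then have cG': "continuous_on UNIV (\<lambda>\<omega>. G' (Complex 1 \<omega>))"
    unfolding S_def by (rule continuous_on_line) simp
  have cG: "continuous_on UNIV (\<lambda>\<omega>. G (Complex 1 \<omega>))"
    using holomorphic_on_imp_continuous_on[OF hol] unfolding S_def by (rule continuous_on_line) simp
  obtain C k where k: "1 < k" "\<And>p. 1 \<le> Re p \<Longrightarrow> norm (G p) \<le> C * norm p powr - k"
    using G unfolding decaying_def by blast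
  define h where "h \<omega> = exp (of_real t * Complex 1 \<omega>) * G (Complex 1 \<omega>)" for \<omega>
  define h' where "h' \<omega> = \<i> * (of_real t * h \<omega> + exp (of_real t * Complex 1 \<omega>) * G' (Complex 1 \<omega>))" for \<omega>
  have dh: "(h has_vector_derivative h' \<omega>) (at \<omega>)" for \<omega>
  proof -
    have "((\<lambda>p. exp (of_real t * p) * G p) has_field_derivative
        (of_real t * exp (of_real t * Complex 1 \<omega>)) * G (Complex 1 \<omega>) + G' (Complex 1 \<omega>) * exp (of_real t * Complex 1 \<omega>))
        (at (Complex 1 \<omega>))"
      by (intro DERIV_mult G') (auto intro!: derivative_eq_intros)
    then have 1: "((\<lambda>p. exp (of_real t * p) * G p) has_field_derivative
        (of_real t * exp (of_real t * Complex 1 \<omega>)) * G (Complex 1 \<omega>) + G' (Complex 1 \<omega>) * exp (of_real t * Complex 1 \<omega>))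
        (at (1 + \<i> * of_real \<omega>))"
      by (simp add: Complex_eq)
    have "((\<lambda>v. 1 + \<i> * v) has_field_derivative \<i>) (at (of_real \<omega>))"
      by (auto intro!: derivative_eq_intros)
    from has_vector_derivative_real_field[OF DERIV_chain2[OF 1 this]] show ?thesis
      unfolding h_def h'_def by (simp add: Complex_eq algebra_simps)
  qed
  have h_int: "integrable lborel h"
    unfolding h_def by (rule integrable_bromwich[OF decaying_integrable[OF G zero_less_one]])
  have g_int: "integrable lborel (\<lambda>\<omega>. exp (of_real t * Complex 1 \<omega>) * G' (Complex 1 \<omega>))"
    by (rule integrable_bromwich[OF int])
  have h'_int: "integrable lborel h'"
    unfolding h'_def by (intro integrable_mult_right Bochner_Integration.integrable_add h_int g_int)
  have h_le: "norm (h \<omega>) \<le> exp t * (\<bar>C\<bar> * \<bar>\<omega>\<bar> powr - k)" if "\<omega> \<noteq> 0" for \<omega>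
  proof -
    have "norm (G (Complex 1 \<omega>)) \<le> C * norm (Complex 1 \<omega>) powr - k"
      using k(2)[of "Complex 1 \<omega>"] by simp
    also have "\<dots> \<le> \<bar>C\<bar> * \<bar>\<omega>\<bar> powr - k"
      using abs_Im_le_cmod[of "Complex 1 \<omega>"] k(1) that by (intro mult_mono powr_mono2') auto
    finally show ?thesis
      unfolding h_def norm_mult norm_exp_line by simp
  qed
  have top: "(h \<longlongrightarrow> 0) at_top"
  proof (rule Lim_null_comparison)
    show "\<forall>\<^sub>F \<omega> in at_top. norm (h \<omega>) \<le> exp t * (\<bar>C\<bar> * \<bar>\<omega>\<bar> powr - k)"
      using eventually_gt_at_top[of 0] by eventually_elim (rule h_le, simp)
    show "((\<lambda>\<omega>. exp t * (\<bar>C\<bar> * \<bar>\<omega>\<bar> powr - k)) \<longlongrightarrow> 0) at_top"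
      using k(1) by real_asymp
  qed
  have bot: "(h \<longlongrightarrow> 0) at_bot"
  proof (rule Lim_null_comparison)
    show "\<forall>\<^sub>F \<omega> in at_bot. norm (h \<omega>) \<le> exp t * (\<bar>C\<bar> * \<bar>\<omega>\<bar> powr - k)"
      using eventually_gt_at_bot[of 0] by eventually_elim (rule h_le, simp)
    show "((\<lambda>\<omega>. exp t * (\<bar>C\<bar> * \<bar>\<omega>\<bar> powr - k)) \<longlongrightarrow> 0) at_bot"
      using k(1) by real_asymp
  qed
  have "(LBINT \<omega>=-\<infinity>..\<infinity>. h' \<omega>) = 0 - 0"
  proof (rule interval_integral_FTC_integrable)
    have "continuous_on UNIV h'"
      unfolding h'_def h_def by (intro continuous_intros continuous_Complex cG cG')
    then show "isCont h' \<omega>" for \<omega>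
      by (simp add: continuous_on_eq_continuous_at)
    show "set_integrable lborel (einterval (- \<infinity>) \<infinity>) h'"
      using h'_int by (simp add: set_integrable_def)
    show "((h \<circ> real_of_ereal) \<longlongrightarrow> 0) (at_right (- \<infinity>))" "((h \<circ> real_of_ereal) \<longlongrightarrow> 0) (at_left \<infinity>)"
      using top bot by (simp_all add: ereal_tendsto_simps)
  qed (use dh in auto)
  then have "integral\<^sup>L lborel h' = 0"
    by (simp add: interval_lebesgue_integral_def set_lebesgue_integral_def)
  also have "integral\<^sup>L lborel h' = \<i> * (of_real t * integral\<^sup>L lborel h
      + (LBINT \<omega>. exp (of_real t * Complex 1 \<omega>) * G' (Complex 1 \<omega>)))"
    unfolding h'_def using h_int g_int by simp
  finally have "of_real t * integral\<^sup>L lborel h = - (LBINT \<omega>. exp (of_real t * Complex 1 \<omega>) * G' (Complex 1 \<omega>))"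
    by (simp add: eq_neg_iff_add_eq_0)
  then show ?thesis
    unfolding bromwich_def h_def by simp
qed

text \<open>Both sides have the transform 1 / p^2, so Lerch's theorem applies. In the proof t is
  written as \<open>t powr 1\<close> to fit the transform of powers with \<delta> = -1.\<close>

lemma bromwich_inverse_square:
  assumes "0 < t"
  shows "Re (bromwich 1 (\<lambda>p. 1 / p\<^sup>2) t) = t"
proof -
  have dec: "decaying 1 (\<lambda>p. 1 / p\<^sup>2)"
  proof (rule decayingI)
    show "(\<lambda>p. 1 / p\<^sup>2) holomorphic_on {p. 0 < Re p}"
      by (intro holomorphic_intros) auto
    show "norm (1 / p\<^sup>2) \<le> 1 * norm p powr - 2" if "1 \<le> Re p" for p :: complex
    proof -
      have "0 < norm p"
        using that by auto
      then show ?thesis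
        by (simp add: norm_divide norm_power powr_minus_divide)
    qed
  qed simp
  have "Re (bromwich 1 (\<lambda>p. 1 / p\<^sup>2) t) = t powr 1"
  proof (rule lerch[where ?p0.0 = 2, OF _ _ _ _ _ assms])
    show "continuous_on {0<..} (\<lambda>t. Re (bromwich 1 (\<lambda>p. 1 / p\<^sup>2) t))"
      by (intro continuous_on_Re continuous_on_subset[OF continuous_on_bromwich[OF decaying_integrable[OF dec]]]) auto
    show "continuous_on {0<..} (\<lambda>t::real. t powr 1)"
      by (intro continuous_intros) auto
    fix p :: real assume p: "2 \<le> p"
    note L = laplace_bromwich[OF dec zero_less_one, of "of_real p"]
    have p1: "1 < Re (of_real p)"
      using p by simp
    show "set_integrable lborel {0..} (\<lambda>t. exp (- p * t) * Re (bromwich 1 (\<lambda>p. 1 / p\<^sup>2) t))"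
      by (rule laplace_Re(1)[OF L(1)[OF p1]])
    show "set_integrable lborel {0..} (\<lambda>t. exp (- p * t) * t powr 1)"
      using laplace_powr_real(1)[of "-1" p] p by simp
    have "1 / (complex_of_real p)\<^sup>2 = of_real (1 / p\<^sup>2)"
      by simp
    then have "(LBINT t:{0..}. exp (- p * t) * Re (bromwich 1 (\<lambda>p. 1 / p\<^sup>2) t)) = 1 / p\<^sup>2"
      unfolding laplace_Re(2)[OF L(1)[OF p1]] L(2)[OF p1] by (simp only: Re_complex_of_real)
    moreover have "(LBINT t:{0..}. exp (- p * t) * t powr 1) = 1 / p\<^sup>2"
      using laplace_powr_real(2)[of "-1" p] p Gamma_fact[of 1, where 'a = real] by (simp add: powr_minus_divide)
    ultimately show "(LBINT t:{0..}. exp (- p * t) * Re (bromwich 1 (\<lambda>p. 1 / p\<^sup>2) t)) = (LBINT t:{0..}. exp (- p * t) * t powr 1)"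
      by simp
  qed
  then show ?thesis
    using assms by simp
qed

section \<open>The Laplace symbol of the problem\<close>

lemma exp_powr_decay:
  fixes c b N :: real
  assumes "0 < c" "0 < b" "0 \<le> N"
  obtains C where "0 < C" "\<And>r. 0 < r \<Longrightarrow> exp (- c * r powr b) \<le> C * r powr - N"
proof -
  have "((\<lambda>r. r powr N * exp (- c * r powr b)) \<longlongrightarrow> 0) at_top"
    using assms by real_asymp
  then have "\<forall>\<^sub>F r in at_top. r powr N * exp (- c * r powr b) < 1"
    by (rule order_tendstoD) simp
  then obtain R where R: "\<And>r. R \<le> r \<Longrightarrow> r powr N * exp (- c * r powr b) < 1"
    unfolding eventually_at_top_linorder by blast
  \<comment> \<open>The maximum with 1 makes R0^N \<ge> 1, so the same constant also covers r \<ge>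
    R0, where the product is below 1.\<close>
  define R0 where "R0 = max 1 R"
  have R0: "1 \<le> R0" "1 \<le> R0 powr N"
    using assms by (auto simp: R0_def ge_one_powr_ge_zero)
  show thesis
  proof (rule that)
    show "0 < R0 powr N"
      using R0 by simp
    fix r :: real assume r: "0 < r"
    have "r powr N * exp (- c * r powr b) \<le> R0 powr N"
    proof (cases "R0 \<le> r")
      case True
      then show ?thesis
        using R[of r] R0 by (simp add: R0_def)
    next
      case False
      have "exp (- c * r powr b) \<le> 1"
        using assms by simp
      moreover have "r powr N \<le> R0 powr N"
        using r False assms by (intro powr_mono2) auto
      ultimately show ?thesis
        using mult_mono[of "r powr N" "R0 powr N" "exp (- c * r powr b)" 1] by simp
    qed
    then have "r powr - N * (r powr N * exp (- c * r powr b)) \<le> r powr - N * R0 powr N"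
      by (intro mult_left_mono) auto
    moreover have "r powr - N * r powr N = 1"
      using r by (simp add: powr_add[symmetric])
    then have "r powr - N * (r powr N * X) = X" for X
      by (simp add: mult.assoc[symmetric])
    ultimately show "exp (- c * r powr b) \<le> R0 powr N * r powr - N"
      by (simp only: mult.commute)
  qed
qed

text \<open>The principal root satisfies (Re (csqrt z))^2 = (|z| + Re z) / 2 \<ge> Re z.\<close>

lemma Re_csqrt_ge:
  assumes "0 \<le> y" "y\<^sup>2 \<le> Re z"
  shows "y \<le> Re (csqrt z)"
proof -
  have "y\<^sup>2 \<le> (norm z + Re z) / 2"
    using assms complex_Re_le_cmod[of z] by simp
  then show ?thesis
    using assms by (simp add: real_le_rsqrt)
qed

lemma norm_powr_of_real: "(p :: complex) \<noteq> 0 \<Longrightarrow> norm (p powr of_real e) = norm p powr e"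
  by (simp add: powr_def)

locale lumped_problem =
  fixes \<beta> a lam A \<gamma> \<alpha> :: real
  assumes \<beta>: "0 < \<beta>" "\<beta> < 1 / 2"
    and pos: "0 < a" "0 < lam" "0 < A" "0 < \<gamma>" "0 < \<alpha>"
begin

definition P :: "complex \<Rightarrow> complex" where "P p = p powr of_real (2 * \<beta>)"
text \<open>Completing the square in a^2 m^2 + lam m = P gives (a m + \<mu>)^2 = P + \<mu>^2 with
  \<mu> = lam / (2 a), which is where R = a m + \<mu> comes from.\<close>

definition R :: "complex \<Rightarrow> complex" where "R p = csqrt (P p + of_real (lam\<^sup>2 / (4 * a\<^sup>2)))"
definition \<mu> :: real where "\<mu> = lam / (2 * a)"
definition m :: "complex \<Rightarrow> complex" where "m p = (R p - of_real \<mu>) / of_real a"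
definition s :: "complex \<Rightarrow> complex" where "s p = csqrt (P p + of_real \<alpha> * m p + of_real (\<gamma>\<^sup>2))"
text \<open>The cosine of the limiting argument of p^(2 \<beta>) as p approaches the imaginary
  axis.\<close>

definition \<kappa> :: real where "\<kappa> = cos (pi * \<beta>)"

lemma \<kappa>_pos: "0 < \<kappa>"
  unfolding \<kappa>_def using \<beta> pi_gt_zero by (intro cos_gt_zero) (auto simp: field_simps)

lemma \<mu>_pos: "0 < \<mu>"
  using pos by (simp add: \<mu>_def)

lemma \<mu>2: "lam\<^sup>2 / (4 * a\<^sup>2) = \<mu>\<^sup>2"
  by (simp add: \<mu>_def power_divide power_mult_distrib)

lemma norm_P: "0 < Re p \<Longrightarrow> norm (P p) = norm p powr (2 * \<beta>)"
  unfolding P_def by (rule norm_powr_of_real) auto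

lemma Re_P_ge:
  assumes "0 < Re p"
  shows "\<kappa> * norm p powr (2 * \<beta>) \<le> Re (P p)"
proof -
  have p: "p \<noteq> 0"
    using assms by auto
  then have im: "\<bar>Im (Ln p)\<bar> < pi / 2"
    using assms Re_Ln_pos_lt by blast
  have "\<bar>2 * \<beta> * Im (Ln p)\<bar> \<le> 2 * \<beta> * (pi / 2)"
    using im \<beta> by (simp add: abs_mult)
  then have le: "\<bar>2 * \<beta> * Im (Ln p)\<bar> \<le> pi * \<beta>"
    by (simp add: mult.commute)
  have "pi * \<beta> \<le> pi"
    using \<beta> by simp
  then have "\<kappa> \<le> cos \<bar>2 * \<beta> * Im (Ln p)\<bar>"
    unfolding \<kappa>_def using le by (intro cos_monotone_0_pi_le) auto
  then have "\<kappa> \<le> cos (2 * \<beta> * Im (Ln p))"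
    by simp
  moreover have "Re (P p) = norm p powr (2 * \<beta>) * cos (2 * \<beta> * Im (Ln p))"
    using p by (simp add: P_def powr_def Re_exp)
  ultimately show ?thesis
    using mult_left_mono[OF \<open>\<kappa> \<le> cos (2 * \<beta> * Im (Ln p))\<close>, of "norm p powr (2 * \<beta>)"]
    by (simp add: mult.commute)
qed

lemma Re_P_pos:
  assumes "0 < Re p"
  shows "0 < Re (P p)"
proof -
  have "0 < \<kappa> * norm p powr (2 * \<beta>)"
    using assms \<kappa>_pos by (intro mult_pos_pos) auto
  then show ?thesis
    using Re_P_ge[OF assms] by simp
qed

lemma sqrt_\<kappa>_powr: "(sqrt \<kappa> * r powr \<beta>)\<^sup>2 = \<kappa> * r powr (2 * \<beta>)"
proof -
  have "(r powr \<beta>)\<^sup>2 = r powr (2 * \<beta>)"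
    by (simp add: power2_eq_square powr_add[symmetric])
  then show ?thesis
    using \<kappa>_pos by (simp add: power_mult_distrib)
qed

lemma Re_R_ge:
  assumes "0 < Re p"
  shows "\<mu> \<le> Re (R p)" and "sqrt \<kappa> * norm p powr \<beta> \<le> Re (R p)"
proof -
  show "\<mu> \<le> Re (R p)"
    unfolding R_def \<mu>2 using Re_P_pos[OF assms] \<mu>_pos by (intro Re_csqrt_ge) auto
  have "(sqrt \<kappa> * norm p powr \<beta>)\<^sup>2 \<le> Re (P p + of_real (\<mu>\<^sup>2))"
    unfolding sqrt_\<kappa>_powr using Re_P_ge[OF assms] zero_le_power2[of \<mu>] unfolding plus_complex.simps Re_complex_of_real by linarith
  then show "sqrt \<kappa> * norm p powr \<beta> \<le> Re (R p)"
    unfolding R_def \<mu>2 using \<kappa>_pos by (intro Re_csqrt_ge) auto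
qed

lemma Re_m_nonneg: "0 < Re p \<Longrightarrow> 0 \<le> Re (m p)"
  using Re_R_ge(1)[of p] pos by (simp add: m_def Re_divide_of_real)

lemma Re_q_ge:
  assumes "0 < Re p"
  shows "\<kappa> * norm p powr (2 * \<beta>) \<le> Re (P p + of_real \<alpha> * m p)"
  using Re_P_ge[OF assms] Re_m_nonneg[OF assms] pos by (simp add: add_increasing2)

lemma Re_q_pos:
  assumes "0 < Re p"
  shows "0 < Re (P p + of_real \<alpha> * m p)"
  using Re_P_pos[OF assms] Re_m_nonneg[OF assms] pos by (simp add: add_pos_nonneg)

lemma Re_s_ge:
  assumes "0 < Re p"
  shows "\<gamma> \<le> Re (s p)" and "sqrt \<kappa> * norm p powr \<beta> \<le> Re (s p)"
proof -
  show "\<gamma> \<le> Re (s p)"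
    unfolding s_def using Re_q_pos[OF assms] pos by (intro Re_csqrt_ge) auto
  have "(sqrt \<kappa> * norm p powr \<beta>)\<^sup>2 \<le> Re (P p + of_real \<alpha> * m p + of_real (\<gamma>\<^sup>2))"
    unfolding sqrt_\<kappa>_powr plus_complex.simps(1)[of "P p + of_real \<alpha> * m p"] Re_complex_of_real
    using Re_q_ge[OF assms] zero_le_power2[of \<gamma>] by linarith
  then show "sqrt \<kappa> * norm p powr \<beta> \<le> Re (s p)"
    unfolding s_def using \<kappa>_pos by (intro Re_csqrt_ge) auto
qed

lemma norm_ge_1: "1 \<le> Re p \<Longrightarrow> 1 \<le> norm p"
  using complex_Re_le_cmod[of p] by simp

lemma le_mult_norm: "1 \<le> Re p \<Longrightarrow> 0 \<le> c \<Longrightarrow> c \<le> c * norm p"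
  using mult_left_mono[OF norm_ge_1, of p c] by simp

text \<open>On Re p \<ge> 1 one has |p| \<ge> 1 and hence Re P \<ge> \<kappa>, which lifts the
  square roots above \<mu> and \<gamma> by a fixed amount. The gap gives exponential decay in x + z
  and so condition (b); it would close as p tends to 0.\<close>

lemma Re_line_gap:
  obtains c where "0 < c" "\<And>p. 1 \<le> Re p \<Longrightarrow> c \<le> Re (m p)" "\<And>p. 1 \<le> Re p \<Longrightarrow> c \<le> Re (s p - of_real \<gamma>)"
proof -
  define c1 where "c1 = (sqrt (\<kappa> + \<mu>\<^sup>2) - \<mu>) / a"
  define c2 where "c2 = sqrt (\<kappa> + \<gamma>\<^sup>2) - \<gamma>"
  have \<kappa>_le: "\<kappa> \<le> \<kappa> * norm p powr (2 * \<beta>)" if "1 \<le> Re p" for p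
    using norm_ge_1[OF that] \<beta> \<kappa>_pos by (simp add: ge_one_powr_ge_zero)
  show thesis
  proof (rule that)
    have "\<mu> < sqrt (\<kappa> + \<mu>\<^sup>2)" "\<gamma> < sqrt (\<kappa> + \<gamma>\<^sup>2)"
      using \<kappa>_pos by (auto intro!: real_less_rsqrt)
    then show "0 < min c1 c2"
      using pos by (simp add: c1_def c2_def)
    fix p assume p: "1 \<le> Re p"
    then have p': "0 < Re p"
      by simp
    have "sqrt (\<kappa> + \<mu>\<^sup>2) \<le> Re (R p)"
      unfolding R_def \<mu>2 using order_trans[OF \<kappa>_le[OF p] Re_P_ge[OF p']] \<kappa>_pos by (intro Re_csqrt_ge) auto
    then have "c1 \<le> Re (m p)"
      using pos by (simp add: c1_def m_def Re_divide_of_real divide_right_mono)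
    then show "min c1 c2 \<le> Re (m p)"
      by simp
    have "sqrt (\<kappa> + \<gamma>\<^sup>2) \<le> Re (s p)"
      unfolding s_def using order_trans[OF \<kappa>_le[OF p] Re_q_ge[OF p']] \<kappa>_pos by (intro Re_csqrt_ge) auto
    then show "min c1 c2 \<le> Re (s p - of_real \<gamma>)"
      by (simp add: c2_def)
  qed
qed

section \<open>Holomorphy, characteristic equations and growth of the symbols\<close>

lemma holomorphic_symbols:
  shows holomorphic_P: "P holomorphic_on {p. 0 < Re p}"
    and holomorphic_R: "R holomorphic_on {p. 0 < Re p}"
    and holomorphic_m: "m holomorphic_on {p. 0 < Re p}"
    and holomorphic_s: "s holomorphic_on {p. 0 < Re p}"
proof -
  show P: "P holomorphic_on {p. 0 < Re p}"
    unfolding P_def by (intro holomorphic_intros) (auto simp: complex_nonpos_Reals_iff)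
  have nonpos: "w \<notin> \<real>\<^sub>\<le>\<^sub>0" if "0 < Re w" for w
    using that by (auto simp: complex_nonpos_Reals_iff)
  have "0 < Re (P p + of_real (lam\<^sup>2 / (4 * a\<^sup>2)))" if "0 < Re p" for p
    using Re_P_pos[OF that] unfolding \<mu>2 by (simp add: add_pos_nonneg)
  then show R: "R holomorphic_on {p. 0 < Re p}"
    unfolding R_def using nonpos by (intro holomorphic_intros P) auto
  show m: "m holomorphic_on {p. 0 < Re p}"
    unfolding m_def using pos by (intro holomorphic_intros R) auto
  have "0 < Re (P p + of_real \<alpha> * m p + of_real (\<gamma>\<^sup>2))" if "0 < Re p" for p
    using Re_q_pos[OF that] by (simp add: add_pos_nonneg)
  then show "s holomorphic_on {p. 0 < Re p}"
    unfolding s_def using nonpos by (intro holomorphic_intros P m) auto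
qed

lemma m_eq: "of_real (a\<^sup>2) * (m p)\<^sup>2 + of_real lam * m p = P p"
proof -
  have R2: "(R p)\<^sup>2 = P p + (of_real \<mu>)\<^sup>2"
    unfolding R_def \<mu>2 by simp
  have am: "of_real a * m p = R p - of_real \<mu>"
    using pos by (simp add: m_def)
  have lam: "complex_of_real lam = 2 * of_real \<mu> * of_real a"
    using pos by (simp add: \<mu>_def)
  have "of_real (a\<^sup>2) * (m p)\<^sup>2 + of_real lam * m p = (of_real a * m p)\<^sup>2 + 2 * of_real \<mu> * (of_real a * m p)"
    by (simp add: lam power_mult_distrib)
  also have "\<dots> = P p"
    unfolding am power2_diff R2 by (simp add: algebra_simps power2_eq_square)
  finally show ?thesis .
qed

text \<open>With \<rho> = s - \<gamma> this reads \<rho>^2 + 2 \<gamma> \<rho> - \<alpha> m = P, the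
  boundary equation on z = 0 applied to exp (-\<rho> x - m z).\<close>

lemma s_eq: "(s p - of_real \<gamma>) * (s p + of_real \<gamma>) = P p + of_real \<alpha> * m p"
proof -
  have "(s p)\<^sup>2 = P p + of_real \<alpha> * m p + (of_real \<gamma>)\<^sup>2"
    unfolding s_def by simp
  then show ?thesis
    by (simp add: algebra_simps power2_eq_square)
qed

lemma s_plus_nonzero:
  assumes "0 < Re p"
  shows "s p + of_real \<gamma> \<noteq> 0"
proof
  assume "s p + of_real \<gamma> = 0"
  then have "Re (s p + of_real \<gamma>) = 0"
    by simp
  then show False
    using Re_s_ge(1)[OF assms] pos by simp
qed

text \<open>Linear growth is not sharp, but any power is enough: for x > 0 the exponential factor
  beats it. The square roots are bounded through their squares, using |p| \<ge> 1.\<close>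

lemma symbol_growth:
  obtains K where "1 \<le> K" "\<And>p. 1 \<le> Re p \<Longrightarrow> norm (m p) \<le> K * norm p" "\<And>p. 1 \<le> Re p \<Longrightarrow> norm (s p) \<le> K * norm p"
    "\<And>p. 1 \<le> Re p \<Longrightarrow> norm (P p) \<le> K * norm p"
proof -
  have root: "norm w \<le> K * norm p" if "(norm w)\<^sup>2 \<le> K * norm p" "1 \<le> K" "1 \<le> norm p" for w p :: complex and K
  proof -
    have "1 \<le> K * norm p"
      using mult_mono[of 1 K 1 "norm p"] that by simp
    then have "K * norm p \<le> (K * norm p)\<^sup>2"
      using mult_mono[of 1 "K * norm p" "K * norm p" "K * norm p"] by (simp add: power2_eq_square)
    then have "(norm w)\<^sup>2 \<le> (K * norm p)\<^sup>2"
      using that by linarith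
    then show ?thesis
      by (rule power2_le_imp_le) (use \<open>1 \<le> K * norm p\<close> in linarith)
  qed
  define K1 where "K1 = 1 + \<mu>\<^sup>2"
  define K2 where "K2 = (K1 + \<mu>) / a"
  define K3 where "K3 = 1 + \<alpha> * K2 + \<gamma>\<^sup>2"
  have K: "1 \<le> K1" "0 \<le> K2" "1 \<le> K3"
    using pos \<mu>_pos by (auto simp: K1_def K2_def K3_def intro!: add_increasing2)
  have P: "norm (P p) \<le> norm p" if "1 \<le> Re p" for p
    using norm_P[of p] norm_ge_1[OF that] that \<beta> powr_mono[of "2 * \<beta>" 1 "norm p"] by simp
  have R: "norm (R p) \<le> K1 * norm p" if "1 \<le> Re p" for p
  proof (rule root)
    have "(norm (R p))\<^sup>2 = norm (P p + of_real (\<mu>\<^sup>2))"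
      unfolding R_def \<mu>2 by (simp add: norm_power[symmetric])
    also have "\<dots> \<le> norm (P p) + \<mu>\<^sup>2"
      using norm_triangle_ineq[of "P p" "of_real (\<mu>\<^sup>2)"] unfolding norm_of_real abs_power2 .
    also have "\<dots> \<le> norm p + \<mu>\<^sup>2 * norm p"
      using P[OF that] le_mult_norm[OF that zero_le_power2[of \<mu>]] by linarith
    finally show "(norm (R p))\<^sup>2 \<le> K1 * norm p"
      by (simp add: K1_def algebra_simps)
  qed (use K norm_ge_1[OF that] in auto)
  have m: "norm (m p) \<le> K2 * norm p" if "1 \<le> Re p" for p
  proof -
    have "norm (R p - of_real \<mu>) \<le> norm (R p) + norm (of_real \<mu> :: complex)"
      by (rule norm_triangle_ineq4)
    also have "\<dots> \<le> K1 * norm p + \<mu> * norm p"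
      using R[OF that] le_mult_norm[OF that less_imp_le[OF \<mu>_pos]] \<mu>_pos by (simp only: norm_of_real abs_of_pos)
    finally show ?thesis
      using pos by (simp add: m_def norm_divide K2_def divide_right_mono algebra_simps add_divide_distrib[symmetric])
  qed
  have s: "norm (s p) \<le> K3 * norm p" if "1 \<le> Re p" for p
  proof (rule root)
    have "(norm (s p))\<^sup>2 = norm (P p + of_real \<alpha> * m p + of_real (\<gamma>\<^sup>2))"
      unfolding s_def by (simp add: norm_power[symmetric])
    also have "\<dots> \<le> norm (P p) + norm (of_real \<alpha> * m p) + norm (of_real (\<gamma>\<^sup>2) :: complex)"
      by (intro order_trans[OF norm_triangle_ineq] add_right_mono norm_triangle_ineq)
    also have "\<dots> = norm (P p) + \<alpha> * norm (m p) + \<gamma>\<^sup>2"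
      using pos by (simp add: norm_mult norm_power)
    also have "\<dots> \<le> norm p + \<alpha> * (K2 * norm p) + \<gamma>\<^sup>2 * norm p"
      using P[OF that] mult_left_mono[OF m[OF that] less_imp_le[OF pos(5)]] le_mult_norm[OF that zero_le_power2[of \<gamma>]]
      by linarith
    finally show "(norm (s p))\<^sup>2 \<le> K3 * norm p"
      by (simp add: K3_def algebra_simps)
  qed (use K norm_ge_1[OF that] in auto)
  show thesis
  proof (rule that)
    show "1 \<le> K2 + K3"
      using K by simp
    show "norm (m p) \<le> (K2 + K3) * norm p" "norm (s p) \<le> (K2 + K3) * norm p" "norm (P p) \<le> (K2 + K3) * norm p"
      if "1 \<le> Re p" for p
    proof -
      have "K2 * norm p \<le> (K2 + K3) * norm p" "K3 * norm p \<le> (K2 + K3) * norm p" "1 * norm p \<le> (K2 + K3) * norm p"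
        by (rule mult_right_mono, use K in linarith, simp)+
      then show "norm (m p) \<le> (K2 + K3) * norm p" "norm (s p) \<le> (K2 + K3) * norm p" "norm (P p) \<le> (K2 + K3) * norm p"
        using m[OF that] s[OF that] P[OF that] by auto
    qed
  qed
qed

text \<open>Using s - \<gamma> in place of s absorbs the prefactor exp (\<gamma> x) of the stated
  formula.\<close>

definition E :: "real \<Rightarrow> real \<Rightarrow> complex \<Rightarrow> complex" where
  "E x z p = exp (- of_real x * (s p - of_real \<gamma>)) * exp (- of_real z * m p)"

lemma holomorphic_E: "E x z holomorphic_on {p. 0 < Re p}"
  unfolding E_def by (intro holomorphic_intros holomorphic_s holomorphic_m)

lemma norm_E_le_1:
  assumes "0 \<le> x" "0 \<le> z" "0 < Re p"
  shows "norm (E x z p) \<le> 1"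
proof -
  have "norm (E x z p) = exp (- (x * Re (s p - of_real \<gamma>))) * exp (- (z * Re (m p)))"
    by (simp add: E_def norm_mult)
  also have "\<dots> \<le> 1 * 1"
    using assms Re_s_ge(1)[of p] Re_m_nonneg[of p] by (intro mult_mono) auto
  finally show ?thesis
    by simp
qed

text \<open>Differentiating the integral of Q E in x, z or t multiplies Q by -(s - \<gamma>), -m or
  p, and the Caputo derivative multiplies it by P. All these factors belong to this class, which is
  closed under products.\<close>

definition poly_bounded :: "(complex \<Rightarrow> complex) \<Rightarrow> bool" where
  "poly_bounded Q \<longleftrightarrow> Q holomorphic_on {p. 0 < Re p} \<and>
    (\<exists>B n. 0 \<le> n \<and> (\<forall>p. 1 \<le> Re p \<longrightarrow> norm (Q p) \<le> B * norm p powr n))"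

lemma poly_bounded_mult:
  assumes "poly_bounded Q1" "poly_bounded Q2"
  shows "poly_bounded (\<lambda>p. Q1 p * Q2 p)"
proof -
  obtain B1 n1 where 1: "0 \<le> n1" "\<And>p. 1 \<le> Re p \<Longrightarrow> norm (Q1 p) \<le> B1 * norm p powr n1"
    using assms unfolding poly_bounded_def by blast
  obtain B2 n2 where 2: "0 \<le> n2" "\<And>p. 1 \<le> Re p \<Longrightarrow> norm (Q2 p) \<le> B2 * norm p powr n2"
    using assms unfolding poly_bounded_def by blast
  have "norm (Q1 p * Q2 p) \<le> (B1 * B2) * norm p powr (n1 + n2)" if "1 \<le> Re p" for p
    using mult_mono'[OF 1(2)[OF that] 2(2)[OF that]]
    by (simp add: norm_mult powr_add mult_ac)
  moreover have "(\<lambda>p. Q1 p * Q2 p) holomorphic_on {p. 0 < Re p}"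
    using assms unfolding poly_bounded_def by (intro holomorphic_intros) auto
  ultimately show ?thesis
    unfolding poly_bounded_def using 1(1) 2(1) by (blast intro: add_nonneg_nonneg)
qed

lemma poly_bounded_linear:
  assumes "Q holomorphic_on {p. 0 < Re p}" "\<And>p. 1 \<le> Re p \<Longrightarrow> norm (Q p) \<le> B * norm p"
  shows "poly_bounded Q"
proof -
  have "0 \<le> (1::real) \<and> (\<forall>p. 1 \<le> Re p \<longrightarrow> norm (Q p) \<le> B * norm p powr 1)"
    using assms(2) by simp
  then show ?thesis
    unfolding poly_bounded_def using assms(1) by blast
qed

lemma poly_bounded_symbols:
  shows "poly_bounded m" "poly_bounded (\<lambda>p. s p - of_real \<gamma>)" "poly_bounded P" "poly_bounded (\<lambda>p. p)"
    "poly_bounded (\<lambda>p. - 1)"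
proof -
  obtain K where K: "1 \<le> K" "\<And>p. 1 \<le> Re p \<Longrightarrow> norm (m p) \<le> K * norm p" "\<And>p. 1 \<le> Re p \<Longrightarrow> norm (s p) \<le> K * norm p"
    "\<And>p. 1 \<le> Re p \<Longrightarrow> norm (P p) \<le> K * norm p"
    using symbol_growth by metis
  show "poly_bounded m" "poly_bounded P"
    by (rule poly_bounded_linear[OF holomorphic_m K(2)] poly_bounded_linear[OF holomorphic_P K(4)], assumption)+
  show "poly_bounded (\<lambda>p. p)"
    by (rule poly_bounded_linear[of _ 1]) (auto intro: holomorphic_intros)
  show "poly_bounded (\<lambda>p. - 1)"
    by (rule poly_bounded_linear[of _ 1]) (auto intro: holomorphic_intros simp: norm_ge_1)
  show "poly_bounded (\<lambda>p. s p - of_real \<gamma>)"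
  proof (rule poly_bounded_linear)
    show "(\<lambda>p. s p - of_real \<gamma>) holomorphic_on {p. 0 < Re p}"
      by (intro holomorphic_intros holomorphic_s)
    fix p :: complex assume p: "1 \<le> Re p"
    have "norm (s p - of_real \<gamma>) \<le> norm (s p) + \<gamma>"
      using norm_triangle_ineq4[of "s p" "of_real \<gamma>"] pos by simp
    also have "\<dots> \<le> K * norm p + \<gamma> * norm p"
      using K(3)[OF p] le_mult_norm[OF p less_imp_le[OF pos(4)]] by linarith
    finally show "norm (s p - of_real \<gamma>) \<le> (K + \<gamma>) * norm p"
      by (simp add: algebra_simps)
  qed
qed

lemma poly_bounded_inverse: "poly_bounded (\<lambda>p. 1 / p)"
proof (rule poly_bounded_linear)
  show "(\<lambda>p. 1 / p) holomorphic_on {p. 0 < Re p}"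
    by (intro holomorphic_intros) auto
  show "norm (1 / p) \<le> 1 * norm p" if "1 \<le> Re p" for p
    using norm_ge_1[OF that] mult_mono[of 1 "norm p" 1 "norm p"] by (simp add: norm_divide divide_simps)
qed

text \<open>For x > 0 the bound exp (-x sqrt \<kappa> |p|^\<beta>) is smaller than any power;
  choosing the power n + 2 leaves |p|^(-2) after multiplication by Q.\<close>

lemma decaying_poly_E:
  assumes Q: "poly_bounded Q" and x: "0 < x" and z: "0 \<le> z"
  shows "decaying 1 (\<lambda>p. Q p * E x z p)"
proof -
  obtain B n where B: "0 \<le> n" "\<And>p. 1 \<le> Re p \<Longrightarrow> norm (Q p) \<le> B * norm p powr n"
    and hol: "Q holomorphic_on {p. 0 < Re p}"
    using Q unfolding poly_bounded_def by blast
  have c: "0 < x * sqrt \<kappa>"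
    using x \<kappa>_pos by simp
  obtain C where C: "0 < C" "\<And>r. 0 < r \<Longrightarrow> exp (- (x * sqrt \<kappa>) * r powr \<beta>) \<le> C * r powr - (n + 2)"
    using exp_powr_decay[OF c \<beta>(1), of "n + 2"] B(1) by auto
  show ?thesis
  proof (rule decayingI[where k = 2 and C = "B * (exp (x * \<gamma>) * C)"])
    show "(\<lambda>p. Q p * E x z p) holomorphic_on {p. 0 < Re p}"
      by (intro holomorphic_intros hol holomorphic_E)
    fix p :: complex assume p: "1 \<le> Re p"
    then have p': "0 < Re p" "0 < norm p"
      using norm_ge_1[OF p] by auto
    have "norm (E x z p) = exp (x * \<gamma>) * exp (- (x * Re (s p))) * exp (- (z * Re (m p)))"
      by (simp add: E_def norm_mult exp_add[symmetric] algebra_simps)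
    also have "\<dots> \<le> exp (x * \<gamma>) * exp (- (x * sqrt \<kappa>) * norm p powr \<beta>) * 1"
      using Re_s_ge(2)[OF p'(1)] Re_m_nonneg[OF p'(1)] x z
      by (intro mult_mono) (auto simp: mult.assoc)
    also have "\<dots> \<le> exp (x * \<gamma>) * (C * norm p powr - (n + 2))"
      using C(2)[OF p'(2)] by simp
    finally have "norm (E x z p) \<le> exp (x * \<gamma>) * (C * norm p powr - (n + 2))" .
    from mult_mono'[OF B(2)[OF p] this]
    have "norm (Q p * E x z p) \<le> B * (exp (x * \<gamma>) * C) * (norm p powr n * norm p powr - (n + 2))"
      by (simp add: norm_mult mult_ac)
    also have "norm p powr n * norm p powr - (n + 2) = norm p powr - 2"
      by (simp add: powr_add[symmetric])
    finally show "norm (Q p * E x z p) \<le> B * (exp (x * \<gamma>) * C) * norm p powr - 2" .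
  qed simp
qed

text \<open>The amplitude is forced by condition (a): the transform of the constant A is A / p, so
  -(s - \<gamma>) Q0 - 2 \<gamma> Q0 = -2 \<gamma> A / p.\<close>

definition Q0 :: "complex \<Rightarrow> complex" where
  "Q0 p = of_real (2 * \<gamma> * A) / (p * (s p + of_real \<gamma>))"

lemma holomorphic_Q0: "Q0 holomorphic_on {p. 0 < Re p}"
  unfolding Q0_def using s_plus_nonzero by (intro holomorphic_intros holomorphic_s) auto

lemma norm_Q0_le:
  assumes "0 < Re p"
  shows "norm (Q0 p) \<le> (2 * \<gamma> * A / sqrt \<kappa>) * norm p powr - (1 + \<beta>)"
proof -
  have p: "0 < norm p"
    using assms by auto
  have "sqrt \<kappa> * norm p powr \<beta> \<le> norm (s p + of_real \<gamma>)"
    using Re_s_ge(2)[OF assms] complex_Re_le_cmod[of "s p + of_real \<gamma>"] pos by simp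
  then have "norm p * (sqrt \<kappa> * norm p powr \<beta>) \<le> norm (p * (s p + of_real \<gamma>))"
    by (simp add: norm_mult mult_left_mono)
  moreover have "0 < norm p * (sqrt \<kappa> * norm p powr \<beta>)"
    using p \<kappa>_pos by simp
  ultimately have "norm (Q0 p) \<le> 2 * \<gamma> * A / (norm p * (sqrt \<kappa> * norm p powr \<beta>))"
  proof -
    have "norm (of_real (2 * \<gamma> * A) :: complex) = 2 * \<gamma> * A"
      unfolding norm_of_real using pos by simp
    with \<open>norm p * _ \<le> _\<close> \<open>0 < norm p * _\<close> show ?thesis
      unfolding Q0_def norm_divide using pos by (intro frac_le) simp_all
  qed
  also have "\<dots> = (2 * \<gamma> * A / sqrt \<kappa>) * norm p powr - (1 + \<beta>)"
    unfolding powr_minus_divide powr_add using p by simp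
  finally show ?thesis .
qed

lemma norm_Q0_E_le:
  assumes "0 \<le> x" "0 \<le> z" "0 < Re p"
  shows "norm (Q0 p * E x z p) \<le> (2 * \<gamma> * A / sqrt \<kappa>) * norm p powr - (1 + \<beta>)"
  using mult_mono'[OF norm_Q0_le[OF assms(3)] norm_E_le_1[OF assms]] by (simp add: norm_mult)

lemma decaying_Q0_E:
  assumes "0 \<le> x" "0 \<le> z"
  shows "decaying 1 (\<lambda>p. Q0 p * E x z p)"
proof (rule decayingI)
  show "(\<lambda>p. Q0 p * E x z p) holomorphic_on {p. 0 < Re p}"
    by (intro holomorphic_intros holomorphic_Q0 holomorphic_E)
  show "1 < 1 + \<beta>"
    using \<beta> by simp
  show "norm (Q0 p * E x z p) \<le> (2 * \<gamma> * A / sqrt \<kappa>) * norm p powr - (1 + \<beta>)" if "1 \<le> Re p" for p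
    using that by (intro norm_Q0_E_le assms) simp
qed

lemma poly_bounded_Q0: "poly_bounded Q0"
proof (rule poly_bounded_linear[OF holomorphic_Q0])
  fix p :: complex assume p: "1 \<le> Re p"
  then have "norm (Q0 p) \<le> (2 * \<gamma> * A / sqrt \<kappa>) * norm p powr - (1 + \<beta>)"
    by (intro norm_Q0_le) simp
  also have "\<dots> \<le> (2 * \<gamma> * A / sqrt \<kappa>) * norm p powr 1"
    using norm_ge_1[OF p] pos \<beta> \<kappa>_pos by (intro mult_left_mono powr_mono) auto
  finally show "norm (Q0 p) \<le> (2 * \<gamma> * A / sqrt \<kappa>) * norm p"
    using norm_ge_1[OF p] by simp
qed

section \<open>The solution as a Bromwich integral\<close>

lemma two_\<beta>: "0 < 2 * \<beta>" "2 * \<beta> < 1"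
  using \<beta> by auto

lemma line_integrable:
  assumes "poly_bounded Q" "0 < x" "0 \<le> z"
  shows "integrable lborel (\<lambda>\<omega>. Q (Complex 1 \<omega>) * E x z (Complex 1 \<omega>))"
  using decaying_integrable[OF decaying_poly_E[OF assms]] by simp

text \<open>\<open>B Q0\<close> is the candidate solution. For x > 0 its derivatives are again of
  this form, so the equations become identities between symbols.\<close>

definition B :: "(complex \<Rightarrow> complex) \<Rightarrow> real \<Rightarrow> real \<Rightarrow> real \<Rightarrow> real" where
  "B Q x z t = Re (bromwich 1 (\<lambda>p. Q p * E x z p) t)"

lemma B_cmult: "B (\<lambda>p. of_real c * Q p) x z t = c * B Q x z t"
  unfolding B_def using bromwich_cmult[of 1 "of_real c" "\<lambda>p. Q p * E x z p" t] by (simp add: mult.assoc)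

lemma B_add:
  assumes "poly_bounded Q1" "poly_bounded Q2" "0 < x" "0 \<le> z"
  shows "B (\<lambda>p. Q1 p + Q2 p) x z t = B Q1 x z t + B Q2 x z t"
  unfolding B_def distrib_right using assms by (subst bromwich_add) (auto intro: line_integrable)

lemma B_cong: "(\<And>p. 0 < Re p \<Longrightarrow> Q1 p = Q2 p) \<Longrightarrow> B Q1 x z t = B Q2 x z t"
  unfolding B_def by (intro arg_cong[of _ _ Re] bromwich_cong) simp

lemma B_derivative_x:
  assumes Q: "poly_bounded Q" and x: "0 < x" and z: "0 \<le> z"
  shows "((\<lambda>\<xi>. B Q \<xi> z t) has_real_derivative - B (\<lambda>p. (s p - of_real \<gamma>) * Q p) x z t) (at x)"
proof -
  define \<rho> where "\<rho> p = s p - of_real \<gamma>" for p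
  \<comment> \<open>Half of x stays in the symbol G, where it keeps the integrals convergent; the
    other half leaves x - y > 0 in the interior of the half-line, so the derivative is
    two-sided.\<close>
  define y where "y = x / 2"
  have y: "0 < y" "0 < x - y"
    using x by (auto simp: y_def)
  define G where "G p = Q p * E y z p" for p
  have E: "E \<xi> z p = E y z p * exp (- of_real (\<xi> - y) * \<rho> p)" for \<xi> p
    unfolding E_def \<rho>_def mult.commute[of "exp (- of_real y * _)"] mult.assoc exp_add[symmetric]
    by (simp add: algebra_simps)
  have G: "integrable lborel (\<lambda>\<omega>. G (Complex 1 \<omega>))"
    unfolding G_def using line_integrable[OF Q y(1) z] .
  have "poly_bounded (\<lambda>p. \<rho> p * Q p)"
    unfolding \<rho>_def by (intro poly_bounded_mult poly_bounded_symbols Q)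
  from line_integrable[OF this y(1) z]
  have \<rho>G: "integrable lborel (\<lambda>\<omega>. \<rho> (Complex 1 \<omega>) * G (Complex 1 \<omega>))"
    unfolding G_def by (simp only: mult.assoc)
  have "((\<lambda>\<zeta>. bromwich 1 (\<lambda>p. G p * exp (- of_real \<zeta> * \<rho> p)) t) has_vector_derivative
    - bromwich 1 (\<lambda>p. \<rho> p * (G p * exp (- of_real (x - y) * \<rho> p))) t) (at (x - y) within {0..})"
  proof (rule bromwich_exp_derivative[OF G \<rho>G])
    show "(\<lambda>\<omega>. \<rho> (Complex 1 \<omega>)) \<in> borel_measurable borel"
      unfolding \<rho>_def by (intro measurable_line holomorphic_on_imp_continuous_on holomorphic_intros holomorphic_s) simp
    show "0 \<le> Re (\<rho> (Complex 1 \<omega>))" for \<omega>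
      using Re_s_ge(1)[of "Complex 1 \<omega>"] by (simp add: \<rho>_def)
  qed (use y in simp)
  then have 1: "((\<lambda>\<zeta>. bromwich 1 (\<lambda>p. G p * exp (- of_real \<zeta> * \<rho> p)) t) has_vector_derivative
    - bromwich 1 (\<lambda>p. \<rho> p * (G p * exp (- of_real (x - y) * \<rho> p))) t) (at (x - y))"
    by (subst (asm) at_within_Ici[OF y(2)])
  have QE: "Q p * E \<xi> z p = G p * exp (- of_real (\<xi> - y) * \<rho> p)" for \<xi> p
    unfolding G_def E[of \<xi> p] mult.assoc ..
  have "((\<lambda>\<xi>. \<xi> - y) has_real_derivative 1) (at x)"
    by (auto intro!: derivative_eq_intros)
  then have "((\<lambda>\<xi>. \<xi> - y) has_vector_derivative 1) (at x)"
    by (simp add: has_real_derivative_iff_has_vector_derivative)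
  from has_real_derivative_Re[OF vector_diff_chain_at[OF this 1]] show ?thesis
    unfolding B_def o_def mult.assoc QE \<rho>_def[symmetric] by simp
qed

text \<open>The factor exp (-x (s - \<gamma>)) with x > 0 already ensures integrability, so the
  exponential in z can start from z = 0 and the one-sided derivative there is included.\<close>

lemma B_derivative_z:
  assumes Q: "poly_bounded Q" and x: "0 < x" and z: "0 \<le> z"
  shows "((\<lambda>\<zeta>. B Q x \<zeta> t) has_real_derivative - B (\<lambda>p. m p * Q p) x z t) (at z within {0..})"
proof -
  define G where "G p = Q p * E x 0 p" for p
  have E: "E x \<zeta> p = E x 0 p * exp (- of_real \<zeta> * m p)" for \<zeta> p
    unfolding E_def by simp
  have G: "integrable lborel (\<lambda>\<omega>. G (Complex 1 \<omega>))"
    unfolding G_def using line_integrable[OF Q x order.refl] .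
  have "poly_bounded (\<lambda>p. m p * Q p)"
    by (intro poly_bounded_mult poly_bounded_symbols Q)
  from line_integrable[OF this x order.refl]
  have mG: "integrable lborel (\<lambda>\<omega>. m (Complex 1 \<omega>) * G (Complex 1 \<omega>))"
    unfolding G_def by (simp only: mult.assoc)
  have "((\<lambda>\<zeta>. bromwich 1 (\<lambda>p. G p * exp (- of_real \<zeta> * m p)) t) has_vector_derivative
    - bromwich 1 (\<lambda>p. m p * (G p * exp (- of_real z * m p))) t) (at z within {0..})"
  proof (rule bromwich_exp_derivative[OF G mG])
    show "(\<lambda>\<omega>. m (Complex 1 \<omega>)) \<in> borel_measurable borel"
      by (intro measurable_line holomorphic_on_imp_continuous_on holomorphic_m) simp
  qed (use z Re_m_nonneg in simp_all)
  moreover have QE: "Q p * E x \<zeta> p = G p * exp (- of_real \<zeta> * m p)" for \<zeta> p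
    unfolding G_def E[of \<zeta> p] mult.assoc ..
  ultimately show ?thesis
    unfolding B_def mult.assoc QE by (auto dest: has_real_derivative_Re)
qed

lemma B_derivative_t:
  assumes Q: "poly_bounded Q" and x: "0 < x" and z: "0 \<le> z"
  shows "((\<lambda>t. B Q x z t) has_real_derivative B (\<lambda>p. p * Q p) x z t) (at t)"
proof -
  have "poly_bounded (\<lambda>p. p * Q p)"
    by (intro poly_bounded_mult poly_bounded_symbols Q)
  from line_integrable[OF this x z]
  have "integrable lborel (\<lambda>\<omega>. Complex 1 \<omega> * (Q (Complex 1 \<omega>) * E x z (Complex 1 \<omega>)))"
    by (simp only: mult.assoc)
  from has_real_derivative_Re[OF bromwich_time_derivative[of "\<lambda>p. Q p * E x z p", OF line_integrable[OF Q x z] this]]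
  show ?thesis
    unfolding B_def by (simp add: mult.assoc)
qed

text \<open>The Caputo derivative is the convolution of the time derivative, whose symbol is p Q E,
  with r^(-2 \<beta>) / Gamma (1 - 2 \<beta>), whose transform is p^(2 \<beta> - 1); the symbols
  multiply to P Q E.\<close>

lemma B_caputo:
  assumes Q: "poly_bounded Q" and x: "0 < x" and z: "0 \<le> z"
  shows "caputo_differentiable (2 * \<beta>) (B Q x z) t"
    and "caputo (2 * \<beta>) (B Q x z) t = B (\<lambda>p. P p * Q p) x z t"
proof -
  define \<delta> where "\<delta> = 2 * \<beta>"
  have \<delta>: "\<delta> < 1" "0 < Gamma (1 - \<delta>)"
    using \<beta> by (auto simp: \<delta>_def intro: Gamma_real_pos)
  have pQ: "poly_bounded (\<lambda>p. p * Q p)"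
    by (intro poly_bounded_mult poly_bounded_symbols Q)
  have deriv: "deriv (B Q x z) s = B (\<lambda>p. p * Q p) x z s" for s
    using B_derivative_t[OF Q x z] by (rule DERIV_imp_deriv)
  have diff: "B Q x z differentiable (at s)" for s
    using B_derivative_t[OF Q x z] real_differentiable_def by blast
  define G where "G p = p * Q p * E x z p" for p
  define f where "f s = indicator {0..t} s *\<^sub>R (B (\<lambda>p. p * Q p) x z s / (t - s) powr \<delta>)" for s
  have G: "decaying 1 G"
    unfolding G_def[abs_def] by (rule decaying_poly_E[OF pQ x z])
  have \<phi>: "set_integrable lborel {0..} (\<lambda>r. exp (- 1 * r) * r powr - \<delta>)"
    using laplace_powr_real(1)[OF \<delta>(1), of 1] by simp
  have \<Phi>: "(LBINT r:{0..}. exp (- Complex 1 \<omega> * of_real r) * complex_of_real (r powr - \<delta>)) =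
      (\<lambda>p. of_real (Gamma (1 - \<delta>)) * p powr of_real (\<delta> - 1)) (Complex 1 \<omega>)" for \<omega>
    using laplace_powr[OF \<delta>(1), of "Complex 1 \<omega>"] by simp
  note conv = convolution_bromwich[OF G zero_less_one \<phi> \<Phi>, of t]
  \<comment> \<open>The substitution s = t - r brings the integral from the form in
    \<open>caputo\<close> to the form in \<open>convolution_bromwich\<close>.\<close>
  have f_eq: "f (t + (-1) * r) = Re (indicator {0..t} r *\<^sub>R (bromwich 1 G (t - r) * of_real (r powr - \<delta>)))" for r
  proof -
    have "indicat_real {0..t} (t - r) = indicator {0..t} r"
      by (auto simp: indicator_def)
    then show ?thesis
      unfolding f_def B_def G_def by (simp add: powr_minus_divide)
  qed
  have "integrable lborel (\<lambda>r. f (t + (-1) * r))"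
    using conv(1) unfolding f_eq set_integrable_def by (rule integrable_Re)
  then have f_int: "integrable lborel f"
    by (subst (asm) lborel_integrable_real_affine_iff) auto
  then show "caputo_differentiable (2 * \<beta>) (B Q x z) t"
    unfolding caputo_less_one[OF two_\<beta>] deriv set_integrable_def f_def \<delta>_def using diff by simp
  have "(LBINT s:{0..t}. deriv (B Q x z) s / (t - s) powr \<delta>) = integral\<^sup>L lborel f"
    unfolding deriv set_lebesgue_integral_def f_def ..
  also have "\<dots> = (LBINT r. f (t + (-1) * r))"
    by (subst lborel_integral_real_affine[of "-1" f t]) auto
  also have "\<dots> = Re (LBINT r:{0..t}. bromwich 1 G (t - r) * of_real (r powr - \<delta>))"
    unfolding f_eq set_lebesgue_integral_def using conv(1) unfolding set_integrable_def by (rule integral_Re)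
  also have "\<dots> = Re (bromwich 1 (\<lambda>p. of_real (Gamma (1 - \<delta>)) * (P p * Q p * E x z p)) t)"
  proof -
    have P: "p * p powr of_real (\<delta> - 1) = P p" if "p \<noteq> 0" for p
      using that unfolding P_def \<delta>_def by (simp add: powr_diff)
    show ?thesis
      unfolding conv(2)
    proof (intro arg_cong[of _ _ Re] bromwich_cong)
      fix \<omega>
      define p where "p = Complex 1 \<omega>"
      have "p \<noteq> 0"
        by (simp add: p_def complex_eq_iff)
      have "G p * (of_real (Gamma (1 - \<delta>)) * p powr of_real (\<delta> - 1)) =
          of_real (Gamma (1 - \<delta>)) * ((p * p powr of_real (\<delta> - 1)) * Q p * E x z p)"
        unfolding G_def by (simp only: mult_ac)
      then show "G p * (of_real (Gamma (1 - \<delta>)) * p powr of_real (\<delta> - 1)) =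
          of_real (Gamma (1 - \<delta>)) * (P p * Q p * E x z p)"
        unfolding P[OF \<open>p \<noteq> 0\<close>] .
    qed
  qed
  also have "\<dots> = Gamma (1 - \<delta>) * B (\<lambda>p. P p * Q p) x z t"
    unfolding bromwich_cmult B_def by simp
  finally have "(LBINT s:{0..t}. deriv (B Q x z) s / (t - s) powr (2 * \<beta>)) = Gamma (1 - 2 * \<beta>) * B (\<lambda>p. P p * Q p) x z t"
    unfolding \<delta>_def .
  moreover have "Gamma (1 - 2 * \<beta>) \<noteq> 0"
    using \<delta>(2) unfolding \<delta>_def by linarith
  ultimately show "caputo (2 * \<beta>) (B Q x z) t = B (\<lambda>p. P p * Q p) x z t"
    unfolding caputo_less_one[OF two_\<beta>] by simp
qed

section \<open>Continuity and decay of the candidate\<close>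

lemma continuous_on_B_Q0:
  "continuous_on ({0..} \<times> {0..} \<times> UNIV) (\<lambda>(x, z, t). B Q0 x z t)"
proof -
  define h where "h = (\<lambda>(x, z, t) \<omega>. exp (of_real t * Complex 0 \<omega>) * (Q0 (Complex 1 \<omega>) * E x z (Complex 1 \<omega>)))"
  have int: "continuous_on ({0..} \<times> {0..} \<times> UNIV) (\<lambda>y. integral\<^sup>L lborel (h y))"
  proof (rule continuous_on_integral_dominated)
    show "h y \<in> borel_measurable lborel" if y: "y \<in> {0..} \<times> {0..} \<times> UNIV" for y
    proof -
      obtain x z t where xzt: "y = (x, z, t)" "0 \<le> x" "0 \<le> z"
        using y by auto
      note [measurable] = borel_measurable_integrable[OF decaying_integrable[OF decaying_Q0_E[OF xzt(2,3)] zero_less_one]]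
      show ?thesis
        unfolding h_def xzt(1) prod.case by measurable
    qed
    show "continuous_on ({0..} \<times> {0..} \<times> UNIV) (\<lambda>y. h y \<omega>)" for \<omega>
      unfolding h_def split_def E_def by (intro continuous_intros)
    show "integrable lborel (\<lambda>\<omega>. (2 * \<gamma> * A / sqrt \<kappa>) * norm (Complex 1 \<omega>) powr - (1 + \<beta>))"
      using \<beta> by (intro integrable_mult_right integrable_norm_line) auto
    show "norm (h y \<omega>) \<le> (2 * \<gamma> * A / sqrt \<kappa>) * norm (Complex 1 \<omega>) powr - (1 + \<beta>)"
      if "y \<in> {0..} \<times> {0..} \<times> UNIV" for y \<omega>
      using that norm_Q0_E_le[of "fst y" "fst (snd y)" "Complex 1 \<omega>"]
      unfolding h_def split_def norm_mult[of "exp _"] norm_exp_line by auto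
  qed
  have "(\<lambda>(x, z, t). B Q0 x z t) = (\<lambda>y. Re (exp (of_real (snd (snd y))) * integral\<^sup>L lborel (h y) / of_real (2 * pi)))"
    unfolding B_def bromwich_factor h_def by (auto simp: fun_eq_iff)
  moreover have "continuous_on ({0..} \<times> {0..} \<times> UNIV)
      (\<lambda>y. Re (exp (of_real (snd (snd y))) * integral\<^sup>L lborel (h y) / of_real (2 * pi)))"
    by (intro continuous_intros int) auto
  ultimately show ?thesis
    by simp
qed

lemma B_Q0_exp_decay:
  obtains K c where "0 < K" "0 < c"
    "\<And>x z t. 0 \<le> x \<Longrightarrow> 0 \<le> z \<Longrightarrow> \<bar>B Q0 x z t\<bar> \<le> K * exp t * exp (- c * (x + z))"
proof -
  obtain c where c: "0 < c" "\<And>p. 1 \<le> Re p \<Longrightarrow> c \<le> Re (m p)" "\<And>p. 1 \<le> Re p \<Longrightarrow> c \<le> Re (s p - of_real \<gamma>)"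
    using Re_line_gap by metis
  define N where "N \<omega> = (2 * \<gamma> * A / sqrt \<kappa>) * norm (Complex 1 \<omega>) powr - (1 + \<beta>)" for \<omega>
  have N: "integrable lborel N"
    unfolding N_def using \<beta> by (intro integrable_mult_right integrable_norm_line) auto
  define K where "K = \<bar>integral\<^sup>L lborel N\<bar> / (2 * pi) + 1"
  have bound: "\<bar>B Q0 x z t\<bar> \<le> K * exp t * exp (- c * (x + z))" if "0 \<le> x" "0 \<le> z" for x z t
  proof -
    have dec: "integrable lborel (\<lambda>\<omega>. Q0 (Complex 1 \<omega>) * E x z (Complex 1 \<omega>))"
      using decaying_integrable[OF decaying_Q0_E[OF that]] by simp
    have "norm (Q0 (Complex 1 \<omega>) * E x z (Complex 1 \<omega>)) \<le> N \<omega> * exp (- c * (x + z))" for \<omega>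
    proof -
      have "c * x \<le> x * Re (s (Complex 1 \<omega>) - of_real \<gamma>)" "c * z \<le> z * Re (m (Complex 1 \<omega>))"
      proof -
        have c': "c \<le> Re (s (Complex 1 \<omega>) - of_real \<gamma>)" "c \<le> Re (m (Complex 1 \<omega>))"
          by (rule c(3), simp) (rule c(2), simp)
        show "c * x \<le> x * Re (s (Complex 1 \<omega>) - of_real \<gamma>)" "c * z \<le> z * Re (m (Complex 1 \<omega>))"
          using mult_right_mono[OF c'(1) that(1)] mult_right_mono[OF c'(2) that(2)] by (simp_all only: mult.commute)
      qed
      then have "norm (E x z (Complex 1 \<omega>)) \<le> exp (- (c * x)) * exp (- (c * z))"
        unfolding E_def norm_mult by (intro mult_mono) auto
      also have "\<dots> = exp (- c * (x + z))"
        unfolding exp_add[symmetric] by (simp add: algebra_simps)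
      finally have "norm (E x z (Complex 1 \<omega>)) \<le> exp (- c * (x + z))" .
      with norm_Q0_le show ?thesis
        unfolding norm_mult N_def by (rule mult_mono') simp_all
    qed
    then have "(LBINT \<omega>. norm (Q0 (Complex 1 \<omega>) * E x z (Complex 1 \<omega>))) \<le> (LBINT \<omega>. N \<omega> * exp (- c * (x + z)))"
      using dec N by (intro integral_mono) auto
    also have "\<dots> \<le> \<bar>integral\<^sup>L lborel N\<bar> * exp (- c * (x + z))"
      by (simp add: mult_right_mono)
    finally have "(LBINT \<omega>. norm (Q0 (Complex 1 \<omega>) * E x z (Complex 1 \<omega>))) / (2 * pi)
        \<le> \<bar>integral\<^sup>L lborel N\<bar> * exp (- c * (x + z)) / (2 * pi)"
      by (intro divide_right_mono) auto
    also have "\<dots> \<le> K * exp (- c * (x + z))"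
      unfolding K_def by (simp add: distrib_right)
    finally have "exp (1 * t) * ((LBINT \<omega>. norm (Q0 (Complex 1 \<omega>) * E x z (Complex 1 \<omega>))) / (2 * pi))
        \<le> exp (1 * t) * (K * exp (- c * (x + z)))"
      by (intro mult_left_mono) auto
    then have "norm (bromwich 1 (\<lambda>p. Q0 p * E x z p) t) \<le> exp (1 * t) * (K * exp (- c * (x + z)))"
      using norm_bromwich_le[OF dec, of t] by linarith
    then show ?thesis
      unfolding B_def using abs_Re_le_cmod[of "bromwich 1 (\<lambda>p. Q0 p * E x z p) t"] by (simp add: mult_ac)
  qed
  have "0 < K"
    unfolding K_def by (simp add: add_nonneg_pos)
  then show thesis
    using c(1) bound that by blast
qed

lemma B_Q0_decay:
  assumes "0 < \<epsilon>"
  shows "\<exists>R. \<forall>x\<ge>0. \<forall>z\<ge>0. \<forall>t\<in>{0..T}. x\<^sup>2 + z\<^sup>2 > R \<longrightarrow> \<bar>B Q0 x z t\<bar> < \<epsilon>"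
proof -
  obtain K c where K: "0 < K" "0 < c"
    "\<And>x z t. 0 \<le> x \<Longrightarrow> 0 \<le> z \<Longrightarrow> \<bar>B Q0 x z t\<bar> \<le> K * exp t * exp (- c * (x + z))"
    using B_Q0_exp_decay by metis
  have "((\<lambda>r. K * exp T * exp (- c * r)) \<longlongrightarrow> 0) at_top"
    using K by real_asymp
  then have "\<forall>\<^sub>F r in at_top. K * exp T * exp (- c * r) < \<epsilon>"
    using assms by (rule order_tendstoD)
  then obtain r where r: "\<And>y. r \<le> y \<Longrightarrow> K * exp T * exp (- c * y) < \<epsilon>"
    unfolding eventually_at_top_linorder by blast
  show ?thesis
  proof (intro exI[of _ "r\<^sup>2"] allI impI ballI)
    fix x z t :: real assume xz: "0 \<le> x" "0 \<le> z" and t: "t \<in> {0..T}" and gt: "r\<^sup>2 < x\<^sup>2 + z\<^sup>2"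
    have "x\<^sup>2 + z\<^sup>2 \<le> (x + z)\<^sup>2"
      using xz by (simp add: power2_sum)
    then have "r\<^sup>2 \<le> (x + z)\<^sup>2"
      using gt by linarith
    then have "r \<le> x + z"
      by (rule power2_le_imp_le) (use xz in simp)
    then have "K * exp T * exp (- c * (x + z)) < \<epsilon>"
      by (rule r)
    moreover have "K * exp t * exp (- c * (x + z)) \<le> K * exp T * exp (- c * (x + z))"
      using t K by (intro mult_right_mono mult_left_mono) auto
    ultimately show "\<bar>B Q0 x z t\<bar> < \<epsilon>"
      using order_trans[OF K(3)[OF xz]] by (meson order_le_less_trans)
  qed
qed

text \<open>R and s are bounded away from 0 by \<mu> and \<gamma>, so the chain rule leaves only the
  growth |p|^(2 \<beta> - 1) of the derivative of P. This bound makes the differentiated symbol at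
  the corner integrable.\<close>

lemma s_derivative:
  obtains s' C where "\<And>p. 0 < Re p \<Longrightarrow> (s has_field_derivative s' p) (at p)"
    "\<And>p. 0 < Re p \<Longrightarrow> norm (s' p) \<le> C * norm p powr (2 * \<beta> - 1)"
proof -
  define P' where "P' p = of_real (2 * \<beta>) * p powr (of_real (2 * \<beta>) - 1)" for p :: complex
  define R' where "R' p = inverse (2 * R p) * P' p" for p
  define s' where "s' p = inverse (2 * s p) * (P' p + of_real (\<alpha> / a) * R' p)" for p
  define C where "C = (2 * \<beta> + \<alpha> / a * (2 * \<beta> / (2 * \<mu>))) / (2 * \<gamma>)"
  have nonpos: "w \<notin> \<real>\<^sub>\<le>\<^sub>0" if "0 < Re w" for w
    using that by (auto simp: complex_nonpos_Reals_iff)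
  have inv: "norm (inverse (2 * w)) \<le> 1 / (2 * c)" if "0 < c" "c \<le> norm w" for w :: complex and c
  proof -
    have "inverse (2 * norm w) \<le> inverse (2 * c)"
      using that by (intro le_imp_inverse_le) auto
    moreover have "norm (inverse (2 * w)) = inverse (2 * norm w)"
      by (simp only: norm_inverse norm_mult norm_numeral)
    moreover have "inverse (2 * c) = 1 / (2 * c)"
      by (rule inverse_eq_divide)
    ultimately show ?thesis
      by linarith
  qed
  show thesis
  proof (rule that)
    fix p assume p: "0 < Re p"
    have dP: "(P has_field_derivative P' p) (at p)"
      unfolding P_def[abs_def] P'_def by (rule has_field_derivative_powr[OF nonpos[OF p]])
    have "0 < Re (P p + of_real (lam\<^sup>2 / (4 * a\<^sup>2)))"
      using Re_P_pos[OF p] unfolding \<mu>2 by (simp add: add_pos_nonneg)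
    from has_field_derivative_csqrt[OF nonpos[OF this]]
    have "(csqrt has_field_derivative inverse (2 * R p)) (at (P p + of_real (lam\<^sup>2 / (4 * a\<^sup>2))))"
      unfolding R_def .
    from DERIV_chain2[OF this DERIV_add[OF dP DERIV_const]]
    have dR: "(R has_field_derivative R' p) (at p)"
      unfolding R_def[abs_def] R'_def by simp
    have "((\<lambda>p. P p + of_real (\<alpha> / a) * (R p - of_real \<mu>) + of_real (\<gamma>\<^sup>2)) has_field_derivative
        P' p + of_real (\<alpha> / a) * (R' p - 0) + 0) (at p)"
      by (intro DERIV_add DERIV_cmult DERIV_diff DERIV_const dP dR)
    then have dq: "((\<lambda>p. P p + of_real \<alpha> * m p + of_real (\<gamma>\<^sup>2)) has_field_derivative
        P' p + of_real (\<alpha> / a) * R' p) (at p)"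
      unfolding m_def by simp
    have "0 < Re (P p + of_real \<alpha> * m p + of_real (\<gamma>\<^sup>2))"
      using Re_q_pos[OF p] by (simp add: add_pos_nonneg)
    from has_field_derivative_csqrt[OF nonpos[OF this]]
    have "(csqrt has_field_derivative inverse (2 * s p)) (at (P p + of_real \<alpha> * m p + of_real (\<gamma>\<^sup>2)))"
      unfolding s_def .
    from DERIV_chain2[OF this dq]
    show "(s has_field_derivative s' p) (at p)"
      unfolding s_def[abs_def] s'_def[unfolded s_def] by simp
    define r where "r = norm p powr (2 * \<beta> - 1)"
    have r: "0 \<le> r"
      by (simp add: r_def)
    have "norm (p powr of_real (2 * \<beta> - 1)) = r"
      unfolding r_def using p by (intro norm_powr_of_real) auto
    then have nP: "norm (P' p) = 2 * \<beta> * r"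
      unfolding P'_def using \<beta> by (simp add: norm_mult)
    have "\<mu> \<le> norm (R p)" "\<gamma> \<le> norm (s p)"
      using Re_R_ge(1)[OF p] Re_s_ge(1)[OF p] complex_Re_le_cmod[of "R p"] complex_Re_le_cmod[of "s p"] by linarith+
    then have iR: "norm (inverse (2 * R p)) \<le> 1 / (2 * \<mu>)" and i_s: "norm (inverse (2 * s p)) \<le> 1 / (2 * \<gamma>)"
      using \<mu>_pos pos inv by blast+
    have nR: "norm (R' p) \<le> 1 / (2 * \<mu>) * (2 * \<beta> * r)"
      unfolding R'_def norm_mult nP using iR r \<beta> by (intro mult_right_mono) auto
    have "norm (P' p + of_real (\<alpha> / a) * R' p) \<le> norm (P' p) + norm (of_real (\<alpha> / a) * R' p)"
      by (rule norm_triangle_ineq)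
    also have "norm (of_real (\<alpha> / a) * R' p) = \<alpha> / a * norm (R' p)"
      unfolding norm_mult norm_of_real using pos by simp
    also have "norm (P' p) + \<alpha> / a * norm (R' p) \<le> 2 * \<beta> * r + \<alpha> / a * (1 / (2 * \<mu>) * (2 * \<beta> * r))"
      unfolding nP using nR pos by (intro add_left_mono mult_left_mono) auto
    finally have "norm (s' p) \<le> 1 / (2 * \<gamma>) * (2 * \<beta> * r + \<alpha> / a * (1 / (2 * \<mu>) * (2 * \<beta> * r)))"
      unfolding s'_def norm_mult[of "inverse _"] using i_s pos by (intro mult_mono) auto
    also have "\<dots> = C * r"
      unfolding C_def by (simp add: distrib_left distrib_right add_divide_distrib mult_ac)
    finally show "norm (s' p) \<le> C * norm p powr (2 * \<beta> - 1)"
      unfolding r_def .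
  qed
qed

text \<open>Letting x tend to 0 formally leaves 1 / p, the transform of 1, but there is no
  integrable majorant. After multiplication by t the symbol is -d/dp (E / p), which on Re p = 1 is
  O(|p|^(2 \<beta> - 2)) uniformly for 0 < x < 1, and its limit 1 / p^2 is the transform of
  t.\<close>

lemma boundary_kernel_limit:
  assumes t: "0 < t"
  shows "((\<lambda>x. B (\<lambda>p. 1 / p) x 0 t) \<longlongrightarrow> 1) (at_right 0)"
proof -
  obtain s' C where s': "\<And>p. 0 < Re p \<Longrightarrow> (s has_field_derivative s' p) (at p)"
    and C: "\<And>p. 0 < Re p \<Longrightarrow> norm (s' p) \<le> C * norm p powr (2 * \<beta> - 1)"
    using s_derivative by metis
  define D where "D x p = - (of_real x * s' p) * E x 0 p / p - E x 0 p / p\<^sup>2" for x p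
  have dec: "decaying 1 (\<lambda>p. 1 / p * E x 0 p)" if "0 < x" for x
    using poly_bounded_inverse that by (rule decaying_poly_E) simp
  have D: "((\<lambda>p. 1 / p * E x 0 p) has_field_derivative D x p) (at p)" if p: "0 < Re p" for x p
  proof -
    have p0: "p \<noteq> 0"
      using p by auto
    have 1: "(E x 0 has_field_derivative - of_real x * s' p * E x 0 p) (at p)"
      unfolding E_def[abs_def] by (auto intro!: derivative_eq_intros s'[OF p])
    have 2: "((\<lambda>p. 1 / p) has_field_derivative - (1 / p\<^sup>2)) (at p)"
      using p0 by (auto intro!: derivative_eq_intros simp: power2_eq_square)
    from DERIV_mult[OF 2 1] show ?thesis
      by (rule DERIV_cong) (use p0 in \<open>simp add: D_def field_simps power2_eq_square\<close>)
  qed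
  \<comment> \<open>The first term bounds x s' E / p, where |s'| is of order |p|^(2 \<beta> - 1);
    its exponent 2 - 2 \<beta> exceeds 1 exactly because \<beta> < 1/2.\<close>
  define N where "N \<omega> = C * norm (Complex 1 \<omega>) powr - (2 - 2 * \<beta>) + norm (Complex 1 \<omega>) powr - 2" for \<omega>
  have N: "integrable lborel N"
    unfolding N_def using \<beta>
    by (intro Bochner_Integration.integrable_add integrable_mult_right integrable_norm_line) auto
  have D_le: "norm (D x (Complex 1 \<omega>)) \<le> N \<omega>" if x: "x \<in> {0<..<1}" for x \<omega>
  proof -
    define p where "p = Complex 1 \<omega>"
    have p: "0 < Re p"
      by (simp add: p_def)
    then have np: "0 < norm p"
      by auto
    have E1: "norm (E x 0 p) \<le> 1"
      using x p by (intro norm_E_le_1) auto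
    have "norm (- (of_real x * s' p) * E x 0 p / p) = x * norm (s' p) * norm (E x 0 p) / norm p"
      using x by (simp add: norm_mult norm_divide)
    also have "\<dots> \<le> 1 * (C * norm p powr (2 * \<beta> - 1)) * 1 / norm p"
      using x C[OF p] E1 np by (intro divide_right_mono mult_mono) (auto intro: order_trans[OF norm_ge_zero])
    also have "\<dots> = C * norm p powr - (2 - 2 * \<beta>)"
    proof -
      have "norm p powr - (2 - 2 * \<beta>) = norm p powr ((2 * \<beta> - 1) - 1)"
        by (simp add: algebra_simps)
      also have "\<dots> = norm p powr (2 * \<beta> - 1) / norm p"
        unfolding powr_diff using np by simp
      finally show ?thesis
        by simp
    qed
    finally have a: "norm (- (of_real x * s' p) * E x 0 p / p) \<le> C * norm p powr - (2 - 2 * \<beta>)" .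
    have "norm (E x 0 p / p\<^sup>2) \<le> 1 / (norm p)\<^sup>2"
      unfolding norm_divide norm_power using E1 by (intro divide_right_mono) auto
    also have "\<dots> = norm p powr - 2"
      using np by (simp add: powr_minus_divide)
    finally have b: "norm (E x 0 p / p\<^sup>2) \<le> norm p powr - 2" .
    show ?thesis
      unfolding D_def N_def p_def[symmetric] using a b norm_triangle_ineq4[of "- (of_real x * s' p) * E x 0 p / p" "E x 0 p / p\<^sup>2"]
      by linarith
  qed
  have cont_D: "(\<lambda>\<omega>. D x (Complex 1 \<omega>)) \<in> borel_measurable borel" if "0 < x" for x
  proof (rule measurable_line)
    define H where "H p = 1 / p * E x 0 p" for p
    have hol: "H holomorphic_on {p. 0 < Re p}"
      using dec[OF that] unfolding decaying_def H_def by blast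
    have "deriv H holomorphic_on {p. 0 < Re p}"
      by (rule holomorphic_deriv[OF hol open_halfspace_Re_gt])
    then have "continuous_on {p. 0 < Re p} (deriv H)"
      by (rule holomorphic_on_imp_continuous_on)
    moreover have "deriv H p = D x p" if "p \<in> {p. 0 < Re p}" for p
      using D[of p x] that unfolding H_def by (intro DERIV_imp_deriv) simp
    ultimately show "continuous_on {p. 0 < Re p} (D x)"
      by (rule continuous_on_eq)
  qed simp
  have D_int: "integrable lborel (\<lambda>\<omega>. D x (Complex 1 \<omega>))" if "x \<in> {0<..<1}" for x
    using D_le[OF that] cont_D[of x] that
    by (intro Bochner_Integration.integrable_bound[OF N]) (auto intro: order_trans[OF _ abs_ge_self])
  have key: "t * B (\<lambda>p. 1 / p) x 0 t = - Re (bromwich 1 (D x) t)" if "x \<in> {0<..<1}" for x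
  proof -
    have "Re (of_real t * bromwich 1 (\<lambda>p. 1 / p * E x 0 p) t) = Re (- bromwich 1 (D x) t)"
      using bromwich_mult_time[OF dec D D_int[OF that], of t] that by simp
    then show ?thesis
      unfolding B_def by simp
  qed
  have lim: "((\<lambda>x. LBINT \<omega>. exp (of_real t * Complex 1 \<omega>) * D x (Complex 1 \<omega>)) \<longlongrightarrow>
      (LBINT \<omega>. exp (of_real t * Complex 1 \<omega>) * (- (1 / (Complex 1 \<omega>)\<^sup>2)))) (at 0 within {0<..<1})"
  proof (rule tendsto_integral_dominated)
    show "(\<lambda>\<omega>. exp (of_real t * Complex 1 \<omega>) * D x (Complex 1 \<omega>)) \<in> borel_measurable lborel" if "x \<in> {0<..<1}" for x
      using borel_measurable_integrable[OF integrable_bromwich[OF D_int[OF that]]] .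
    show "(\<lambda>\<omega>. exp (of_real t * Complex 1 \<omega>) * (- (1 / (Complex 1 \<omega>)\<^sup>2))) \<in> borel_measurable lborel"
      unfolding Complex_eq by measurable
    show "integrable lborel (\<lambda>\<omega>. exp (1 * t) * N \<omega>)"
      using N by (rule integrable_mult_right)
    show "norm (exp (of_real t * Complex 1 \<omega>) * D x (Complex 1 \<omega>)) \<le> exp (1 * t) * N \<omega>" if "x \<in> {0<..<1}" for x \<omega>
      unfolding norm_mult norm_exp_line using D_le[OF that] by (intro mult_left_mono) auto
    show "((\<lambda>x. exp (of_real t * Complex 1 \<omega>) * D x (Complex 1 \<omega>)) \<longlongrightarrow>
        exp (of_real t * Complex 1 \<omega>) * (- (1 / (Complex 1 \<omega>)\<^sup>2))) (at 0 within {0<..<1})" for \<omega>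
    proof -
      define p where "p = Complex 1 \<omega>"
      have "p \<noteq> 0"
        by (auto simp: p_def complex_eq_iff)
      have e: "((\<lambda>x. E x 0 p) \<longlongrightarrow> exp (- of_real 0 * (s p - of_real \<gamma>)) * exp (- of_real 0 * m p)) (at 0 within {0<..<1})"
        unfolding E_def by (intro tendsto_intros)
      have "((\<lambda>x. D x p) \<longlongrightarrow> - (of_real 0 * s' p) * (exp (- of_real 0 * (s p - of_real \<gamma>)) * exp (- of_real 0 * m p)) / p
          - (exp (- of_real 0 * (s p - of_real \<gamma>)) * exp (- of_real 0 * m p)) / p\<^sup>2) (at 0 within {0<..<1})"
        unfolding D_def using \<open>p \<noteq> 0\<close> by (intro tendsto_intros e) auto
      then have "((\<lambda>x. D x p) \<longlongrightarrow> - (1 / p\<^sup>2)) (at 0 within {0<..<1})"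
        by simp
      then show ?thesis
        unfolding p_def by (rule tendsto_mult_left)
    qed
  qed
  have "((\<lambda>x. - Re ((LBINT \<omega>. exp (of_real t * Complex 1 \<omega>) * D x (Complex 1 \<omega>)) / of_real (2 * pi)) / t) \<longlongrightarrow>
      - Re ((LBINT \<omega>. exp (of_real t * Complex 1 \<omega>) * (- (1 / (Complex 1 \<omega>)\<^sup>2))) / of_real (2 * pi)) / t) (at 0 within {0<..<1})"
    using t by (intro tendsto_intros lim) auto
  also have "- Re ((LBINT \<omega>. exp (of_real t * Complex 1 \<omega>) * (- (1 / (Complex 1 \<omega>)\<^sup>2))) / of_real (2 * pi)) / t = 1"
    using bromwich_inverse_square[OF t] t unfolding bromwich_def by simp
  finally have "((\<lambda>x. - Re (bromwich 1 (D x) t) / t) \<longlongrightarrow> 1) (at 0 within {0<..<1})"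
    unfolding bromwich_def .
  moreover have "\<forall>\<^sub>F x in at 0 within {0<..<1}. - Re (bromwich 1 (D x) t) / t = B (\<lambda>p. 1 / p) x 0 t"
    unfolding eventually_at_filter using key t by (intro always_eventually) (auto simp: field_simps)
  ultimately have "((\<lambda>x. B (\<lambda>p. 1 / p) x 0 t) \<longlongrightarrow> 1) (at 0 within {0<..<1})"
    by (rule Lim_transform_eventually)
  moreover have "at 0 within {0<..<1} = at_right (0::real)"
    by (rule at_within_nhd[of 0 "{-1<..<1}"]) auto
  ultimately show ?thesis
    by simp
qed

section \<open>Verification of the boundary value problem\<close>

lemma lumped_solution_B_Q0: "lumped_solution \<beta> a lam A \<gamma> \<alpha> (B Q0)"
proof -
  define \<rho> where "\<rho> p = s p - of_real \<gamma>" for p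
  note Q = poly_bounded_Q0
  have mQ: "poly_bounded (\<lambda>p. m p * Q0 p)" and \<rho>Q: "poly_bounded (\<lambda>p. \<rho> p * Q0 p)"
    unfolding \<rho>_def by (intro poly_bounded_mult poly_bounded_symbols Q)+
  have mmQ: "poly_bounded (\<lambda>p. m p * (m p * Q0 p))" and \<rho>\<rho>Q: "poly_bounded (\<lambda>p. \<rho> p * (\<rho> p * Q0 p))"
    unfolding \<rho>_def by (intro poly_bounded_mult poly_bounded_symbols Q)+
  have const: "poly_bounded (\<lambda>p. of_real c)" for c
    by (rule poly_bounded_linear[of _ "\<bar>c\<bar>"]) (auto intro: holomorphic_intros simp: le_mult_norm)
  have dz: "((\<lambda>\<zeta>. B R x \<zeta> t) has_real_derivative - B (\<lambda>p. m p * R p) x z t) (at z)"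
    if "poly_bounded R" "0 < x" "0 < z" for R x z t
    using B_derivative_z[OF that(1,2) less_imp_le[OF that(3)], of t] unfolding at_within_Ici[OF that(3)] .
  have dx: "((\<lambda>\<xi>. B R \<xi> z t) has_real_derivative - B (\<lambda>p. \<rho> p * R p) x z t) (at x)"
    if "poly_bounded R" "0 < x" "0 \<le> z" for R x z t
    using B_derivative_x[OF that, of t] unfolding \<rho>_def .
  have dzz: "(deriv (\<lambda>\<zeta>. B Q0 x \<zeta> t) has_real_derivative B (\<lambda>p. m p * (m p * Q0 p)) x z t) (at z)"
    if xz: "0 < x" "0 < z" for x z t
  proof (rule has_field_derivative_transform_within_open)
    show "((\<lambda>\<zeta>. - B (\<lambda>p. m p * Q0 p) x \<zeta> t) has_real_derivative B (\<lambda>p. m p * (m p * Q0 p)) x z t) (at z)"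
      using DERIV_minus[OF dz[OF mQ xz, of t]] by simp
    show "- B (\<lambda>p. m p * Q0 p) x \<zeta> t = deriv (\<lambda>\<zeta>. B Q0 x \<zeta> t) \<zeta>" if "\<zeta> \<in> {0<..}" for \<zeta>
      using dz[OF Q xz(1), of \<zeta> t] that by (simp add: DERIV_imp_deriv)
  qed (use xz in auto)
  have dxx: "(deriv (\<lambda>\<xi>. B Q0 \<xi> 0 t) has_real_derivative B (\<lambda>p. \<rho> p * (\<rho> p * Q0 p)) x 0 t) (at x)"
    if x: "0 < x" for x t
  proof (rule has_field_derivative_transform_within_open)
    show "((\<lambda>\<xi>. - B (\<lambda>p. \<rho> p * Q0 p) \<xi> 0 t) has_real_derivative B (\<lambda>p. \<rho> p * (\<rho> p * Q0 p)) x 0 t) (at x)"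
      using DERIV_minus[OF dx[OF \<rho>Q x order.refl, of t]] by simp
    show "- B (\<lambda>p. \<rho> p * Q0 p) \<xi> 0 t = deriv (\<lambda>\<xi>. B Q0 \<xi> 0 t) \<xi>" if "\<xi> \<in> {0<..}" for \<xi>
      using dx[OF Q, of \<xi> 0 t] that by (simp add: DERIV_imp_deriv)
  qed (use x in auto)
  have cont: "continuous_on ({0..} \<times> {0..} \<times> {0..}) (\<lambda>(x, z, t). B Q0 x z t)"
    by (rule continuous_on_subset[OF continuous_on_B_Q0]) auto
  show ?thesis
    unfolding lumped_solution_def
  proof (intro conjI allI impI)
    show "continuous_on ({0..} \<times> {0..} \<times> {0..}) (\<lambda>(x, z, t). B Q0 x z t)"
      by (rule cont)
  next
    fix x z t :: real assume xzt: "0 < x" "0 < z" "0 < t"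
    have z: "0 \<le> z"
      using xzt by simp
    show "caputo_differentiable (2 * \<beta>) (\<lambda>s. B Q0 x z s) t"
      by (rule B_caputo(1)[OF Q xzt(1) z])
    show "(\<lambda>\<zeta>. B Q0 x \<zeta> t) differentiable at z"
      using dz[OF Q xzt(1,2), of t] real_differentiable_def by blast
    show "deriv (\<lambda>\<zeta>. B Q0 x \<zeta> t) differentiable at z"
      using dzz[OF xzt(1,2), of t] real_differentiable_def by blast
    have "B (\<lambda>p. P p * Q0 p) x z t = B (\<lambda>p. of_real (a\<^sup>2) * (m p * (m p * Q0 p)) + of_real lam * (m p * Q0 p)) x z t"
      by (rule B_cong) (simp add: m_eq[symmetric] algebra_simps power2_eq_square)
    also have "\<dots> = a\<^sup>2 * B (\<lambda>p. m p * (m p * Q0 p)) x z t + lam * B (\<lambda>p. m p * Q0 p) x z t"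
      by (subst B_add[OF poly_bounded_mult[OF const mmQ] poly_bounded_mult[OF const mQ] xzt(1) z]) (simp only: B_cmult)
    finally show "caputo (2 * \<beta>) (\<lambda>s. B Q0 x z s) t =
        a\<^sup>2 * deriv (deriv (\<lambda>\<zeta>. B Q0 x \<zeta> t)) z - lam * deriv (\<lambda>\<zeta>. B Q0 x \<zeta> t) z"
      unfolding B_caputo(2)[OF Q xzt(1) z] DERIV_imp_deriv[OF dz[OF Q xzt(1,2)]] DERIV_imp_deriv[OF dzz[OF xzt(1,2)]] by simp
  next
    fix x t :: real assume xt: "0 < x" "0 < t"
    show "caputo_differentiable (2 * \<beta>) (\<lambda>s. B Q0 x 0 s) t"
      by (rule B_caputo(1)[OF Q xt(1) order.refl])
    show "(\<lambda>\<xi>. B Q0 \<xi> 0 t) differentiable at x"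
      using dx[OF Q xt(1) order.refl, of t] real_differentiable_def by blast
    show "deriv (\<lambda>\<xi>. B Q0 \<xi> 0 t) differentiable at x"
      using dxx[OF xt(1), of t] real_differentiable_def by blast
    have P: "P p * Q0 p = (\<rho> p * (\<rho> p * Q0 p) + of_real (2 * \<gamma>) * (\<rho> p * Q0 p)) + of_real (- \<alpha>) * (m p * Q0 p)" for p
    proof -
      have "P p = \<rho> p * (\<rho> p + 2 * of_real \<gamma>) - of_real \<alpha> * m p"
        using s_eq[of p] by (simp add: \<rho>_def algebra_simps)
      then show ?thesis
        by (simp only:) (simp add: algebra_simps)
    qed
    have "B (\<lambda>p. P p * Q0 p) x 0 t = B (\<lambda>p. \<rho> p * (\<rho> p * Q0 p) + of_real (2 * \<gamma>) * (\<rho> p * Q0 p)) x 0 t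
        + B (\<lambda>p. of_real (- \<alpha>) * (m p * Q0 p)) x 0 t"
    proof -
      have "B (\<lambda>p. \<rho> p * (\<rho> p * Q0 p) + of_real (2 * \<gamma>) * (\<rho> p * Q0 p) + of_real (- \<alpha>) * (m p * Q0 p)) x 0 t =
          B (\<lambda>p. \<rho> p * (\<rho> p * Q0 p) + of_real (2 * \<gamma>) * (\<rho> p * Q0 p)) x 0 t + B (\<lambda>p. of_real (- \<alpha>) * (m p * Q0 p)) x 0 t"
      proof (rule B_add[OF _ poly_bounded_mult[OF const mQ] xt(1) order.refl])
        \<comment> \<open>The sum is factored as (\<rho> + 2 \<gamma>) \<rho> Q0 so that closure
          under products applies; the first factor is s + \<gamma>.\<close>
        have "poly_bounded (\<lambda>p. (\<rho> p + of_real (2 * \<gamma>)) * (\<rho> p * Q0 p))"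
        proof (rule poly_bounded_mult[OF _ \<rho>Q])
          obtain K where K: "\<And>p. 1 \<le> Re p \<Longrightarrow> norm (s p) \<le> K * norm p"
            using symbol_growth by metis
          show "poly_bounded (\<lambda>p. \<rho> p + of_real (2 * \<gamma>))"
          proof (rule poly_bounded_linear)
            show "(\<lambda>p. \<rho> p + of_real (2 * \<gamma>)) holomorphic_on {p. 0 < Re p}"
              unfolding \<rho>_def by (intro holomorphic_intros holomorphic_s)
            fix p :: complex assume p: "1 \<le> Re p"
            have "norm (s p + of_real \<gamma>) \<le> norm (s p) + norm (of_real \<gamma> :: complex)"
              by (rule norm_triangle_ineq)
            also have "\<dots> \<le> K * norm p + \<gamma> * norm p"
            proof -
              have "norm (of_real \<gamma> :: complex) = \<gamma>"
                using pos(4) by simp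
              then show ?thesis
                using K[OF p] le_mult_norm[OF p less_imp_le[OF pos(4)]] by linarith
            qed
            finally show "norm (\<rho> p + of_real (2 * \<gamma>)) \<le> (K + \<gamma>) * norm p"
              by (simp add: \<rho>_def algebra_simps)
          qed
        qed
        then show "poly_bounded (\<lambda>p. \<rho> p * (\<rho> p * Q0 p) + of_real (2 * \<gamma>) * (\<rho> p * Q0 p))"
          by (simp only: distrib_right)
      qed
      then show ?thesis
        by (simp only: P)
    qed
    also have "B (\<lambda>p. \<rho> p * (\<rho> p * Q0 p) + of_real (2 * \<gamma>) * (\<rho> p * Q0 p)) x 0 t =
        B (\<lambda>p. \<rho> p * (\<rho> p * Q0 p)) x 0 t + B (\<lambda>p. of_real (2 * \<gamma>) * (\<rho> p * Q0 p)) x 0 t"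
      by (rule B_add[OF \<rho>\<rho>Q poly_bounded_mult[OF const \<rho>Q] xt(1) order.refl])
    finally have eq: "B (\<lambda>p. P p * Q0 p) x 0 t = B (\<lambda>p. \<rho> p * (\<rho> p * Q0 p)) x 0 t
        + 2 * \<gamma> * B (\<lambda>p. \<rho> p * Q0 p) x 0 t + - \<alpha> * B (\<lambda>p. m p * Q0 p) x 0 t"
      unfolding B_cmult .
    have "((\<lambda>\<zeta>. B Q0 x \<zeta> t) has_real_derivative - B (\<lambda>p. m p * Q0 p) x 0 t) (at 0 within {0..})"
      by (rule B_derivative_z[OF Q xt(1) order.refl])
    moreover have "caputo (2 * \<beta>) (\<lambda>s. B Q0 x 0 s) t =
          deriv (deriv (\<lambda>\<xi>. B Q0 \<xi> 0 t)) x - 2 * \<gamma> * deriv (\<lambda>\<xi>. B Q0 \<xi> 0 t) x + \<alpha> * - B (\<lambda>p. m p * Q0 p) x 0 t"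
      unfolding B_caputo(2)[OF Q xt(1) order.refl] eq DERIV_imp_deriv[OF dx[OF Q xt(1) order.refl]] DERIV_imp_deriv[OF dxx[OF xt(1)]]
      by simp
    ultimately show "\<exists>u\<^sub>z. ((\<lambda>\<zeta>. B Q0 x \<zeta> t) has_real_derivative u\<^sub>z) (at 0 within {0..}) \<and>
        caputo (2 * \<beta>) (\<lambda>s. B Q0 x 0 s) t =
          deriv (deriv (\<lambda>\<xi>. B Q0 \<xi> 0 t)) x - 2 * \<gamma> * deriv (\<lambda>\<xi>. B Q0 \<xi> 0 t) x + \<alpha> * u\<^sub>z"
      by blast
  next
    fix t :: real assume t: "0 < t"
    have lim0: "((\<lambda>\<xi>. B Q0 \<xi> 0 t) \<longlongrightarrow> B Q0 0 0 t) (at_right 0)"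
    proof -
      have "((\<lambda>(x, z, t). B Q0 x z t) \<longlongrightarrow> B Q0 0 0 t) (at (0, 0, t) within {0..} \<times> {0..} \<times> {0..})"
        using cont t unfolding continuous_on by auto
      moreover have "filterlim (\<lambda>x::real. (x, 0::real, t)) (at (0, 0, t) within {0..} \<times> {0..} \<times> {0..}) (at_right 0)"
        unfolding filterlim_at
      proof (intro conjI tendsto_intros)
        show "\<forall>\<^sub>F x in at_right (0::real). (x, 0::real, t) \<in> {0..} \<times> {0..} \<times> {0..} \<and> (x, 0, t) \<noteq> (0, 0, t)"
          using eventually_at_right_less[of "0::real"] by eventually_elim (use t in auto)
      qed
      ultimately show ?thesis
        by (auto dest: filterlim_compose)
    qed
    \<comment> \<open>Since (s + \<gamma>) Q0 = 2 \<gamma> A / p, the x-derivative splits into 2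
      \<gamma> u, which is continuous up to x = 0, and -2 \<gamma> A times the integral with symbol
      1 / p, which tends to 1. The limit is exactly condition (a).\<close>
    have d: "((\<lambda>\<xi>. B Q0 \<xi> 0 t) has_real_derivative 2 * \<gamma> * B Q0 x 0 t - 2 * \<gamma> * A * B (\<lambda>p. 1 / p) x 0 t) (at x)"
      if x: "0 < x" for x
    proof -
      have eq: "\<rho> p * Q0 p = of_real (2 * \<gamma> * A) * (1 / p) + of_real (- (2 * \<gamma>)) * Q0 p" if "0 < Re p" for p
      proof -
        have gen: "w * (c / (p * w)) = c * (1 / p)" if "w \<noteq> 0" for w c :: complex
          using that by simp
        have "\<rho> p * Q0 p = (s p + of_real \<gamma>) * Q0 p - 2 * of_real \<gamma> * Q0 p"
          by (simp add: \<rho>_def algebra_simps)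
        also have "(s p + of_real \<gamma>) * Q0 p = of_real (2 * \<gamma> * A) * (1 / p)"
          unfolding Q0_def by (rule gen[OF s_plus_nonzero[OF that]])
        finally show ?thesis
          by simp
      qed
      have "B (\<lambda>p. \<rho> p * Q0 p) x 0 t = B (\<lambda>p. of_real (2 * \<gamma> * A) * (1 / p) + of_real (- (2 * \<gamma>)) * Q0 p) x 0 t"
        by (rule B_cong[OF eq])
      also have "\<dots> = 2 * \<gamma> * A * B (\<lambda>p. 1 / p) x 0 t + - (2 * \<gamma>) * B Q0 x 0 t"
        unfolding B_add[OF poly_bounded_mult[OF const poly_bounded_inverse] poly_bounded_mult[OF const Q] x order.refl] B_cmult ..
      finally show ?thesis
        using dx[OF Q x order.refl, of t] by simp
    qed
    have "((\<lambda>x. 2 * \<gamma> * B Q0 x 0 t - 2 * \<gamma> * A * B (\<lambda>p. 1 / p) x 0 t) \<longlongrightarrow> 2 * \<gamma> * B Q0 0 0 t - 2 * \<gamma> * A * 1) (at_right 0)"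
      by (intro tendsto_intros lim0 boundary_kernel_limit t)
    from has_real_derivative_at_0_from_limit[OF lim0 d this]
    show "\<exists>u\<^sub>x. ((\<lambda>\<xi>. B Q0 \<xi> 0 t) has_real_derivative u\<^sub>x) (at 0 within {0..}) \<and>
        u\<^sub>x - 2 * \<gamma> * B Q0 0 0 t = - 2 * \<gamma> * A"
      by (intro exI conjI) auto
  next
    fix T \<epsilon> :: real assume "0 < \<epsilon>"
    then show "\<exists>R. \<forall>x\<ge>0. \<forall>z\<ge>0. \<forall>t\<in>{0..T}. x\<^sup>2 + z\<^sup>2 > R \<longrightarrow> \<bar>B Q0 x z t\<bar> < \<epsilon>"
      by (rule B_Q0_decay)
  next
    fix x z :: real assume "0 \<le> x" "0 \<le> z"
    then show "B Q0 x z 0 = 0"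
      unfolding B_def using bromwich_nonpos[OF decaying_Q0_E zero_less_one] by simp
  qed
qed

section \<open>Identification with the stated formula\<close>

lemma cnj_symbols:
  assumes p: "0 < Re p"
  shows "P (cnj p) = cnj (P p)" and "R (cnj p) = cnj (R p)"
proof -
  have nonpos: "w \<notin> \<real>\<^sub>\<le>\<^sub>0" if "0 < Re w" for w
    using that by (auto simp: complex_nonpos_Reals_iff)
  show P: "P (cnj p) = cnj (P p)"
    unfolding P_def using cnj_powr[of p "of_real (2 * \<beta>)"] p by simp
  have "0 < Re (P p + of_real (lam\<^sup>2 / (4 * a\<^sup>2)))"
    using Re_P_pos[OF p] unfolding \<mu>2 by (simp add: add_pos_nonneg)
  from cnj_csqrt[OF nonpos[OF this]] show "R (cnj p) = cnj (R p)"
    unfolding R_def P by simp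
qed

text \<open>For \<tau> > 0 the real part of P makes exp (-\<tau> P) decay faster than any power of
  |p|, and one power beyond 1 / p is enough. At \<tau> = 0 the symbol would be 1 / p, whose decay is
  too slow.\<close>

lemma decaying_G1:
  assumes \<tau>: "0 < \<tau>" and \<sigma>: "0 < \<sigma>"
  shows "decaying \<sigma> (\<lambda>p. exp (- of_real \<tau> * P p) / p)"
proof -
  obtain C where C: "0 < C" "\<And>r. 0 < r \<Longrightarrow> exp (- (\<tau> * \<kappa>) * r powr (2 * \<beta>)) \<le> C * r powr - 1"
    using exp_powr_decay[of "\<tau> * \<kappa>" "2 * \<beta>" 1] \<tau> \<kappa>_pos \<beta> by auto
  show ?thesis
  proof (rule decayingI[where k = 2 and C = C])
    show "(\<lambda>p. exp (- of_real \<tau> * P p) / p) holomorphic_on {p. 0 < Re p}"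
      by (intro holomorphic_intros holomorphic_P) auto
    fix p assume "\<sigma> \<le> Re p"
    then have p: "0 < Re p"
      using \<sigma> by simp
    then have np: "0 < norm p"
      by auto
    have "norm (exp (- of_real \<tau> * P p)) = exp (- (\<tau> * Re (P p)))"
      by simp
    also have "\<dots> \<le> exp (- (\<tau> * \<kappa>) * norm p powr (2 * \<beta>))"
      using mult_left_mono[OF Re_P_ge[OF p] less_imp_le[OF \<tau>]] by (simp add: mult.assoc)
    also have "\<dots> \<le> C * norm p powr - 1"
      by (rule C(2)[OF np])
    finally have "norm (exp (- of_real \<tau> * P p) / p) \<le> C * norm p powr - 1 / norm p"
      unfolding norm_divide by (rule divide_right_mono) simp
    also have "C * norm p powr - 1 / norm p = C * norm p powr - 2"
    proof -
      have "norm p powr (- 1 - 1) = norm p powr - 1 / norm p"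
        unfolding powr_diff using np by simp
      then have "norm p powr - 1 / norm p = norm p powr - 2"
        by simp
      then show ?thesis
        unfolding times_divide_eq_right[symmetric] by (simp only:)
    qed
    finally show "norm (exp (- of_real \<tau> * P p) / p) \<le> C * norm p powr - 2" .
  qed simp
qed

lemma decaying_G2:
  assumes c: "0 < c" and \<sigma>: "0 < \<sigma>"
  shows "decaying \<sigma> (\<lambda>p. exp (- of_real c * R p))"
proof -
  obtain C where C: "0 < C" "\<And>r. 0 < r \<Longrightarrow> exp (- (c * sqrt \<kappa>) * r powr \<beta>) \<le> C * r powr - 2"
    using exp_powr_decay[of "c * sqrt \<kappa>" \<beta> 2] c \<kappa>_pos \<beta> by auto
  show ?thesis
  proof (rule decayingI[where k = 2 and C = C])
    show "(\<lambda>p. exp (- of_real c * R p)) holomorphic_on {p. 0 < Re p}"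
      by (intro holomorphic_intros holomorphic_R)
    fix p assume "\<sigma> \<le> Re p"
    then have p: "0 < Re p"
      using \<sigma> by simp
    then have np: "0 < norm p"
      by auto
    have "norm (exp (- of_real c * R p)) = exp (- (c * Re (R p)))"
      by simp
    also have "\<dots> \<le> exp (- (c * sqrt \<kappa>) * norm p powr \<beta>)"
      using mult_left_mono[OF Re_R_ge(2)[OF p] less_imp_le[OF c]] by (simp add: mult.assoc)
    also have "\<dots> \<le> C * norm p powr - 2"
      by (rule C(2)[OF np])
    finally show "norm (exp (- of_real c * R p)) \<le> C * norm p powr - 2" .
  qed simp
qed

lemma g2_eq_bromwich:
  assumes \<tau>: "0 < \<tau>" and z: "0 \<le> z"
  shows "g2 a lam \<alpha> t \<tau> z \<beta> =
    Re (bromwich 1 (\<lambda>p. exp (- of_real \<tau> * P p) / p * exp (- of_real ((z + \<alpha> * \<tau>) / a) * R p)) t)"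
proof -
  define c where "c = (z + \<alpha> * \<tau>) / a"
  have c: "0 < c"
    using \<tau> z pos by (simp add: c_def add_nonneg_pos)
  define G1 where "G1 p = exp (- of_real \<tau> * P p) / p" for p
  define G2 where "G2 p = exp (- of_real c * R p)" for p
  have d1: "decaying \<sigma> G1" and d2: "decaying \<sigma> G2" if "0 < \<sigma>" for \<sigma>
    unfolding G1_def G2_def using decaying_G1[OF \<tau> that] decaying_G2[OF c that] by simp_all
  have sym: "G1 (cnj p) = cnj (G1 p)" "G2 (cnj p) = cnj (G2 p)" if "0 < Re p" for p
    unfolding G1_def G2_def cnj_symbols[OF that] by (simp_all add: exp_cnj)
  define \<phi> where "\<phi> r = Re (bromwich 1 G2 r)" for r
  have L: "is_inverse_laplace G2 \<phi>"
    unfolding \<phi>_def by (rule inverse_laplace_bromwich(1)[OF d2 sym(2)])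
  have L': "set_integrable lborel {0..} (\<lambda>r. exp (- p * of_real r) * complex_of_real (\<phi> r))"
    "laplace \<phi> p = G2 p" if "0 < Re p" for p
    using L that unfolding is_inverse_laplace_def by blast+
  have \<phi>_int: "set_integrable lborel {0..} (\<lambda>r. exp (- 1 * r) * \<phi> r)"
    using laplace_Re(1)[OF L'(1)[of "of_real 1"]] by simp
  have \<Phi>: "(LBINT r:{0..}. exp (- Complex 1 \<omega> * of_real r) * of_real (\<phi> r)) = G2 (Complex 1 \<omega>)" for \<omega>
    using L'(2)[of "Complex 1 \<omega>"] unfolding laplace_def by simp
  note conv = convolution_bromwich[OF d1[OF zero_less_one] zero_less_one \<phi>_int \<Phi>, of t]
  have "g2 a lam \<alpha> t \<tau> z \<beta> = (LBINT r:{0..t}. inverse_laplace G1 (t - r) * inverse_laplace G2 r)"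
    unfolding g2_def Defs.convolution_def G1_def G2_def P_def R_def c_def ..
  also have "\<dots> = (LBINT r. Re (indicator {0..t} r *\<^sub>R (bromwich 1 G1 (t - r) * of_real (\<phi> r))))"
    unfolding set_lebesgue_integral_def
  \<comment> \<open>The inverses are known only at positive times, so the endpoints r = 0 and r = t,
    a null set, are left out.\<close>
  proof (rule integral_discrete_difference[of "{0, t}"])
    fix r assume "r \<notin> {0, t}"
    then show "indicator {0..t} r *\<^sub>R (inverse_laplace G1 (t - r) * inverse_laplace G2 r)
        = Re (indicator {0..t} r *\<^sub>R (bromwich 1 G1 (t - r) * of_real (\<phi> r)))"
      using inverse_laplace_bromwich(2)[OF d1 sym(1), of "t - r"] inverse_laplace_bromwich(2)[OF d2 sym(2), of r]
      by (cases "r \<in> {0..t}") (auto simp: \<phi>_def)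
  qed auto
  also have "\<dots> = Re (LBINT r:{0..t}. bromwich 1 G1 (t - r) * of_real (\<phi> r))"
    unfolding set_lebesgue_integral_def using conv(1) unfolding set_integrable_def by (rule integral_Re)
  also have "\<dots> = Re (bromwich 1 (\<lambda>p. G1 p * G2 p) t)"
    unfolding conv(2) ..
  finally show ?thesis
    unfolding G1_def G2_def c_def .
qed

text \<open>The exponent 1/4 is chosen for the majorant in the exchange of integrals: it is small
  enough that \<tau>^(-1/2) \<tau>^(-1/4) remains integrable at 0, and being positive it gains a
  power of |p| beyond 1 / |p|.\<close>

lemma powr_quarter_exp_le:
  fixes y :: real
  assumes y: "0 < y"
  shows "exp (- y) \<le> y powr - (1 / 4)"
proof -
  have "y powr (1 / 4) \<le> exp y"
  proof (cases "y \<le> 1")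
    case True
    then have "y powr (1 / 4) \<le> 1 powr (1 / 4)"
      using y by (intro powr_mono2) auto
    show ?thesis
    proof -
      have "1 \<le> exp y"
        using y by simp
      with \<open>y powr (1 / 4) \<le> 1 powr (1 / 4)\<close> show ?thesis
        using powr_one_eq_one[of "1 / 4 :: real"] by linarith
    qed
  next
    case False
    then have "y powr (1 / 4) \<le> y powr 1"
      using y by (intro powr_mono) auto
    then have "y powr (1 / 4) \<le> y"
      using y by simp
    then show ?thesis
      using exp_ge_add_one_self[of y] by linarith
  qed
  then have "inverse (exp y) \<le> inverse (y powr (1 / 4))"
    using y by (intro le_imp_inverse_le) auto
  then show ?thesis
    by (simp add: exp_minus powr_minus)
qed

text \<open>Since R = a m + \<mu>, the factor exp (lam (z + \<alpha> \<tau>) / (2 a^2)) turns exp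
  (-(z + \<alpha> \<tau>) R / a) into exp (-z m) exp (-\<alpha> \<tau> m). Together with exp
  (-\<tau> P) this makes the \<tau>-integral the transform of the Robin kernel at P + \<alpha> m.
  Most of the work goes into a majorant that allows the exchange of integrals.\<close>

lemma formula_eq_B_Q0:
  assumes x: "0 \<le> x" and z: "0 \<le> z"
  shows "2 * \<gamma> * A * exp (\<gamma> * x) *
        (LBINT \<tau>:{0..}. robin_kernel \<gamma> x \<tau> * exp (lam / (2 * a\<^sup>2) * (z + \<alpha> * \<tau>)) * g2 a lam \<alpha> t \<tau> z \<beta>)
    = B Q0 x z t"
proof -
  define q where "q p = P p + of_real \<alpha> * m p" for p
  define Z where "Z p = exp (- of_real z * m p) / p" for p
  define F where "F \<tau> \<omega> = indicator {0<..} \<tau> *\<^sub>R (of_real (robin_kernel \<gamma> x \<tau>) *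
      (exp (of_real t * Complex 1 \<omega>) * (Z (Complex 1 \<omega>) * exp (- of_real \<tau> * q (Complex 1 \<omega>))))) / of_real (2 * pi)" for \<tau> \<omega>
  have holq: "q holomorphic_on {p. 0 < Re p}" and holZ: "Z holomorphic_on {p. 0 < Re p}"
    unfolding q_def Z_def by (intro holomorphic_intros holomorphic_P holomorphic_m; auto)+
  have [measurable]: "(\<lambda>\<omega>. q (Complex 1 \<omega>)) \<in> borel_measurable borel" "(\<lambda>\<omega>. Z (Complex 1 \<omega>)) \<in> borel_measurable borel"
    by (intro measurable_line holomorphic_on_imp_continuous_on holq holZ zero_less_one)+
  have meas: "(\<lambda>(\<tau>, \<omega>). F \<tau> \<omega>) \<in> borel_measurable (lborel \<Otimes>\<^sub>M lborel)"
    unfolding F_def by measurable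
  define \<delta> where "\<delta> = 2 * \<beta>"
  define g where "g \<tau> = indicator {0..} \<tau> * (exp (- (\<kappa> / 2) * \<tau>) * \<tau> powr - (3 / 4))
      + (2 * \<gamma> * exp (\<gamma> * x)) * (indicator {0..} \<tau> * (exp (- (\<kappa> / 2) * \<tau>) * \<tau> powr - (1 / 4)))" for \<tau>
  define h where "h \<omega> = (exp t * (\<kappa> / 2) powr - (1 / 4) / (2 * pi)) * norm (Complex 1 \<omega>) powr - (1 + \<delta> / 4)" for \<omega>
  have g: "integrable lborel g"
    unfolding g_def using laplace_powr_real(1)[of "3 / 4" "\<kappa> / 2"] laplace_powr_real(1)[of "1 / 4" "\<kappa> / 2"] \<kappa>_pos
    unfolding set_integrable_def by (intro Bochner_Integration.integrable_add integrable_mult_right) auto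
  have h: "integrable lborel h"
    unfolding h_def \<delta>_def using \<beta> by (intro integrable_mult_right integrable_norm_line) auto
  have bound: "norm (F \<tau> \<omega>) \<le> g \<tau> * h \<omega>" for \<tau> \<omega>
  proof (cases "0 < \<tau>")
    case True
    define p where "p = Complex 1 \<omega>"
    define r where "r = norm p powr \<delta>"
    have p: "1 \<le> Re p" "0 < Re p"
      by (auto simp: p_def)
    have np: "1 \<le> norm p"
      by (rule norm_ge_1[OF p(1)])
    have r: "1 \<le> r"
      unfolding r_def \<delta>_def using np \<beta> by (intro ge_one_powr_ge_zero) auto
    have "norm (exp (- of_real \<tau> * q p)) = exp (- (\<tau> * Re (q p)))"
      by simp
    also have "\<dots> \<le> exp (- (\<tau> * (\<kappa> * r)))"
      using mult_left_mono[OF Re_q_ge[OF p(2)] less_imp_le[OF True]] by (simp add: q_def r_def \<delta>_def)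
    \<comment> \<open>One half of the exponential keeps the decay in \<tau>, using r \<ge> 1; the
      other half is traded for negative powers of \<tau> and |p|.\<close>
    also have "\<dots> = exp (- (\<tau> * \<kappa> * r / 2)) * exp (- (\<tau> * \<kappa> * r / 2))"
      unfolding exp_add[symmetric] by simp
    also have "\<dots> \<le> exp (- (\<kappa> / 2) * \<tau>) * (\<tau> * \<kappa> * r / 2) powr - (1 / 4)"
    proof (rule mult_mono)
      have "\<tau> * \<kappa> * 1 \<le> \<tau> * \<kappa> * r"
        using r True \<kappa>_pos by (intro mult_left_mono) auto
      then show "exp (- (\<tau> * \<kappa> * r / 2)) \<le> exp (- (\<kappa> / 2) * \<tau>)"
        by (simp add: mult.commute)
      show "exp (- (\<tau> * \<kappa> * r / 2)) \<le> (\<tau> * \<kappa> * r / 2) powr - (1 / 4)"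
        using True \<kappa>_pos r by (intro powr_quarter_exp_le) auto
    qed auto
    also have "(\<tau> * \<kappa> * r / 2) powr - (1 / 4) = \<tau> powr - (1 / 4) * (\<kappa> / 2) powr - (1 / 4) * norm p powr - (\<delta> / 4)"
    proof -
      have "\<tau> * \<kappa> * r / 2 = \<tau> * (\<kappa> / 2) * r"
        by simp
      moreover have "r powr - (1 / 4) = norm p powr - (\<delta> / 4)"
        unfolding r_def powr_powr by simp
      moreover have gen: "(x1 * x2 * x3) powr e = x1 powr e * x2 powr e * x3 powr e"
        if "0 < x1" "0 < x2" "0 < x3" for x1 x2 x3 e :: real
        using that by (simp add: powr_mult)
      have "(\<tau> * (\<kappa> / 2) * r) powr - (1 / 4) = \<tau> powr - (1 / 4) * (\<kappa> / 2) powr - (1 / 4) * r powr - (1 / 4)"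
        by (rule gen) (use True \<kappa>_pos r in auto)
      ultimately show ?thesis
        by (simp only:)
    qed
    finally have eq: "norm (exp (- of_real \<tau> * q p)) \<le>
        exp (- (\<kappa> / 2) * \<tau>) * (\<tau> powr - (1 / 4) * (\<kappa> / 2) powr - (1 / 4) * norm p powr - (\<delta> / 4))" .
    have "norm (exp (- of_real z * m p)) \<le> 1"
      using Re_m_nonneg[OF p(2)] z by simp
    then have Z: "norm (Z p) \<le> 1 / norm p"
      unfolding Z_def norm_divide by (intro divide_right_mono) auto
    have K: "\<bar>robin_kernel \<gamma> x \<tau>\<bar> \<le> \<tau> powr - (1 / 2) + 2 * \<gamma> * exp (\<gamma> * x)"
      using True pos by (intro abs_robin_kernel_le) auto
    have "norm (F \<tau> \<omega>) = \<bar>robin_kernel \<gamma> x \<tau>\<bar> * (exp t * (norm (Z p) * norm (exp (- of_real \<tau> * q p)))) / (2 * pi)"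
      unfolding F_def p_def norm_divide norm_mult norm_scaleR norm_exp_line using True by simp
    also have "\<dots> \<le> (\<tau> powr - (1 / 2) + 2 * \<gamma> * exp (\<gamma> * x)) * (exp t * (1 / norm p *
        (exp (- (\<kappa> / 2) * \<tau>) * (\<tau> powr - (1 / 4) * (\<kappa> / 2) powr - (1 / 4) * norm p powr - (\<delta> / 4))))) / (2 * pi)"
      using K Z eq np pos by (intro divide_right_mono mult_mono mult_left_mono mult_nonneg_nonneg add_nonneg_nonneg) auto
    also have "\<dots> = (\<tau> powr - (1 / 2) * \<tau> powr - (1 / 4) * exp (- (\<kappa> / 2) * \<tau>) + 2 * \<gamma> * exp (\<gamma> * x) * (exp (- (\<kappa> / 2) * \<tau>) * \<tau> powr - (1 / 4)))
        * ((exp t * (\<kappa> / 2) powr - (1 / 4) / (2 * pi)) * (norm p powr - (\<delta> / 4) / norm p))"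
    proof -
      have "(T1 + c) * (e * (1 / n * (e' * (T2 * k * N)))) / w = (T1 * T2 * e' + c * (e' * T2)) * ((e * k / w) * (N / n))"
        for T1 c e n e' T2 k N w :: real
      proof -
        have "X * (e * (1 / n * (e' * (T2 * k * N)))) / w = (X * (e' * T2)) * ((e * k / w) * (N / n))" for X
          by (simp add: mult_ac)
        moreover have "(T1 + c) * (e' * T2) = T1 * T2 * e' + c * (e' * T2)"
          by (simp add: algebra_simps)
        ultimately show ?thesis
          by (simp only:)
      qed
      then show ?thesis .
    qed
    also have "\<tau> powr - (1 / 2) * \<tau> powr - (1 / 4) = \<tau> powr - (3 / 4)"
      by (simp add: powr_add[symmetric])
    also have "norm p powr - (\<delta> / 4) / norm p = norm p powr - (1 + \<delta> / 4)"
    proof -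
      have "- (1 + \<delta> / 4) = - (\<delta> / 4) - 1"
        by simp
      then have "norm p powr - (1 + \<delta> / 4) = norm p powr (- (\<delta> / 4) - 1)"
        by (rule arg_cong)
      also have "\<dots> = norm p powr - (\<delta> / 4) / norm p"
        unfolding powr_diff using np by simp
      finally show ?thesis ..
    qed
    finally show ?thesis
      using True unfolding g_def h_def p_def by (simp add: mult.commute)
  next
    case False
    have "0 \<le> g \<tau>" "0 \<le> h \<omega>"
      unfolding g_def h_def using pos by auto
    then show ?thesis
      using False by (simp add: F_def)
  qed
  note fub = Fubini_lborel_product_bound[OF meas g h bound]
  have inner: "(LBINT \<omega>. F \<tau> \<omega>) = indicator {0<..} \<tau> *\<^sub>R (of_real (robin_kernel \<gamma> x \<tau>) * bromwich 1 (\<lambda>p. Z p * exp (- of_real \<tau> * q p)) t)" for \<tau>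
    unfolding F_def bromwich_def by (simp add: scaleR_conv_of_real)
  have outer: "(LBINT \<tau>. F \<tau> \<omega>) = exp (of_real t * Complex 1 \<omega>) * (Z (Complex 1 \<omega>) *
      (exp (- of_real x * s (Complex 1 \<omega>)) / (s (Complex 1 \<omega>) + of_real \<gamma>))) / of_real (2 * pi)" for \<omega>
  proof -
    define p where "p = Complex 1 \<omega>"
    have p: "0 < Re p"
      by (simp add: p_def)
    define c where "c = exp (of_real t * p) * Z p / of_real (2 * pi)"
    have "F \<tau> \<omega> = (indicator {0<..} \<tau> *\<^sub>R (exp (- q p * of_real \<tau>) * complex_of_real (robin_kernel \<gamma> x \<tau>))) * c" for \<tau>
      unfolding F_def p_def[symmetric] c_def scaleR_conv_of_real by (simp add: mult_ac)
    then have "(LBINT \<tau>. F \<tau> \<omega>) = (LBINT \<tau>. (indicator {0<..} \<tau> *\<^sub>R (exp (- q p * of_real \<tau>) * complex_of_real (robin_kernel \<gamma> x \<tau>))) * c)"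
      by presburger
    also have "\<dots> = (LBINT \<tau>:{0<..}. exp (- q p * of_real \<tau>) * complex_of_real (robin_kernel \<gamma> x \<tau>)) * c"
      unfolding set_lebesgue_integral_def by (rule integral_mult_left_zero)
    also have "(LBINT \<tau>:{0<..}. exp (- q p * of_real \<tau>) * complex_of_real (robin_kernel \<gamma> x \<tau>))
        = (LBINT \<tau>:{0..}. exp (- q p * of_real \<tau>) * complex_of_real (robin_kernel \<gamma> x \<tau>))"
      by (rule set_integral_Ioi_eq_Ici) measurable
    also have "\<dots> = exp (- of_real x * s p) / (s p + of_real \<gamma>)"
      using laplace_robin_kernel[OF pos(4) _ x, of "q p"] Re_q_pos[OF p] unfolding q_def s_def by simp
    finally show ?thesis
      unfolding c_def p_def by simp
  qed
  have integrand: "indicator {0..} \<tau> *\<^sub>R (robin_kernel \<gamma> x \<tau> * exp (lam / (2 * a\<^sup>2) * (z + \<alpha> * \<tau>)) * g2 a lam \<alpha> t \<tau> z \<beta>)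
      = Re (LBINT \<omega>. F \<tau> \<omega>)" if "\<tau> \<notin> {0}" for \<tau>
  proof (cases "0 < \<tau>")
    case True
    define c where "c = (z + \<alpha> * \<tau>) / a"
    have c\<mu>: "lam / (2 * a\<^sup>2) * (z + \<alpha> * \<tau>) = c * \<mu>"
      unfolding c_def \<mu>_def by (simp add: power2_eq_square mult_ac)
    have eq: "of_real (exp (c * \<mu>)) * (exp (- of_real \<tau> * P p) / p * exp (- of_real c * R p)) = Z p * exp (- of_real \<tau> * q p)" for p
    proof -
      have ca: "complex_of_real c * of_real a = of_real (z + \<alpha> * \<tau>)"
        unfolding of_real_mult[symmetric] c_def using pos by simp
      have Rm: "R p = of_real a * m p + of_real \<mu>"
        using pos by (simp add: m_def)
      have "of_real c * of_real \<mu> + (- of_real \<tau> * P p + - of_real c * R p) = - (of_real c * of_real a) * m p - of_real \<tau> * P p"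
        unfolding Rm by (simp add: algebra_simps)
      also have "\<dots> = - of_real z * m p + - of_real \<tau> * q p"
        unfolding ca q_def by (simp add: algebra_simps)
      finally have "exp (of_real c * of_real \<mu> + (- of_real \<tau> * P p + - of_real c * R p)) = exp (- of_real z * m p + - of_real \<tau> * q p)"
        by (rule arg_cong)
      then have "exp (of_real c * of_real \<mu>) * (exp (- of_real \<tau> * P p) * exp (- of_real c * R p)) = exp (- of_real z * m p) * exp (- of_real \<tau> * q p)"
        unfolding exp_add .
      then have "exp (of_real c * of_real \<mu>) * (exp (- of_real \<tau> * P p) * exp (- of_real c * R p)) / p = exp (- of_real z * m p) * exp (- of_real \<tau> * q p) / p"
        by (rule arg_cong)
      then show ?thesis
        unfolding Z_def exp_of_real[symmetric] of_real_mult by simp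
    qed
    have "exp (c * \<mu>) * g2 a lam \<alpha> t \<tau> z \<beta> = Re (of_real (exp (c * \<mu>)) * bromwich 1 (\<lambda>p. exp (- of_real \<tau> * P p) / p * exp (- of_real c * R p)) t)"
      unfolding g2_eq_bromwich[OF True z] c_def by simp
    also have "\<dots> = Re (bromwich 1 (\<lambda>p. Z p * exp (- of_real \<tau> * q p)) t)"
      unfolding bromwich_cmult[symmetric] eq ..
    finally have "exp (c * \<mu>) * g2 a lam \<alpha> t \<tau> z \<beta> = Re (bromwich 1 (\<lambda>p. Z p * exp (- of_real \<tau> * q p)) t)" .
    then show ?thesis
      using True unfolding inner c\<mu> by (simp add: mult.assoc)
  next
    case False
    then show ?thesis
      using that unfolding inner by simp
  qed
  have "(LBINT \<tau>:{0..}. robin_kernel \<gamma> x \<tau> * exp (lam / (2 * a\<^sup>2) * (z + \<alpha> * \<tau>)) * g2 a lam \<alpha> t \<tau> z \<beta>)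
      = (LBINT \<tau>. Re (LBINT \<omega>. F \<tau> \<omega>))"
    unfolding set_lebesgue_integral_def
    by (rule integral_discrete_difference[of "{0}"]) (rule integrand | simp)+
  also have "\<dots> = Re (LBINT \<tau>. LBINT \<omega>. F \<tau> \<omega>)"
    by (rule integral_Re[OF fub(2)])
  also have "(LBINT \<tau>. LBINT \<omega>. F \<tau> \<omega>) = (LBINT \<omega>. LBINT \<tau>. F \<tau> \<omega>)"
    by (rule fub(1))
  also have "\<dots> = bromwich 1 (\<lambda>p. Z p * (exp (- of_real x * s p) / (s p + of_real \<gamma>))) t"
    unfolding outer bromwich_def integral_divide_zero[symmetric] ..
  finally have F: "2 * \<gamma> * A * exp (\<gamma> * x) *
      (LBINT \<tau>:{0..}. robin_kernel \<gamma> x \<tau> * exp (lam / (2 * a\<^sup>2) * (z + \<alpha> * \<tau>)) * g2 a lam \<alpha> t \<tau> z \<beta>)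
      = Re (of_real (2 * \<gamma> * A * exp (\<gamma> * x)) * bromwich 1 (\<lambda>p. Z p * (exp (- of_real x * s p) / (s p + of_real \<gamma>))) t)"
    by simp
  have "of_real (2 * \<gamma> * A * exp (\<gamma> * x)) * (Z p * (exp (- of_real x * s p) / (s p + of_real \<gamma>))) = Q0 p * E x z p" for p
  proof -
    have "- of_real x * (s p - of_real \<gamma>) = of_real (\<gamma> * x) + - of_real x * s p"
      by (simp add: algebra_simps)
    then have "E x z p = of_real (exp (\<gamma> * x)) * exp (- of_real x * s p) * exp (- of_real z * m p)"
      unfolding E_def exp_of_real[symmetric] by (simp only: exp_add)
    then show ?thesis
      unfolding Q0_def Z_def by (simp add: mult_ac)
  qed
  then have "Re (of_real (2 * \<gamma> * A * exp (\<gamma> * x)) * bromwich 1 (\<lambda>p. Z p * (exp (- of_real x * s p) / (s p + of_real \<gamma>))) t) = B Q0 x z t"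
    unfolding bromwich_cmult[symmetric] B_def by (simp only:)
  with F show ?thesis
    by (rule trans)
qed

end

theorem theorem2:
  fixes a lam A \<gamma> \<alpha> \<beta> :: real and u :: "real \<Rightarrow> real \<Rightarrow> real \<Rightarrow> real"
  assumes "0 < \<beta>" and "\<beta> < 1 / 2"
    and "0 < a" and "0 < lam" and "0 < A" and "0 < \<gamma>" and "0 < \<alpha>"
  shows "lumped_solution \<beta> a lam A \<gamma> \<alpha> u \<longleftrightarrow>
    (\<forall>x\<ge>0. \<forall>z\<ge>0. \<forall>t\<ge>0.
      u x z t = 2 * \<gamma> * A * exp (\<gamma> * x) *
        (LBINT \<tau>:{0..}.
          (1 / sqrt (pi * \<tau>) * exp (- (x\<^sup>2 / (4 * \<tau>) + \<tau> * \<gamma>\<^sup>2))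
            - \<gamma> * exp (\<gamma> * x) * erfc (x / (2 * sqrt \<tau>) + \<gamma> * sqrt \<tau>))
          * exp (lam / (2 * a\<^sup>2) * (z + \<alpha> * \<tau>)) * g2 a lam \<alpha> t \<tau> z \<beta>))"
proof -
  interpret lumped_problem \<beta> a lam A \<gamma> \<alpha>
    using assms by unfold_locales
  note formula = formula_eq_B_Q0[unfolded robin_kernel_def]
  have "lumped_solution \<beta> a lam A \<gamma> \<alpha> u \<longleftrightarrow> (\<forall>x\<ge>0. \<forall>z\<ge>0. \<forall>t\<ge>0. u x z t = B Q0 x z t)"
  proof (intro iffI allI impI)
    fix x z t :: real
    assume u: "lumped_solution \<beta> a lam A \<gamma> \<alpha> u" and "0 \<le> x" "0 \<le> z" "0 \<le> t"
    then show "u x z t = B Q0 x z t"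
      using lumped_solution_le[OF assms(1-4,6,7) u lumped_solution_B_Q0]
        lumped_solution_le[OF assms(1-4,6,7) lumped_solution_B_Q0 u] by (simp add: order_antisym)
  next
    assume "\<forall>x\<ge>0. \<forall>z\<ge>0. \<forall>t\<ge>0. u x z t = B Q0 x z t"
    then show "lumped_solution \<beta> a lam A \<gamma> \<alpha> u"
      by (intro lumped_solution_cong[OF assms(1,2) lumped_solution_B_Q0]) simp
  qed
  also have "\<dots> \<longleftrightarrow>
    (\<forall>x\<ge>0. \<forall>z\<ge>0. \<forall>t\<ge>0.
      u x z t = 2 * \<gamma> * A * exp (\<gamma> * x) *
        (LBINT \<tau>:{0..}.
          (1 / sqrt (pi * \<tau>) * exp (- (x\<^sup>2 / (4 * \<tau>) + \<tau> * \<gamma>\<^sup>2))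
            - \<gamma> * exp (\<gamma> * x) * erfc (x / (2 * sqrt \<tau>) + \<gamma> * sqrt \<tau>))
          * exp (lam / (2 * a\<^sup>2) * (z + \<alpha> * \<tau>)) * g2 a lam \<alpha> t \<tau> z \<beta>))"
    using formula by simp
  finally show ?thesis .
qed

end
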